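(* The subgroup $K=q_{\#}(\pi_1(\widehat{\mathbb{H}},\mathbf 1))$ is open in $\pi_1(\mathbb{H},\mathbf 0)$, where $\pi_1(\mathbb{H},\mathbf 0)$ carries the quotient topology of the compact-open topology on the space of based loops.
   Context: **Topology on $\pi_1$.** $\Omega(X,x)$ is the space of continuous loops $\alpha:([0,1],\{0,1\})\to(X,x)$ in the compact-open topology, and $\pi_1(X,x)$ carries the quotient topology induced by $\alpha\mapsto[\alpha]$. **Hawaiian Earring.** $\mathbb{H}=\bigcup_{i\in\mathbb N}C_i\subseteq\mathbb R^2$ with $C_i=\{(x,y)\in\mathbb{R}^2: x^2+(y-1/i)^2=1/i^2\}$, $i=1,2,3,\dots$, with the subspace topology and base point $\mathbf 0=(0,0)$. Let $l_i:[0,1]\to C_i$, $l_i(t)=((\sin 2\pi t)/i,(1-\cos 2\pi t)/i)$. **Words and Cayley tree.** Let $\mathcal W_n$ be the set of finite words over $\{a_1^{\pm1},\dots,a_n^{\pm1}\}$ and $\mathcal W=\bigcup_n\mathcal W_n$. For $w\in\mathcal W$, $w'$ is its complete free reduction and $|w|$ its length; $\mathbf 1$ denotes the empty word. Let $\Gamma$ be the directed Cayley graph of the free group on $\{a_1,a_2,\dots\}$: the vertex set $V$ is the set of reduced words, and there is a directed edge labeled $a_i$ from $u$ to $(ua_i)'$ for every $u\in V$, $i\in\mathbb N$. The underlying undirected graph is a tree. Fix a complete list $w_1,w_2,w_3,\dots$ of all non-empty words in $\mathcal W$. For each $j$ let $\widehat w_j=a_1a_2a_1a_2\cdots\in V$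 be the word with letters alternating between $a_1$ and $a_2$ (starting with $a_1$) of length $|\widehat w_j|=2(|w_1|+\cdots+|w_{j-1}|)+3j+|w_j|$. **The graph $\widehat{\mathbb H}$.** Step 1: If $w_j=x_1x_2\cdots x_m$ with letters $x_i$, let $Z_j=\{(\widehat w_jx_1\cdots x_i)': 0\le i\le m\}$. Let $Z$ be the set of vertices of the infinite ray in $\Gamma$ starting at $\mathbf 1$ and following the edges $a_1,a_2,a_1,a_2,\dots$. Step 2: Let $n=n(j)\ge2$ be minimal with $w_j\in\mathcal W_n$. For $u\in Z_j$ and $1\le s\le n$ let $L_{u,s}=\{(ua_s^r)': r\in\mathbb Z\}$. Let $Y_j=Z_j\cup\bigcup_{u\in Z_j,\,1\le s\le n}L_{u,s}$ and $Y=Z\cup\bigcup_jY_j$. (The sets $Y_j$ are pairwise disjoint.) Step 3: Let $\Gamma_0=\Gamma$. Inductively, $\Gamma_j$ is obtained from $\Gamma_{j-1}$ by removing all vertices $v$ at edge-distance $1$ from $Y_j$, unless $v$ is connected to $Y_j$ by an edge labeled $a_1$ or $a_2$ (in either direction), along with all edges incident to $v$ and all vertices and edges of $\Gamma_{j-1}$ separated from $Y_j$ in $\Gamma_{j-1}$ by $v$. Each $\Gamma_j$ is a subtree containing $Y$. Step 4: $\Gamma^*$ is obtained from $\bigcap_j\Gamma_j$ by removing all vertices $v$ (and incident edges) of the reduced form $v=ua_k^{\pm1}w$, where $u$ is a vertex of $\bigcap_j\Gamma_j$ of infinite valence, $k\notin\{1,2\}$ and $w\in\mathcal W$. For every vertex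 $v$ of the tree $\Gamma^*$ there is a finite set $E_v\subseteq\mathbb N$ such that the directed edges of $\Gamma^*$ terminating at $v$ are labeled exactly by $\{a_i:i\in E_v\}$ (one each), and likewise for the directed edges emanating from $v$. Step 5: For every vertex $v$ of $\Gamma^*$ and every $i\in\mathbb N\setminus E_v$ add a directed loop from $v$ to $v$ labeled $a_i$. The geometric realization of the resulting graph is $\widehat{\mathbb H}$, with base point the vertex $\mathbf 1$. **The map $q$ and the topology of $\widehat{\mathbb H}$.** In $\mathbb H$ put $V_i^-=l_i([0,3/8))$, $V_i^+=l_i((5/8,1])$, $U_i=l_i((1/4,3/4))$ and $U_{n+1}^\infty=\bigcup_{i=1}^n(V_i^-\cup V_i^+)\cup\bigcup_{i\ge n+1}C_i$. For a directed edge (or loop) $e$ of $\widehat{\mathbb H}$ labeled $a_i$ with parametrization $\psi_e:[0,1]\to e$, put $V_e^-=\psi_e([0,3/8))$, $V_e^+=\psi_e((5/8,1])$, $U_e=\psi_e((1/4,3/4))$. The map $q:\widehat{\mathbb H}\to\mathbb H$ is given by $q(\psi_e(t))=l_i(t)$ for every edge or loop $e$ labeled $a_i$ (so vertices map to $\mathbf 0$). For a vertex $v$, with $n\ge2$ minimal such that $E_v\subseteq\{1,\dots,n\}$, let $U_v$ be the union of all $V_e^-$ with $e$ an edge or loop emanating from $v$, all $V_e^+$ with $e$ an edge or loop terminating at $v$, and all entire loops at $v$ labeled $a_i$ with $i>n$; $q$ restricts to bijections $U_e\to U_i$ and $U_v\to U_{n+1}^\infty$. $\widehat{\mathbb H}$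 carries the unique topology making all $U_e$ and $U_v$ open and all the restrictions $q|_{U_e}:U_e\to U_i$ and $q|_{U_v}:U_v\to U_{n+1}^\infty$ homeomorphisms. **The subgroup $K$.** Every loop $\alpha$ in $\mathbb H$ at $\mathbf 0$ has a unique continuous lift $\widehat\alpha$ to $\widehat{\mathbb H}$ with $\widehat\alpha(0)=\mathbf 1$, homotopies likewise lift, and $K=\{[\alpha]\in\pi_1(\mathbb H,\mathbf 0):\widehat\alpha(1)=\mathbf 1\}=q_\#(\pi_1(\widehat{\mathbb H},\mathbf 1))$. *)

theory Defs
  imports "HOL-Analysis.Analysis" "HOL-Algebra.Group"
begin

section \<open>The fundamental group and its quotient topology\<close>

text \<open>Maps are taken extensional, so that the points of the space below are exactly
  the continuous maps from \<open>X\<close> to \<open>Y\<close>.\<close>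

definition compact_open_topology :: "'a topology \<Rightarrow> 'b topology \<Rightarrow> ('a \<Rightarrow> 'b) topology" where
  "compact_open_topology X Y = topology_generated_by
     {{f \<in> extensional (topspace X). continuous_map X Y f \<and> f ` C \<subseteq> U} |C U.
        compactin X C \<and> openin Y U}"

definition loop_space :: "'a topology \<Rightarrow> 'a \<Rightarrow> (real \<Rightarrow> 'a) topology" where
  "loop_space X x =
     subtopology (compact_open_topology (top_of_set {0..1}) X) {\<alpha>. \<alpha> 0 = x \<and> \<alpha> 1 = x}"

abbreviation loops :: "'a topology \<Rightarrow> 'a \<Rightarrow> (real \<Rightarrow> 'a) set" where
  "loops X x \<equiv> topspace (loop_space X x)"

definition loop_class :: "'a topology \<Rightarrow> 'a \<Rightarrow> (real \<Rightarrow> 'a) \<Rightarrow> (real \<Rightarrow> 'a) set" where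
  "loop_class X x \<alpha> =
     {\<beta> \<in> loops X x. homotopic_with (\<lambda>r. r 0 = x \<and> r 1 = x) (top_of_set {0..1}) X \<alpha> \<beta>}"

definition loop_concat :: "(real \<Rightarrow> 'a) \<Rightarrow> (real \<Rightarrow> 'a) \<Rightarrow> real \<Rightarrow> 'a" where
  "loop_concat \<alpha> \<beta> = restrict (\<lambda>t. if t \<le> 1/2 then \<alpha> (2 * t) else \<beta> (2 * t - 1)) {0..1}"

text \<open>Operations on classes are unions over all choices of representatives; since the
  operations respect homotopy, all the united classes coincide.\<close>

definition pi1 :: "'a topology \<Rightarrow> 'a \<Rightarrow> (real \<Rightarrow> 'a) set monoid" where
  "pi1 X x = \<lparr>carrier = loop_class X x ` loops X x,
     monoid.mult = (\<lambda>A B. \<Union>\<alpha>\<in>A. \<Union>\<beta>\<in>B. loop_class X x (loop_concat \<alpha> \<beta>)),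
     one = loop_class X x (\<lambda>t\<in>{0..1}. x)\<rparr>"

definition pi1_topology :: "'a topology \<Rightarrow> 'a \<Rightarrow> (real \<Rightarrow> 'a) set topology" where
  "pi1_topology X x = topology (\<lambda>U. U \<subseteq> carrier (pi1 X x) \<and>
     openin (loop_space X x) {\<alpha> \<in> loops X x. loop_class X x \<alpha> \<in> U})"

definition pi1_map ::
    "('a \<Rightarrow> 'b) \<Rightarrow> 'b topology \<Rightarrow> 'b \<Rightarrow> (real \<Rightarrow> 'a) set \<Rightarrow> (real \<Rightarrow> 'b) set" where
  "pi1_map f Y y A = (\<Union>\<alpha>\<in>A. loop_class Y y (restrict (f \<circ> \<alpha>) {0..1}))"

lemma topspace_compact_open_topology:
  "topspace (compact_open_topology X Y) = {f \<in> extensional (topspace X). continuous_map X Y f}"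
  unfolding compact_open_topology_def topology_generated_by_topspace
  using compactin_empty openin_empty by blast

lemma loops_iff:
  "\<alpha> \<in> loops X x \<longleftrightarrow> \<alpha> \<in> extensional {0..1} \<and> pathin X \<alpha> \<and> \<alpha> 0 = x \<and> \<alpha> 1 = x"
  by (auto simp: loop_space_def topspace_compact_open_topology pathin_def)

lemma openin_pi1_topology:
  "openin (pi1_topology X x) U \<longleftrightarrow> U \<subseteq> carrier (pi1 X x) \<and>
     openin (loop_space X x) {\<alpha> \<in> loops X x. loop_class X x \<alpha> \<in> U}"
proof -
  have "istopology (\<lambda>U. U \<subseteq> carrier (pi1 X x) \<and>
     openin (loop_space X x) {\<alpha> \<in> loops X x. loop_class X x \<alpha> \<in> U})" (is "istopology ?P")
    unfolding istopology_def
  proof (intro conjI allI impI)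
    fix S T assume "?P S" "?P T"
    moreover have "{\<alpha> \<in> loops X x. loop_class X x \<alpha> \<in> S \<inter> T} =
      {\<alpha> \<in> loops X x. loop_class X x \<alpha> \<in> S} \<inter> {\<alpha> \<in> loops X x. loop_class X x \<alpha> \<in> T}" by auto
    ultimately show "S \<inter> T \<subseteq> carrier (pi1 X x)"
      "openin (loop_space X x) {\<alpha> \<in> loops X x. loop_class X x \<alpha> \<in> S \<inter> T}"
      by auto
  next
    fix \<K> assume *: "\<forall>S\<in>\<K>. ?P S"
    then show "\<Union>\<K> \<subseteq> carrier (pi1 X x)" by blast
    have "{\<alpha> \<in> loops X x. loop_class X x \<alpha> \<in> \<Union>\<K>} =
      (\<Union>S\<in>\<K>. {\<alpha> \<in> loops X x. loop_class X x \<alpha> \<in> S})" by auto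
    then show "openin (loop_space X x) {\<alpha> \<in> loops X x. loop_class X x \<alpha> \<in> \<Union>\<K>}"
      using * by (auto intro!: openin_Union)
  qed
  then show ?thesis
    by (simp add: pi1_topology_def)
qed

lemma quotient_map_loop_class:
  "quotient_map (loop_space X x) (pi1_topology X x) (loop_class X x)"
proof -
  have "{\<alpha> \<in> loops X x. loop_class X x \<alpha> \<in> loop_class X x ` loops X x} = loops X x"
    by auto
  then have "openin (pi1_topology X x) (carrier (pi1 X x))"
    using openin_topspace[of "loop_space X x"] by (simp add: openin_pi1_topology pi1_def)
  then have "topspace (pi1_topology X x) = carrier (pi1 X x)"
    by (meson openin_pi1_topology openin_subset openin_topspace subset_antisym)
  then show ?thesis
    by (auto simp: quotient_map_def openin_pi1_topology pi1_def)
qed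


section \<open>The Hawaiian Earring\<close>

definition circ :: "nat \<Rightarrow> (real \<times> real) set" where
  "circ i = {(x, y). x\<^sup>2 + (y - 1 / real i)\<^sup>2 = 1 / (real i)\<^sup>2}"

definition earring :: "(real \<times> real) set" where
  "earring = (\<Union>i\<in>{1..}. circ i)"

definition ell :: "nat \<Rightarrow> real \<Rightarrow> real \<times> real" where
  "ell i t = (sin (2 * pi * t) / real i, (1 - cos (2 * pi * t)) / real i)"

definition earring_U :: "nat \<Rightarrow> (real \<times> real) set" where
  "earring_U i = ell i ` {1/4<..<3/4}"

text \<open>\<open>earring_Uinf n\<close> is $U_{n+1}^\infty$.\<close>

definition earring_Uinf :: "nat \<Rightarrow> (real \<times> real) set" where
  "earring_Uinf n = (\<Union>i\<in>{1..n}. ell i ` {0..<3/8} \<union> ell i ` {5/8<..1}) \<union> (\<Union>i\<in>{n+1..}. circ i)"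


section \<open>Words and the Cayley tree\<close>

text \<open>\<open>(i, True)\<close> stands for $a_i$ and \<open>(i, False)\<close> for $a_i^{-1}$; indices start at 1.\<close>

type_synonym word = "(nat \<times> bool) list"

definition words_upto :: "nat \<Rightarrow> word set" where
  "words_upto n = {w. \<forall>(i, b)\<in>set w. 1 \<le> i \<and> i \<le> n}"

definition words :: "word set" where
  "words = (\<Union>n. words_upto n)"

fun inv_letter :: "nat \<times> bool \<Rightarrow> nat \<times> bool" where
  "inv_letter (i, b) = (i, \<not> b)"

definition reduced :: "word \<Rightarrow> bool" where
  "reduced w \<longleftrightarrow> successively (\<lambda>x y. y \<noteq> inv_letter x) w"

fun push_letter :: "nat \<times> bool \<Rightarrow> word \<Rightarrow> word" where
  "push_letter x [] = [x]"
| "push_letter x (y # ys) = (if y = inv_letter x then ys else x # y # ys)"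

text \<open>Complete free reduction, computed by a stack; the lemmas below characterise it as the
  normal form with respect to deleting subwords $x x^{-1}$.\<close>

definition free_red :: "word \<Rightarrow> word" where
  "free_red w = foldr push_letter w []"

lemma inv_letter_inv [simp]: "inv_letter (inv_letter x) = x"
  by (cases x) simp

lemma reduced_push: "reduced w \<Longrightarrow> reduced (push_letter x w)"
  by (cases w) (auto simp: reduced_def successively_Cons)

lemma reduced_free_red: "reduced (free_red w)"
  by (induction w) (auto simp: free_red_def reduced_push, simp add: reduced_def)

lemma free_red_reduced: "reduced w \<Longrightarrow> free_red w = w"
proof (induction w)
  case (Cons x w)
  then have "free_red w = w"
    by (cases w) (auto simp: reduced_def successively_Cons)
  with Cons.prems show ?case
    by (cases w) (auto simp: free_red_def reduced_def)
qed (simp add: free_red_def)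

lemma push_inv_push:
  assumes "reduced w" shows "push_letter x (push_letter (inv_letter x) w) = w"
proof (cases w)
  case (Cons y ys)
  with assms show ?thesis
    by (cases ys) (auto simp: reduced_def)
qed simp

lemma free_red_cancel: "free_red (u @ [x, inv_letter x] @ v) = free_red (u @ v)"
  using push_inv_push[OF reduced_free_red, of x v] by (simp add: free_red_def)

definition cayley_verts :: "word set" where
  "cayley_verts = {v \<in> words. reduced v}"

definition cayley_edge :: "word \<Rightarrow> nat \<Rightarrow> word \<Rightarrow> bool" where
  "cayley_edge u i v \<longleftrightarrow> u \<in> cayley_verts \<and> 1 \<le> i \<and> v = free_red (u @ [(i, True)])"

definition adj :: "word \<Rightarrow> word \<Rightarrow> bool" where
  "adj u v \<longleftrightarrow> (\<exists>i. cayley_edge u i v \<or> cayley_edge v i u)"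


section \<open>The tree \<open>\<Gamma>\<^sup>*\<close>\<close>

text \<open>Throughout, \<open>w\<close> is the list $w_1, w_2, \dots$ (the value \<open>w 0\<close> is never used).\<close>

definition alt_word :: "nat \<Rightarrow> word" where
  "alt_word N = map (\<lambda>k. (if even k then 1 else 2, True)) [0..<N]"

definition w_hat :: "(nat \<Rightarrow> word) \<Rightarrow> nat \<Rightarrow> word" where
  "w_hat w j = alt_word (2 * (\<Sum>i\<in>{1..<j}. length (w i)) + 3 * j + length (w j))"

definition Zset :: "(nat \<Rightarrow> word) \<Rightarrow> nat \<Rightarrow> word set" where
  "Zset w j = {free_red (w_hat w j @ take i (w j)) |i. i \<le> length (w j)}"

definition nmin :: "(nat \<Rightarrow> word) \<Rightarrow> nat \<Rightarrow> nat" where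
  "nmin w j = (LEAST n. 2 \<le> n \<and> w j \<in> words_upto n)"

text \<open>The integer exponent $r$ is split into its absolute value and its sign \<open>b\<close>.\<close>

definition line :: "word \<Rightarrow> nat \<Rightarrow> word set" where
  "line u s = {free_red (u @ replicate r (s, b)) |r b. True}"

definition Yset :: "(nat \<Rightarrow> word) \<Rightarrow> nat \<Rightarrow> word set" where
  "Yset w j = Zset w j \<union> (\<Union>u\<in>Zset w j. \<Union>s\<in>{1..nmin w j}. line u s)"

text \<open>All subgraphs of the Cayley tree occurring below are obtained by deleting vertices
  together with their incident edges (an edge separated from \<open>Y\<^sub>j\<close> by \<open>v\<close> is incident to \<open>v\<close> or has a
  separated end point), hence are full subgraphs; they are represented by their vertex sets.\<close>

definition walk_in :: "word set \<Rightarrow> word list \<Rightarrow> bool" where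
  "walk_in G p \<longleftrightarrow> p \<noteq> [] \<and> set p \<subseteq> G \<and> successively adj p"

definition separated :: "word set \<Rightarrow> word set \<Rightarrow> word \<Rightarrow> word \<Rightarrow> bool" where
  "separated G Y v x \<longleftrightarrow> (\<forall>p. walk_in G p \<and> hd p = x \<and> last p \<in> Y \<longrightarrow> v \<in> set p)"

definition cut_vertices :: "word set \<Rightarrow> word set \<Rightarrow> word set" where
  "cut_vertices G Y = {v \<in> G. v \<notin> Y \<and> (\<exists>y\<in>Y. adj y v) \<and>
     \<not> (\<exists>y\<in>Y. \<exists>i\<in>{1, 2}. cayley_edge y i v \<or> cayley_edge v i y)}"

definition prune :: "word set \<Rightarrow> word set \<Rightarrow> word set" where
  "prune G Y = {x \<in> G. \<forall>v\<in>cut_vertices G Y. x \<noteq> v \<and> \<not> separated G Y v x}"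

primrec Gamma :: "(nat \<Rightarrow> word) \<Rightarrow> nat \<Rightarrow> word set" where
  "Gamma w 0 = cayley_verts"
| "Gamma w (Suc j) = prune (Gamma w j) (Yset w (Suc j))"

definition Gamma_inf :: "(nat \<Rightarrow> word) \<Rightarrow> word set" where
  "Gamma_inf w = (\<Inter>j. Gamma w j)"

text \<open>The condition \<open>v = u @ (k, b) # x\<close> is an equality of words, so the product is reduced as
  written.\<close>

definition Gamma_star :: "(nat \<Rightarrow> word) \<Rightarrow> word set" where
  "Gamma_star w = {v \<in> Gamma_inf w. \<not> (\<exists>u k b x. u \<in> Gamma_inf w \<and>
     infinite {z \<in> Gamma_inf w. adj u z} \<and> k \<notin> {1, 2} \<and> x \<in> words \<and> v = u @ (k, b) # x)}"


section \<open>The covering graph and its map to the earring\<close>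

text \<open>\<open>E_set w v\<close> consists of the labels of the edges of \<open>\<Gamma>\<^sup>*\<close> terminating at \<open>v\<close>; the edges emanating
  from \<open>v\<close> have the same labels.\<close>

definition E_set :: "(nat \<Rightarrow> word) \<Rightarrow> word \<Rightarrow> nat set" where
  "E_set w v = {i. \<exists>u\<in>Gamma_star w. cayley_edge u i v}"

text \<open>A directed edge is a triple of origin, label index and terminus.\<close>

type_synonym edge = "word \<times> nat \<times> word"

definition hat_edges :: "(nat \<Rightarrow> word) \<Rightarrow> edge set" where
  "hat_edges w =
     {(u, i, v). u \<in> Gamma_star w \<and> v \<in> Gamma_star w \<and> cayley_edge u i v} \<union>
     {(v, i, v) |v i. v \<in> Gamma_star w \<and> 1 \<le> i \<and> i \<notin> E_set w v}"

text \<open>Points of the geometric realization: vertices, and interior points of edges with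
  parameter in the open interval \<open>(0, 1)\<close>.\<close>

datatype point = Vertex word | Inner edge real

definition hat_space :: "(nat \<Rightarrow> word) \<Rightarrow> point set" where
  "hat_space w = Vertex ` Gamma_star w \<union> {Inner e t |e t. e \<in> hat_edges w \<and> 0 < t \<and> t < 1}"

fun psi :: "edge \<Rightarrow> real \<Rightarrow> point" where
  "psi (u, i, v) t = (if t = 0 then Vertex u else if t = 1 then Vertex v else Inner (u, i, v) t)"

fun qmap :: "point \<Rightarrow> real \<times> real" where
  "qmap (Vertex v) = (0, 0)"
| "qmap (Inner (u, i, v) t) = ell i t"

lemma qmap_psi: "qmap (psi (u, i, v) t) = ell i t"
  by (simp add: ell_def)

definition hat_Ue :: "edge \<Rightarrow> point set" where
  "hat_Ue e = psi e ` {1/4<..<3/4}"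

definition nv :: "(nat \<Rightarrow> word) \<Rightarrow> word \<Rightarrow> nat" where
  "nv w v = (LEAST n. 2 \<le> n \<and> E_set w v \<subseteq> {1..n})"

definition hat_Uv :: "(nat \<Rightarrow> word) \<Rightarrow> word \<Rightarrow> point set" where
  "hat_Uv w v =
     (\<Union>{psi (v, i, x) ` {0..<3/8} |i x. (v, i, x) \<in> hat_edges w}) \<union>
     (\<Union>{psi (x, i, v) ` {5/8<..1} |i x. (x, i, v) \<in> hat_edges w}) \<union>
     (\<Union>{psi (v, i, v) ` {0..1} |i. (v, i, v) \<in> hat_edges w \<and> nv w v < i})"

definition hat_topology :: "(nat \<Rightarrow> word) \<Rightarrow> point topology" where
  "hat_topology w = (THE T. topspace T = hat_space w \<and>
     (\<forall>(u, i, v)\<in>hat_edges w. openin T (hat_Ue (u, i, v)) \<and>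
        homeomorphic_map (subtopology T (hat_Ue (u, i, v))) (top_of_set (earring_U i)) qmap) \<and>
     (\<forall>v\<in>Gamma_star w. openin T (hat_Uv w v) \<and>
        homeomorphic_map (subtopology T (hat_Uv w v)) (top_of_set (earring_Uinf (nv w v))) qmap))"

definition K_group :: "(nat \<Rightarrow> word) \<Rightarrow> (real \<Rightarrow> real \<times> real) set set" where
  "K_group w = pi1_map qmap (top_of_set earring) (0, 0) ` carrier (pi1 (hat_topology w) (Vertex []))"

end

theory Submission
  imports Defs "HOL-Library.Sublist"
begin

text \<open>Every reduced word in the tree \<open>\<Gamma>\<^sup>*\<close> uses letters with index at least 3 only along edges of \<open>Y\<close>, and such an
  edge joins two points of one and the same set \<open>Y\<^sub>j\<close>, on which the labels are bounded. A path in the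
  earring that is close to the base point therefore lifts inside a part of the covering graph that lies over a
  neighbourhood of the base point as a covering, and this makes all paths liftable. If \<open>\<alpha>\<close> lifts to a
  path from the base vertex to \<open>e\<close>, then so does every loop \<open>\<beta>\<close> near \<open>\<alpha>\<close>, because lifts can be
  corrected sheet by sheet along a subdivision, and \<open>\<beta>\<close> followed by the reverse of \<open>\<alpha>\<close> lifts to a loop.
  So \<open>[\<beta>][\<alpha>]\<^sup>-\<^sup>1 \<in> K\<close>, and with \<open>[\<alpha>]\<close> also \<open>[\<beta>]\<close> lies in \<open>K\<close>. Uniqueness of lifts and
  lifting of homotopies play no role.\<close>

section \<open>Free reduction\<close>

text \<open>The tree is built from walks, separation and valences, whereas lifting needs to know
  which labels survive at a given vertex. Both meet in a condition on prefixes of reduced words: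
  since Y is a subtree containing the root, cutting at a vertex removes exactly the words that
  extend it. The topology of the covering graph is given by a definite description, so an explicit
  topology has to be exhibited and shown to be the only one with the prescribed charts. The
  difficulty in lifting is the order of choices. The size of the sheets over the base point depends
  on the vertex, so a subdivision fine enough for one starting point may be too coarse for another.
  The remedy is a neighbourhood that contains only the end pieces of circles 1 and 2: over it a lift
  changes its vertex only along labels at least 3, hence among vertices with a common bound. Path
  lifting is needed even for a loop whose class lies in K, because this membership only provides a
  homotopic loop with a closed lift.\<close>

lemma free_red_push_append:
  assumes "reduced w"
  shows "free_red (push_letter x w @ v) = push_letter x (free_red (w @ v))"
proof (cases "\<exists>ys. w = inv_letter x # ys")
  case True
  then obtain ys where w: "w = inv_letter x # ys" by blast
  then show ?thesis
    using push_inv_push[OF reduced_free_red, of x "ys @ v"] by (simp add: free_red_def)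
next
  case False
  then have "push_letter x w = x # w" by (cases w) auto
  then show ?thesis by (simp add: free_red_def)
qed

text \<open>\<open>free_red\<close> consumes a word from its right end, so its own recursion peels
  off first letters. This is the tool for the other end: multiplying a vertex by one more letter on
  the right, which is a step in the Cayley graph.\<close>

lemma free_red_append_left: "free_red (free_red u @ v) = free_red (u @ v)"
proof (induction u)
  case (Cons x u)
  have "free_red (free_red (x # u) @ v) = free_red (push_letter x (free_red u) @ v)"
    by (simp add: free_red_def)
  also have "\<dots> = push_letter x (free_red (u @ v))"
    by (simp add: free_red_push_append reduced_free_red Cons)
  finally show ?case by (simp add: free_red_def)
qed (simp add: free_red_def)

lemma set_free_red: "set (free_red w) \<subseteq> set w"
proof -
  have push: "set (push_letter x u) \<subseteq> insert x (set u)" for x u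
    by (cases u) auto
  show ?thesis
  proof (induction w)
    case (Cons x w)
    then show ?case using push[of x "free_red w"] by (auto simp: free_red_def simp del: push_letter.simps)
  qed (simp add: free_red_def)
qed

lemma reduced_appendD: "reduced (u @ v) \<Longrightarrow> reduced u" "reduced (u @ v) \<Longrightarrow> reduced v"
  by (auto simp: reduced_def successively_append_iff)

lemma reduced_prefix: "reduced v \<Longrightarrow> prefix u v \<Longrightarrow> reduced u"
  by (auto simp: prefix_def dest: reduced_appendD)

lemma free_red_snoc:
  assumes "reduced u"
  shows "free_red (u @ [x]) = (if u \<noteq> [] \<and> last u = inv_letter x then butlast u else u @ [x])"
proof (cases "u \<noteq> [] \<and> last u = inv_letter x")
  case True
  then have u: "u = butlast u @ [inv_letter x]" by (metis append_butlast_last_id)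
  then have "free_red (u @ [x]) = free_red (butlast u @ [])"
    using free_red_cancel[of "butlast u" "inv_letter x" "[]"]
    by (metis append.assoc append_Cons append_Nil inv_letter_inv)
  also have "\<dots> = butlast u"
    using assms u by (metis append_Nil2 free_red_reduced reduced_appendD(1))
  finally show ?thesis using True by simp
next
  case False
  then have "reduced (u @ [x])"
    using assms by (auto simp: reduced_def successively_append_iff)
  with False show ?thesis by (metis free_red_reduced)
qed

text \<open>The two ways a step in the tree can go: away from the root, lengthening the word, or
  back towards the root, dropping its last letter.\<close>

lemma free_red_snoc_cases:
  assumes "reduced u"
  obtains "free_red (u @ [x]) = u @ [x]" "reduced (u @ [x])"
    | "u = free_red (u @ [x]) @ [inv_letter x]"
proof (cases "u \<noteq> [] \<and> last u = inv_letter x")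
  case True
  then show ?thesis using that(2) free_red_snoc[OF assms, of x]
    by (metis append_butlast_last_id)
next
  case False
  then show ?thesis using that(1) free_red_snoc[OF assms, of x] reduced_free_red
    by metis
qed

lemma free_red_snoc_snoc: "free_red (free_red (u @ [x]) @ [inv_letter x]) = free_red u"
  using free_red_cancel[of u x "[]"] by (simp add: free_red_append_left)

text \<open>In a tree the path from the root to \<open>u\<close>, followed by the walk that reads
  \<open>a\<close>, covers the geodesic from the root to the end of the walk. Prefixes are the
  vertices of that geodesic.\<close>

lemma prefix_free_red_append:
  assumes "reduced u" "prefix p (free_red (u @ a))"
  shows "prefix p u \<or> (\<exists>i\<le>length a. p = free_red (u @ take i a))"
  using assms(2)
proof (induction a arbitrary: p rule: rev_induct)
  case Nil
  then show ?case using assms(1) by (simp add: free_red_reduced)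
next
  case (snoc x a)
  let ?v = "free_red (u @ a)"
  have eq: "free_red (u @ a @ [x]) = free_red (?v @ [x])"
    by (simp add: free_red_append_left)
  have ih: "prefix p u \<or> (\<exists>i\<le>length (a @ [x]). p = free_red (u @ take i (a @ [x])))"
    if "prefix p ?v"
    using snoc.IH[OF that] by (metis le_SucI length_append_singleton take_append diff_is_0_eq
        append_Nil2 take_0)
  have full: "\<exists>i\<le>length (a @ [x]). p = free_red (u @ take i (a @ [x]))"
    if "p = free_red (u @ a @ [x])"
    using that by (metis order_refl take_all)
  from reduced_free_red[of "u @ a"] show ?case
  proof (cases rule: free_red_snoc_cases[where x = x])
    case 1
    then show ?thesis using snoc.prems ih full eq by (metis prefix_snoc)
  next
    case 2
    then have "prefix p ?v" using snoc.prems eq by (metis append_prefixD prefix_def prefix_order.trans)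
    then show ?thesis by (rule ih)
  qed
qed

section \<open>Lines in the direction of one generator\<close>

lemma line_refl: "reduced u \<Longrightarrow> u \<in> line u s"
  unfolding line_def by (force simp: free_red_reduced intro: exI[of _ 0])

lemma line_step:
  assumes "v \<in> line u s"
  shows "free_red (v @ [(s, b)]) \<in> line u s"
proof -
  obtain r b' where v: "v = free_red (u @ replicate r (s, b'))"
    using assms by (auto simp: line_def)
  have eq: "free_red (v @ [(s, b)]) = free_red (u @ replicate r (s, b') @ [(s, b)])"
    by (simp add: v free_red_append_left)
  show ?thesis
  proof (cases "b = b' \<or> r = 0")
    case True
    then have "free_red (v @ [(s, b)]) = free_red (u @ replicate (Suc r) (s, b))"
      using eq by (auto simp: replicate_append_same)
    then show ?thesis unfolding line_def by blast
  next
    case False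
    then obtain r' where r: "r = Suc r'" by (cases r) auto
    have "inv_letter (s, b') = (s, b)" using False by auto
    then have "free_red (v @ [(s, b)]) = free_red (u @ replicate r' (s, b'))"
      using eq free_red_cancel[of "u @ replicate r' (s, b')" "(s, b')" "[]"]
      by (simp add: r replicate_append_same[symmetric] del: replicate_append_same)
    then show ?thesis unfolding line_def by blast
  qed
qed

lemma line_trans:
  assumes "v \<in> line u s"
  shows "line v s \<subseteq> line u s"
proof -
  have "free_red (v @ replicate r (s, b)) \<in> line u s" for r b
  proof (induction r)
    case 0
    obtain a where "v = free_red a" using assms by (auto simp: line_def)
    then show ?case using assms by (simp add: free_red_reduced reduced_free_red)
  next
    case (Suc r)
    then have "free_red (free_red (v @ replicate r (s, b)) @ [(s, b)]) \<in> line u s"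
      by (rule line_step)
    then show ?case by (simp add: free_red_append_left replicate_append_same)
  qed
  then show ?thesis by (auto simp: line_def)
qed

text \<open>\<open>u0\<close> is \<open>u\<close> stripped of its trailing power of
  \<open>s\<close>, the shortest element of the coset. Powers of \<open>s\<close> attach to it
  without cancellation, so only the exponent varies along the line.\<close>

lemma line_normal_form:
  assumes "reduced u"
  obtains u0 where "u0 \<noteq> [] \<Longrightarrow> fst (last u0) \<noteq> s"
    "\<And>v. v \<in> line u s \<Longrightarrow> \<exists>m b. v = u0 @ replicate m (s, b)"
proof -
  have "\<exists>u0 m b. (u0 \<noteq> [] \<longrightarrow> fst (last u0) \<noteq> s) \<and> u = u0 @ replicate m (s, b)"
    using assms
  proof (induction u rule: rev_induct)
    case Nil
    show ?case by (intro exI[of _ "[]"] exI[of _ 0]) simp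
  next
    case (snoc x u)
    show ?case
    proof (cases "fst x = s")
      case False
      then show ?thesis by (intro exI[of _ "u @ [x]"] exI[of _ 0]) simp
    next
      case True
      obtain u0 m b where u0: "u0 \<noteq> [] \<longrightarrow> fst (last u0) \<noteq> s" "u = u0 @ replicate m (s, b)"
        using snoc reduced_appendD by blast
      show ?thesis
      proof (cases m)
        case 0
        with u0 True show ?thesis
          by (intro exI[of _ u0] exI[of _ 1] exI[of _ "snd x"]) (cases x, simp)
      next
        case (Suc m')
        have "x \<noteq> inv_letter (s, b)"
          using snoc.prems u0(2) Suc
          by (auto simp: reduced_def successively_append_iff replicate_append_same[symmetric] simp del: replicate_append_same)
        then have "x = (s, b)" using True by (cases x) auto
        then show ?thesis using u0
          by (intro exI[of _ u0] exI[of _ "Suc m"] exI[of _ b]) (simp add: replicate_append_same)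
      qed
    qed
  qed
  then obtain u0 m b where u0: "u0 \<noteq> [] \<longrightarrow> fst (last u0) \<noteq> s" "u = u0 @ replicate m (s, b)"
    by blast
  have "\<exists>m b. free_red (u @ replicate r (s, c)) = u0 @ replicate m (s, b)" for r c
  proof (induction r)
    case 0
    show ?case using u0 assms by (auto simp: free_red_reduced)
  next
    case (Suc r)
    then obtain m b where v: "free_red (u @ replicate r (s, c)) = u0 @ replicate m (s, b)" by blast
    let ?v = "u0 @ replicate m (s, b)"
    have rv: "reduced ?v" using v reduced_free_red by metis
    have eq: "free_red (u @ replicate (Suc r) (s, c)) = free_red (?v @ [(s, c)])"
      unfolding v[symmetric] by (simp add: free_red_append_left replicate_append_same)
    show ?case
    proof (cases m)
      \<comment> \<open>Only here could a cancellation reach \<open>u0\<close>; its last letter has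
        another index and prevents this.\<close>
      case 0
      then have "free_red (?v @ [(s, c)]) = u0 @ replicate 1 (s, c)"
        using u0(1) free_red_snoc[OF rv, of "(s, c)"] by auto
      then show ?thesis using eq by metis
    next
      case (Suc m')
      have "free_red (?v @ [(s, c)]) = (if b = c then u0 @ replicate (Suc m) (s, b) else u0 @ replicate m' (s, b))"
        using free_red_snoc[OF rv, of "(s, c)"] Suc
        by (auto simp: butlast_append replicate_append_same[symmetric] simp del: replicate_append_same)
      then show ?thesis using eq by metis
    qed
  qed
  then show ?thesis using that[of u0] u0(1) by (fastforce simp: line_def)
qed

section \<open>The sets \<open>Y\<^sub>j\<close>\<close>

text \<open>The length of the common prefix of a word with the ray \<open>Z\<close> varies by at most 1 along a line; the lengths
  of the words \<open>w_hat w j\<close> are chosen so that its values on different sets \<open>Y\<^sub>j\<close> are disjoint.\<close>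

abbreviation ray_letter :: "nat \<Rightarrow> nat \<times> bool" where
  "ray_letter k \<equiv> (if even k then 1 else 2, True)"

fun ray_depth :: "nat \<Rightarrow> word \<Rightarrow> nat" where
  "ray_depth k [] = 0"
| "ray_depth k (y # ys) = (if y = ray_letter k then Suc (ray_depth (Suc k) ys) else 0)"

lemma ray_depth_map: "ray_depth k (map ray_letter [k..<k + N]) = N"
  by (induction N arbitrary: k) (simp_all add: upt_conv_Cons del: upt_Suc, metis add_Suc)

lemma ray_depth_alt_word: "ray_depth 0 (alt_word N) = N"
  using ray_depth_map[of 0 N] by (simp add: alt_word_def)

lemma ray_depth_snoc:
  "ray_depth k x \<le> ray_depth k (x @ [l])" "ray_depth k (x @ [l]) \<le> Suc (ray_depth k x)"
  by (induction x arbitrary: k) auto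

text \<open>The ray alternates between two letters, so a block of equal letters agrees with it in at
  most one place, whatever the length of the block.\<close>

lemma ray_depth_replicate:
  "ray_depth k x \<le> ray_depth k (x @ replicate m (s, b))"
  "ray_depth k (x @ replicate m (s, b)) \<le> Suc (ray_depth k x)"
proof -
  have "ray_depth k (replicate m (s, b)) \<le> 1" for k
    by (cases m; cases "m - 1") auto
  then have "ray_depth k x \<le> ray_depth k (x @ replicate m (s, b)) \<and>
      ray_depth k (x @ replicate m (s, b)) \<le> Suc (ray_depth k x)" for k
    by (induction x arbitrary: k) auto
  then show "ray_depth k x \<le> ray_depth k (x @ replicate m (s, b))"
    "ray_depth k (x @ replicate m (s, b)) \<le> Suc (ray_depth k x)" by blast+
qed

lemma ray_depth_free_red_snoc:
  assumes "reduced u"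
  shows "ray_depth 0 (free_red (u @ [x])) \<le> Suc (ray_depth 0 u)"
    "ray_depth 0 u \<le> Suc (ray_depth 0 (free_red (u @ [x])))"
proof -
  have "ray_depth 0 (free_red (u @ [x])) \<le> Suc (ray_depth 0 u) \<and>
    ray_depth 0 u \<le> Suc (ray_depth 0 (free_red (u @ [x])))"
    using assms
  proof (cases rule: free_red_snoc_cases[where x = x])
    case 1
    then show ?thesis using ray_depth_snoc[of 0 u x] by simp
  next
    case 2
    then show ?thesis using ray_depth_snoc[of 0 "free_red (u @ [x])" "inv_letter x"] by simp
  qed
  then show "ray_depth 0 (free_red (u @ [x])) \<le> Suc (ray_depth 0 u)"
    "ray_depth 0 u \<le> Suc (ray_depth 0 (free_red (u @ [x])))" by blast+
qed

lemma ray_depth_free_red_append: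
  assumes "reduced u"
  shows "ray_depth 0 (free_red (u @ a)) \<le> ray_depth 0 u + length a"
    "ray_depth 0 u \<le> ray_depth 0 (free_red (u @ a)) + length a"
proof -
  have "ray_depth 0 (free_red (u @ a)) \<le> ray_depth 0 u + length a \<and>
    ray_depth 0 u \<le> ray_depth 0 (free_red (u @ a)) + length a"
  proof (induction a rule: rev_induct)
    case (snoc x a)
    have "free_red (u @ a @ [x]) = free_red (free_red (u @ a) @ [x])"
      by (simp add: free_red_append_left)
    then show ?case
      using snoc ray_depth_free_red_snoc[OF reduced_free_red, of "u @ a" x] by simp
  qed (simp add: assms free_red_reduced)
  then show "ray_depth 0 (free_red (u @ a)) \<le> ray_depth 0 u + length a"
    "ray_depth 0 u \<le> ray_depth 0 (free_red (u @ a)) + length a" by blast+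
qed

text \<open>The bound does not depend on the exponent: both words are \<open>u0\<close> followed by
  a power of one letter, so both depths are that of \<open>u0\<close> or one more.\<close>

lemma ray_depth_line:
  assumes "reduced u" "v \<in> line u s"
  shows "ray_depth 0 v \<le> Suc (ray_depth 0 u)" "ray_depth 0 u \<le> Suc (ray_depth 0 v)"
proof -
  obtain u0 where u0: "\<And>v. v \<in> line u s \<Longrightarrow> \<exists>m b. v = u0 @ replicate m (s, b)"
    using line_normal_form[OF assms(1)] by metis
  obtain m b m' b' where "v = u0 @ replicate m (s, b)" "u = u0 @ replicate m' (s, b')"
    using u0[OF assms(2)] u0[OF line_refl[OF assms(1)]] by blast
  then show "ray_depth 0 v \<le> Suc (ray_depth 0 u)" "ray_depth 0 u \<le> Suc (ray_depth 0 v)"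
    using ray_depth_replicate[of 0 u0 m s b] ray_depth_replicate[of 0 u0 m' s b'] by auto
qed

lemma set_alt_word: "set (alt_word N) \<subseteq> {(1, True), (2, True)}"
  by (auto simp: alt_word_def)

lemma reduced_alt_word: "reduced (alt_word N)"
proof -
  \<comment> \<open>Positive letters never cancel each other.\<close>
  have "reduced x" if "\<forall>l\<in>set x. snd l" for x
    using that
  proof (induction x)
    case (Cons y x)
    then show ?case by (cases x; cases y) (auto simp: reduced_def successively_Cons)
  qed (simp add: reduced_def)
  then show ?thesis by (auto simp: alt_word_def)
qed

lemma prefix_alt_word:
  assumes "prefix p (alt_word N)"
  shows "p \<in> range alt_word"
proof -
  obtain M where "p = take M (alt_word N)"
    using assms by (metis append_eq_conv_conj prefix_def)
  then have "p = alt_word (min M N)"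
    by (simp add: alt_word_def take_map take_upt min_def)
  then show ?thesis by blast
qed

lemma words_uptoI: "x \<in> words \<Longrightarrow> \<exists>n\<ge>2. x \<in> words_upto n"
proof -
  assume "x \<in> words"
  then obtain n where "x \<in> words_upto n" by (auto simp: words_def)
  then have "x \<in> words_upto (max 2 n)" by (auto simp: words_upto_def max_def)
  then show ?thesis by (metis max.cobounded1)
qed

lemma words_iff: "x \<in> words \<longleftrightarrow> (\<forall>l\<in>set x. 1 \<le> fst l)"
proof
  assume *: "\<forall>l\<in>set x. 1 \<le> fst l"
  have "fst l \<le> (\<Sum>l\<in>set x. fst l)" if "l \<in> set x" for l
    using that by (intro member_le_sum) auto
  with * have "x \<in> words_upto (\<Sum>l\<in>set x. fst l)"
    by (fastforce simp: words_upto_def)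
  then show "x \<in> words" by (auto simp: words_def)
qed (auto simp: words_def words_upto_def)

locale word_sequence =
  fixes w :: "nat \<Rightarrow> word"
  assumes w_words: "1 \<le> j \<Longrightarrow> w j \<in> words"
begin

text \<open>The ray is left out here and added in \<open>Y_all\<close>, which is the set Y of the
  construction. The ray has only the labels 1 and 2, so labels at least 3 are governed by this
  smaller set.\<close>

definition Y_union :: "word set" where
  "Y_union = (\<Union>j\<in>{1..}. Yset w j)"

definition Y_all :: "word set" where
  "Y_all = range alt_word \<union> Y_union"

lemma nmin: assumes "1 \<le> j" shows "2 \<le> nmin w j" "w j \<in> words_upto (nmin w j)"
proof -
  have "2 \<le> nmin w j \<and> w j \<in> words_upto (nmin w j)"
    unfolding nmin_def using words_uptoI[OF w_words[OF assms]] by (rule LeastI_ex)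
  then show "2 \<le> nmin w j" "w j \<in> words_upto (nmin w j)" by auto
qed

lemma reduced_w_hat: "reduced (w_hat w j)"
  by (simp add: w_hat_def reduced_alt_word)

lemma w_hat_in_Zset: "w_hat w j \<in> Zset w j"
  unfolding Zset_def using reduced_w_hat by (force simp: free_red_reduced intro: exI[of _ 0])

lemma reduced_Zset: "z \<in> Zset w j \<Longrightarrow> reduced z"
  by (auto simp: Zset_def reduced_free_red)

lemma Yset_cases:
  assumes "y \<in> Yset w j"
  obtains "y \<in> Zset w j"
    | u s where "u \<in> Zset w j" "1 \<le> s" "s \<le> nmin w j" "y \<in> line u s"
  using assms by (auto simp: Yset_def)

lemma Zset_subset_Yset: "Zset w j \<subseteq> Yset w j"
  by (auto simp: Yset_def)

lemma reduced_Yset: "y \<in> Yset w j \<Longrightarrow> reduced y"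
  by (auto simp: Yset_def reduced_Zset line_def reduced_free_red)

lemma ray_depth_Zset:
  assumes "z \<in> Zset w j"
  shows "ray_depth 0 z \<le> length (w_hat w j) + length (w j)"
    "length (w_hat w j) \<le> ray_depth 0 z + length (w j)"
proof -
  obtain i where i: "i \<le> length (w j)" "z = free_red (w_hat w j @ take i (w j))"
    using assms by (auto simp: Zset_def)
  have "ray_depth 0 (w_hat w j) = length (w_hat w j)"
    by (simp add: w_hat_def ray_depth_alt_word) (simp add: alt_word_def)
  then show "ray_depth 0 z \<le> length (w_hat w j) + length (w j)"
    "length (w_hat w j) \<le> ray_depth 0 z + length (w j)"
    using ray_depth_free_red_append[OF reduced_w_hat, of j "take i (w j)"] i by auto
qed

text \<open>Reading \<open>w j\<close> moves the depth by at most the length of \<open>w j\<close>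
  away from that of \<open>w_hat w j\<close>, and a line costs one more. So each
  \<open>Yset w j\<close> occupies a window of depths.\<close>

lemma ray_depth_Yset:
  assumes "y \<in> Yset w j"
  shows "ray_depth 0 y \<le> length (w_hat w j) + length (w j) + 1"
    "length (w_hat w j) \<le> ray_depth 0 y + length (w j) + 1"
  using assms ray_depth_Zset ray_depth_line[OF reduced_Zset]
  by (cases rule: Yset_cases; fastforce)+

text \<open>Let S be the total length of the words before \<open>w j\<close>. The window of
  \<open>i\<close> ends at most at 2S + 3i + 1, and that of \<open>j\<close> begins at 2S + 3j - 1.
  The distance of at least 3 between 3i and 3j outweighs the two units spent on lines.\<close>

lemma Yset_disjoint_less:
  assumes "1 \<le> i" "i < j"
  shows "Yset w i \<inter> Yset w j = {}"
proof -
  have len: "length (w_hat w k) = 2 * (\<Sum>i\<in>{1..<k}. length (w i)) + 3 * k + length (w k)" for k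
    by (simp add: w_hat_def alt_word_def)
  have "(\<Sum>k\<in>{1..<i}. length (w k)) + length (w i) = (\<Sum>k\<in>{1..<Suc i}. length (w k))"
    using assms by simp
  also have "\<dots> \<le> (\<Sum>k\<in>{1..<j}. length (w k))"
    using assms by (intro sum_mono2) auto
  finally have "(\<Sum>k\<in>{1..<i}. length (w k)) + length (w i) \<le> (\<Sum>k\<in>{1..<j}. length (w k))" .
  then have "length (w_hat w i) + length (w i) + 1 + length (w j) + 1 < length (w_hat w j)"
    using assms by (simp add: len)
  then show ?thesis
    using ray_depth_Yset(1)[of _ i] ray_depth_Yset(2)[of _ j] by fastforce
qed

lemma Yset_disjoint: "1 \<le> i \<Longrightarrow> 1 \<le> j \<Longrightarrow> y \<in> Yset w i \<Longrightarrow> y \<in> Yset w j \<Longrightarrow> i = j"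
  using Yset_disjoint_less by (metis disjoint_iff nat_neq_iff)

lemma prefix_Zset:
  assumes "z \<in> Zset w j" "prefix p z"
  shows "p \<in> range alt_word \<union> Zset w j"
proof -
  obtain i where i: "i \<le> length (w j)" "z = free_red (w_hat w j @ take i (w j))"
    using assms(1) by (auto simp: Zset_def)
  from prefix_free_red_append[OF reduced_w_hat assms(2)[unfolded i(2)]] show ?thesis
  proof
    assume "prefix p (w_hat w j)"
    then show ?thesis using prefix_alt_word by (simp add: w_hat_def)
  next
    assume "\<exists>i'\<le>length (take i (w j)). p = free_red (w_hat w j @ take i' (take i (w j)))"
    then obtain i' where "p = free_red (w_hat w j @ take (min i' i) (w j))"
      by auto
    then show ?thesis using i(1) by (auto simp: Zset_def intro!: exI[of _ "min i' i"])
  qed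
qed

lemma prefix_Yset:
  assumes "y \<in> Yset w j" "prefix p y"
  shows "p \<in> range alt_word \<union> Yset w j"
  using assms(1)
proof (cases rule: Yset_cases)
  case 1
  then show ?thesis using prefix_Zset assms(2) Zset_subset_Yset by blast
next
  case (2 u s)
  then obtain r b where y: "y = free_red (u @ replicate r (s, b))"
    by (auto simp: line_def)
  from prefix_free_red_append[OF reduced_Zset[OF 2(1)] assms(2)[unfolded y]] show ?thesis
  proof
    assume "prefix p u"
    then show ?thesis using prefix_Zset[OF 2(1)] Zset_subset_Yset by blast
  next
    assume "\<exists>i\<le>length (replicate r (s, b)). p = free_red (u @ take i (replicate r (s, b)))"
    then have "p \<in> line u s" by (auto simp: line_def)
    then show ?thesis using 2 by (auto simp: Yset_def)
  qed
qed

text \<open>So Y is a subtree containing the root, the ray being the connection of each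
  \<open>Yset w j\<close> to it. This makes separation from Y a matter of prefixes.\<close>

lemma prefix_Y_all: "y \<in> Y_all \<Longrightarrow> prefix p y \<Longrightarrow> p \<in> Y_all"
  unfolding Y_all_def Y_union_def using prefix_Yset prefix_alt_word by blast

text \<open>The letters come from \<open>w_hat w j\<close> or from \<open>w j\<close>. Those of the
  former have index 1 or 2, which is covered because \<open>nmin\<close> is at least 2.\<close>

lemma Zset_letters:
  assumes "1 \<le> j" "z \<in> Zset w j" "l \<in> set z"
  shows "fst l \<le> nmin w j"
proof -
  have "l \<in> set (w_hat w j) \<union> set (w j)"
    using assms(2,3) set_free_red set_take_subset by (fastforce simp: Zset_def)
  then show ?thesis
    using nmin[OF assms(1)] set_alt_word by (fastforce simp: w_hat_def words_upto_def)
qed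

text \<open>An edge of \<open>Y\<close> with label at least 3 does not lie on the ray; the normal form of lines shows
  that it belongs to one of the lines added in Step 2.\<close>

lemma Yset_edge:
  assumes j: "1 \<le> j" and t: "v @ [(k, b)] \<in> Yset w j" and k: "3 \<le> k"
  shows "k \<le> nmin w j" "line v k \<subseteq> Yset w j" "v \<in> Yset w j"
proof -
  let ?t = "v @ [(k, b)]"
  let ?C = "k \<le> nmin w j \<and> line v k \<subseteq> Yset w j \<and> v \<in> Yset w j"
  have rt: "reduced ?t" using t by (rule reduced_Yset)
  have v: "v = free_red (?t @ [inv_letter (k, b)])"
    using free_red_cancel[of v "(k, b)" "[]"] free_red_reduced reduced_appendD(1)[OF rt]
    by simp
  \<comment> \<open>If the far end lies in \<open>Zset w j\<close>, its last letter is bounded by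
    \<open>nmin\<close>, so the line through it in this direction was added, and that line contains
    \<open>v\<close>.\<close>
  have Z: ?C if z: "?t \<in> Zset w j"
  proof -
    have kn: "k \<le> nmin w j" using Zset_letters[OF j z, of "(k, b)"] by simp
    have "v \<in> line ?t k"
      using line_step[OF line_refl[OF rt], of k "\<not> b"] v by simp
    then have "line v k \<subseteq> line ?t k" by (rule line_trans)
    also have "\<dots> \<subseteq> Yset w j" using z k kn by (fastforce simp: Yset_def)
    finally show ?C
      using kn line_refl reduced_appendD(1)[OF rt] by blast
  qed
  have ?C using t
  proof (cases rule: Yset_cases)
    case 1
    then show ?C by (rule Z)
  next
    case (2 u s)
    obtain u0 where u0: "\<And>v. v \<in> line u s \<Longrightarrow> \<exists>m b. v = u0 @ replicate m (s, b)"
      using line_normal_form[OF reduced_Zset[OF 2(1)]] by metis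
    obtain m b' where m: "?t = u0 @ replicate m (s, b')" using u0[OF 2(4)] by blast
    show ?C
    proof (cases "k = s")
      case True
      have "v \<in> line u s" using line_step[OF 2(4), of "\<not> b"] v True by simp
      then have "line v k \<subseteq> line u s" using line_trans True by blast
      also have "\<dots> \<subseteq> Yset w j" using 2 by (auto simp: Yset_def)
      finally show ?C using True 2(3) line_refl reduced_appendD(1)[OF rt] by blast
    next
      case False
      \<comment> \<open>The edge crosses the direction of the line, so its far end cannot carry a
        power of \<open>s\<close> and equals \<open>u0\<close>. It is then a prefix of
        \<open>u\<close>, and the case of \<open>Zset w j\<close> applies again.\<close>
      have "m = 0"
      proof (rule ccontr)
        assume "m \<noteq> 0"
        then have "last ?t = (s, b')" unfolding m by simp
        then show False using False by simp
      qed
      moreover obtain m'' b'' where "u = u0 @ replicate m'' (s, b'')"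
        using u0[OF line_refl[OF reduced_Zset[OF 2(1)]]] by blast
      ultimately have "prefix ?t u" using m by simp
      then have "?t \<in> range alt_word \<union> Zset w j" by (rule prefix_Zset[OF 2(1)])
      moreover have "?t \<notin> range alt_word"
      proof
        assume "?t \<in> range alt_word"
        then obtain N where "alt_word N = ?t" by auto
        then have "(k, b) \<in> {(1, True), (2, True)}" using set_alt_word[of N] by auto
        then show False using k by auto
      qed
      ultimately show ?C using Z by blast
    qed
  qed
  then show "k \<le> nmin w j" "line v k \<subseteq> Yset w j" "v \<in> Yset w j" by auto
qed

end

section \<open>The tree \<open>\<Gamma>\<^sup>*\<close>\<close>

lemma cayley_verts_prefix: "v \<in> cayley_verts \<Longrightarrow> prefix u v \<Longrightarrow> u \<in> cayley_verts"
  unfolding cayley_verts_def words_iff using reduced_prefix set_mono_prefix by blast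

lemma free_red_in_cayley_verts: "v \<in> words \<Longrightarrow> free_red v \<in> cayley_verts"
  unfolding cayley_verts_def words_iff using set_free_red reduced_free_red by blast

lemma snoc_in_words: "v \<in> cayley_verts \<Longrightarrow> 1 \<le> i \<Longrightarrow> v @ [(i, b)] \<in> words"
  by (auto simp: cayley_verts_def words_iff)

definition neighbour :: "word \<Rightarrow> nat \<Rightarrow> bool \<Rightarrow> word" where
  "neighbour v i b = free_red (v @ [(i, b)])"

lemma neighbour_cases:
  assumes "v \<in> cayley_verts"
  obtains "neighbour v i b = v @ [(i, b)]" "1 \<le> i \<Longrightarrow> v @ [(i, b)] \<in> cayley_verts"
    | "v = neighbour v i b @ [(i, \<not> b)]"
proof -
  have rv: "reduced v" using assms by (simp add: cayley_verts_def)
  show ?thesis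
    using rv
  proof (cases rule: free_red_snoc_cases[where x = "(i, b)"])
    case 1
    then show ?thesis
      using that(1) snoc_in_words[OF assms, of i b] by (simp add: neighbour_def cayley_verts_def)
  next
    case 2
    then show ?thesis using that(2) by (simp add: neighbour_def)
  qed
qed

lemma neighbour_in_cayley_verts: "v \<in> cayley_verts \<Longrightarrow> 1 \<le> i \<Longrightarrow> neighbour v i b \<in> cayley_verts"
  unfolding neighbour_def by (intro free_red_in_cayley_verts snoc_in_words)

lemma neighbour_neighbour: "v \<in> cayley_verts \<Longrightarrow> neighbour (neighbour v i b) i (\<not> b) = v"
  using free_red_snoc_snoc[of v "(i, b)"] free_red_reduced
  by (simp add: neighbour_def cayley_verts_def)

lemma neighbour_snoc: "v @ [(i, b)] \<in> cayley_verts \<Longrightarrow> neighbour v i b = v @ [(i, b)]"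
  by (simp add: neighbour_def cayley_verts_def free_red_reduced)

lemma neighbour_butlast: "v @ [(i, b)] \<in> cayley_verts \<Longrightarrow> neighbour (v @ [(i, b)]) i (\<not> b) = v"
  using neighbour_neighbour[of v i b] cayley_verts_prefix[of "v @ [(i, b)]" v] by (simp add: neighbour_snoc)

lemma cayley_edge_source:
  assumes "v \<in> cayley_verts" "1 \<le> i"
  shows "cayley_edge v i x \<longleftrightarrow> x = neighbour v i True"
  using assms by (simp add: cayley_edge_def neighbour_def)

lemma cayley_edge_target:
  assumes "v \<in> cayley_verts" "1 \<le> i"
  shows "cayley_edge u i v \<longleftrightarrow> u = neighbour v i False"
proof
  assume "cayley_edge u i v"
  then have "u \<in> cayley_verts" "v = neighbour u i True"
    by (simp_all add: cayley_edge_def neighbour_def)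
  then show "u = neighbour v i False"
    using neighbour_neighbour[of u i True] by simp
next
  assume "u = neighbour v i False"
  then show "cayley_edge u i v"
    using assms neighbour_in_cayley_verts neighbour_neighbour[of v i False]
    by (simp add: cayley_edge_def neighbour_def[symmetric])
qed

text \<open>Removes \<open>free_red\<close> from adjacency: one end of an edge is the other with one
  more letter, positive if the edge points away from the root and negative if it points towards
  it.\<close>

lemma cayley_edge_iff:
  "cayley_edge u i v \<longleftrightarrow> (v = u @ [(i, True)] \<and> v \<in> cayley_verts) \<or> (u = v @ [(i, False)] \<and> u \<in> cayley_verts)"
proof
  assume e: "cayley_edge u i v"
  then have u: "u \<in> cayley_verts" "1 \<le> i" and v: "v = neighbour u i True"
    by (auto simp: cayley_edge_def neighbour_def)
  from u(1) show "(v = u @ [(i, True)] \<and> v \<in> cayley_verts) \<or> (u = v @ [(i, False)] \<and> u \<in> cayley_verts)"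
    using u v by (cases rule: neighbour_cases[where i = i and b = True]) auto
next
  assume *: "(v = u @ [(i, True)] \<and> v \<in> cayley_verts) \<or> (u = v @ [(i, False)] \<and> u \<in> cayley_verts)"
  then have "u \<in> cayley_verts" "1 \<le> i"
    by (auto simp: cayley_verts_def words_iff dest: reduced_appendD)
  then show "cayley_edge u i v"
    using * neighbour_snoc neighbour_butlast[of v i False] cayley_edge_source by auto
qed

lemma adj_iff:
  "adj u v \<longleftrightarrow> (\<exists>k b. (v = u @ [(k, b)] \<and> v \<in> cayley_verts) \<or> (u = v @ [(k, b)] \<and> u \<in> cayley_verts))"
proof
  assume "adj u v"
  then show "\<exists>k b. (v = u @ [(k, b)] \<and> v \<in> cayley_verts) \<or> (u = v @ [(k, b)] \<and> u \<in> cayley_verts)"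
    unfolding adj_def cayley_edge_iff by blast
next
  assume "\<exists>k b. (v = u @ [(k, b)] \<and> v \<in> cayley_verts) \<or> (u = v @ [(k, b)] \<and> u \<in> cayley_verts)"
  then obtain k b where
    kb: "(v = u @ [(k, b)] \<and> v \<in> cayley_verts) \<or> (u = v @ [(k, b)] \<and> u \<in> cayley_verts)"
    by blast
  show "adj u v" unfolding adj_def cayley_edge_iff using kb by (cases b) blast+
qed

text \<open>The walk is not geodesic, but all its vertices are prefixes of its ends. It therefore
  stays inside every set of words that is closed under prefixes.\<close>

lemma walk_through_root:
  assumes "x \<in> cayley_verts" "z \<in> cayley_verts"
  obtains p where "p \<noteq> []" "hd p = x" "last p = z" "successively adj p"
    "\<And>q. q \<in> set p \<Longrightarrow> prefix q x \<or> prefix q z"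
proof -
  have "\<exists>p. p \<noteq> [] \<and> hd p = x \<and> last p = [] \<and> successively adj p \<and> (\<forall>q\<in>set p. prefix q x)"
    using assms(1)
  proof (induction x rule: rev_induct)
    case Nil
    show ?case by (intro exI[of _ "[[]]"]) simp
  next
    case (snoc l x)
    then obtain p where p: "p \<noteq> []" "hd p = x" "last p = []" "successively adj p" "\<forall>q\<in>set p. prefix q x"
      using cayley_verts_prefix by (meson prefixI)
    moreover have "adj (x @ [l]) x" using snoc.prems by (cases l) (auto simp: adj_iff)
    ultimately show ?case
      by (intro exI[of _ "(x @ [l]) # p"]) (auto simp: successively_Cons)
  qed
  then obtain p where p: "p \<noteq> []" "hd p = x" "last p = []" "successively adj p" "\<forall>q\<in>set p. prefix q x"
    by blast
  have "\<exists>p. p \<noteq> [] \<and> hd p = x \<and> last p = z \<and> successively adj p \<and> (\<forall>q\<in>set p. prefix q x \<or> prefix q z)"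
    using assms(2)
  proof (induction z rule: rev_induct)
    case Nil
    show ?case using p by blast
  next
    case (snoc l z)
    then obtain p where p: "p \<noteq> []" "hd p = x" "last p = z" "successively adj p"
        "\<forall>q\<in>set p. prefix q x \<or> prefix q z"
      using cayley_verts_prefix by (meson prefixI)
    moreover have "adj z (z @ [l])" using snoc.prems by (cases l) (auto simp: adj_iff)
    ultimately show ?case
      by (intro exI[of _ "p @ [z @ [l]]"]) (auto simp: successively_append_iff)
  qed
  then show ?thesis using that by blast
qed

text \<open>The words with prefix \<open>v\<close> form the branch beyond \<open>v\<close>. A
  neighbour of such a word other than \<open>v\<close> itself still has the prefix \<open>v\<close>,
  so the branch can be left only through \<open>v\<close>.\<close>

lemma walk_crosses_prefix:
  assumes "successively adj p" "p \<noteq> []" "prefix v (hd p)" "\<not> prefix v (last p)"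
  shows "v \<in> set p"
  using assms
proof (induction p)
  case (Cons a p)
  show ?case
  proof (cases "a = v")
    case False
    have p: "p \<noteq> []" using Cons.prems by auto
    then have "adj a (hd p)" using Cons.prems(1) by (simp add: successively_Cons)
    then have "prefix v (hd p)"
      using Cons.prems(3) False by (auto simp: adj_iff)
    then show ?thesis using Cons p by (auto simp: successively_Cons)
  qed simp
qed simp

context word_sequence
begin

section \<open>Pruning as a condition on prefixes\<close>

lemma ray_edge_small: "v @ [(k, b)] \<in> range alt_word \<Longrightarrow> k \<le> 2"
proof -
  assume "v @ [(k, b)] \<in> range alt_word"
  then obtain N where "alt_word N = v @ [(k, b)]" by auto
  then have "(k, b) \<in> {(1, True), (2, True)}" using set_alt_word[of N] by auto
  then show ?thesis by auto
qed

lemma alt_word_in_cayley_verts: "alt_word N \<in> cayley_verts"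
  using set_alt_word[of N] by (auto simp: cayley_verts_def reduced_alt_word words_iff)

text \<open>Cut vertices always hang off Y on the side away from the root: if the edge led from
  \<open>v\<close> outwards to \<open>y\<close>, \<open>Yset_edge\<close> would put \<open>v\<close>
  into \<open>Yset w j\<close>. The label keeps \<open>v\<close> off the ray, and in another
  \<open>Yset w i\<close> it would drag \<open>y\<close> along, against disjointness.\<close>

lemma cut_verticesD:
  assumes "v \<in> cut_vertices G (Yset w j)" "G \<subseteq> cayley_verts" "1 \<le> j"
  obtains y k b where "y \<in> Yset w j" "3 \<le> k" "v = y @ [(k, b)]" "v \<notin> Y_all"
proof -
  have v: "v \<in> cayley_verts" "v \<notin> Yset w j"
    and small: "\<not> (\<exists>y\<in>Yset w j. \<exists>i\<in>{1, 2}. cayley_edge y i v \<or> cayley_edge v i y)"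
    using assms by (auto simp: cut_vertices_def)
  obtain y where y: "y \<in> Yset w j" "adj y v" using assms(1) by (auto simp: cut_vertices_def)
  then obtain k b where kb: "(v = y @ [(k, b)] \<and> v \<in> cayley_verts) \<or> (y = v @ [(k, b)] \<and> y \<in> cayley_verts)"
    by (auto simp: adj_iff)
  then have "1 \<le> k" by (auto simp: cayley_verts_def words_iff)
  moreover have "k \<notin> {1, 2}"
    using small y(1) kb unfolding cayley_edge_iff by (cases b) blast+
  ultimately have k: "3 \<le> k" by auto
  have vy: "v = y @ [(k, b)]"
    using kb Yset_edge(3)[OF assms(3) _ k] y(1) v(2) by blast
  have "v \<notin> Y_all"
  proof
    assume "v \<in> Y_all"
    then obtain i where "1 \<le> i" "v \<in> Yset w i"
      using ray_edge_small[of y k b] k vy by (auto simp: Y_all_def Y_union_def)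
    then show False
      using Yset_edge(3)[OF _ _ k] vy Yset_disjoint y(1) assms(3) v(2) by metis
  qed
  then show ?thesis using that y(1) k vy by blast
qed

lemma cut_verticesI:
  assumes "v \<in> G" "y \<in> Yset w j" "3 \<le> k" "v = y @ [(k, b)]" "v \<notin> Y_all"
    "1 \<le> j" "G \<subseteq> cayley_verts"
  shows "v \<in> cut_vertices G (Yset w j)"
proof -
  have v: "v \<in> cayley_verts" using assms by blast
  have notin: "v \<notin> Yset w j" using assms by (auto simp: Y_all_def Y_union_def)
  have "adj y v" using v assms(4) by (auto simp: adj_iff)
  \<comment> \<open>The last letter of \<open>v\<close> has index at least 3, so an edge labelled 1
    or 2 at \<open>v\<close> leads away from the root. Then \<open>v\<close> would be a prefix of a
    point of Y.\<close>
  moreover have "\<not> (cayley_edge y' i v \<or> cayley_edge v i y')" if "y' \<in> Yset w j" "i \<in> {1, 2}" for y' i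
  proof
    assume "cayley_edge y' i v \<or> cayley_edge v i y'"
    then have "prefix v y'"
      using that(2) assms(3,4) by (auto simp: cayley_edge_iff)
    moreover have "y' \<in> Y_all" using that assms(6) by (auto simp: Y_all_def Y_union_def)
    ultimately show False using prefix_Y_all assms(5) by blast
  qed
  ultimately show ?thesis
    using assms(1,2) notin by (auto simp: cut_vertices_def)
qed

text \<open>Closed form of the result of pruning along the \<open>Yset w i\<close> with
  \<open>i\<close> in \<open>J\<close>: an edge with label at least 3 may leave such a set outwards
  only if it ends in Y. The parameter covers the finite stages, \<open>{1..j}\<close>, and their
  intersection, \<open>{1..}\<close>.\<close>

definition pruned :: "nat set \<Rightarrow> word set" where
  "pruned J = {x \<in> cayley_verts. \<forall>p k b. prefix (p @ [(k, b)]) x \<longrightarrow> 3 \<le> k \<longrightarrow>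
     (\<exists>i\<in>J. p \<in> Yset w i) \<longrightarrow> p @ [(k, b)] \<in> Y_all}"

lemma pruned_prefix:
  assumes "x \<in> pruned J" "prefix u x"
  shows "u \<in> pruned J"
proof -
  have "prefix p x" if "prefix p u" for p using that assms(2) by (rule prefix_order.trans)
  then show ?thesis using assms cayley_verts_prefix[OF _ assms(2)] by (simp add: pruned_def)
qed

lemma alt_word_in_pruned: "alt_word N \<in> pruned J"
proof -
  have "\<not> 3 \<le> k" if "prefix (p @ [(k, b)]) (alt_word N)" for p k b
    using ray_edge_small[OF prefix_alt_word[OF that]] by simp
  then show ?thesis by (simp add: pruned_def alt_word_in_cayley_verts)
qed

text \<open>Being separated from the new Y-set by a cut vertex \<open>v\<close> amounts to having
  \<open>v\<close> as a prefix. If \<open>x\<close> extends \<open>v\<close>, a walk to Y has to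
  leave the branch beyond \<open>v\<close>; otherwise the walk through the root avoids
  \<open>v\<close>.\<close>

lemma Gamma_eq: "Gamma w j = pruned {1..j}"
proof (induction j)
  case 0
  show ?case by (simp add: pruned_def)
next
  case (Suc j)
  let ?G = "pruned {1..j}" and ?Y = "Yset w (Suc j)"
  have sub: "?G \<subseteq> cayley_verts" by (auto simp: pruned_def)
  have mono: "pruned {1..Suc j} \<subseteq> ?G" by (fastforce simp: pruned_def)
  have YY: "?Y \<subseteq> Y_all" by (auto simp: Y_all_def Y_union_def)
  have "prune ?G ?Y = pruned {1..Suc j}"
  proof (intro subset_antisym subsetI)
    fix x assume x: "x \<in> prune ?G ?Y"
    then have xG: "x \<in> ?G" by (simp add: prune_def)
    have "p @ [(k, b)] \<in> Y_all" if "prefix (p @ [(k, b)]) x" "3 \<le> k" "p \<in> ?Y" for p k b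
    proof (rule ccontr)
      let ?v = "p @ [(k, b)]"
      assume notin: "?v \<notin> Y_all"
      then have "?v \<in> cut_vertices ?G ?Y"
        using cut_verticesI[OF pruned_prefix[OF xG that(1)] that(3,2)] sub by simp
      moreover have "separated ?G ?Y ?v x"
        unfolding separated_def walk_in_def
        using walk_crosses_prefix that(1) prefix_Y_all YY notin by blast
      ultimately show False using x by (auto simp: prune_def)
    qed
    then show "x \<in> pruned {1..Suc j}"
      using xG by (simp add: pruned_def atLeastAtMostSuc_conv)
  next
    fix x assume x: "x \<in> pruned {1..Suc j}"
    have "x \<noteq> v \<and> \<not> separated ?G ?Y v x" if v: "v \<in> cut_vertices ?G ?Y" for v
    proof -
      obtain y k b where y: "y \<in> ?Y" "3 \<le> k" "v = y @ [(k, b)]" "v \<notin> Y_all"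
        using cut_verticesD[OF v sub] by auto
      have nx: "\<not> prefix v x" using x y by (simp add: pruned_def atLeastAtMostSuc_conv) blast
      \<comment> \<open>A convenient goal for the walk: it lies in the new Y-set and, being on the
        ray, in every pruned set.\<close>
      have hat: "w_hat w (Suc j) \<in> ?G" "w_hat w (Suc j) \<in> ?Y" "w_hat w (Suc j) \<in> Y_all"
        using alt_word_in_pruned w_hat_in_Zset[of "Suc j"] Zset_subset_Yset[of "Suc j"] YY
        by (auto simp only: w_hat_def)
      obtain p where p: "p \<noteq> []" "hd p = x" "last p = w_hat w (Suc j)" "successively adj p"
          "\<And>q. q \<in> set p \<Longrightarrow> prefix q x \<or> prefix q (w_hat w (Suc j))"
        using walk_through_root[of x "w_hat w (Suc j)"] x sub mono hat(1) by blast
      have "v \<notin> set p" using p(5) nx prefix_Y_all hat(3) y(4) by blast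
      moreover have "set p \<subseteq> ?G" using p(5) pruned_prefix hat(1) x mono by blast
      ultimately show ?thesis
        using p hat(2) nx unfolding separated_def walk_in_def by auto
    qed
    then show "x \<in> prune ?G ?Y" using x mono by (auto simp: prune_def)
  qed
  then show ?case using Suc by simp
qed

lemma Gamma_inf_eq: "Gamma_inf w = pruned {1..}"
proof (intro subset_antisym subsetI)
  fix x assume x: "x \<in> Gamma_inf w"
  then have *: "x \<in> pruned {1..j}" for j by (simp add: Gamma_inf_def Gamma_eq)
  show "x \<in> pruned {1..}"
    unfolding pruned_def
  proof (intro CollectI conjI allI impI)
    show "x \<in> cayley_verts" using *[of 0] by (simp add: pruned_def)
    fix p k b assume "prefix (p @ [(k, b)]) x" "3 \<le> k" "\<exists>i\<in>{1..}. p \<in> Yset w i"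
    moreover from this obtain i where "i \<in> {1..i}" "p \<in> Yset w i" by auto
    ultimately show "p @ [(k, b)] \<in> Y_all" using *[of i] unfolding pruned_def by blast
  qed
next
  fix x assume "x \<in> pruned {1..}"
  moreover have "pruned {1..} \<subseteq> pruned {1..j}" for j
    by (auto simp: pruned_def) (metis atLeast_iff One_nat_def)
  ultimately show "x \<in> Gamma_inf w" by (auto simp: Gamma_inf_def Gamma_eq)
qed

text \<open>At a vertex of \<open>Yset w j\<close> an outgoing branch with label at least 3 survives
  only inside Y, which by disjointness and \<open>Yset_edge\<close> bounds the label by
  \<open>nmin w j\<close>. At any other vertex no pruning condition restricts the next
  letter.\<close>

lemma infinite_valence_iff:
  assumes u: "u \<in> Gamma_inf w"
  shows "infinite {z \<in> Gamma_inf w. adj u z} \<longleftrightarrow> u \<notin> Y_union"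
proof
  assume inf: "infinite {z \<in> Gamma_inf w. adj u z}"
  show "u \<notin> Y_union"
  proof
    assume "u \<in> Y_union"
    then obtain j where j: "1 \<le> j" "u \<in> Yset w j" by (auto simp: Y_union_def)
    have "z \<in> insert (butlast u) ((\<lambda>l. u @ [l]) ` ({..nmin w j} \<times> UNIV))"
      if z: "z \<in> Gamma_inf w" "adj u z" for z
    proof -
      obtain k b where "(z = u @ [(k, b)] \<and> z \<in> cayley_verts) \<or> u = z @ [(k, b)]"
        using z(2) by (auto simp: adj_iff)
      then show ?thesis
      proof
        assume zu: "z = u @ [(k, b)] \<and> z \<in> cayley_verts"
        have "k \<le> nmin w j"
        proof (cases "3 \<le> k")
          case True
          then have "z \<in> Y_all"
            using z(1) zu j by (auto simp: Gamma_inf_eq pruned_def)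
          then obtain i where i: "1 \<le> i" "u @ [(k, b)] \<in> Yset w i"
            using ray_edge_small[of u k b] zu True by (auto simp: Y_all_def Y_union_def)
          then have "i = j" using Yset_edge(3)[OF i True] Yset_disjoint j by blast
          then show ?thesis using Yset_edge(1)[OF i True] by simp
        qed (use nmin(1)[OF j(1)] in simp)
        then show ?thesis using zu by auto
      qed simp
    qed
    then have "{z \<in> Gamma_inf w. adj u z} \<subseteq>
        insert (butlast u) ((\<lambda>l. u @ [l]) ` ({..nmin w j} \<times> UNIV))" by blast
    moreover have "finite (insert (butlast u) ((\<lambda>l. u @ [l]) ` ({..nmin w j} \<times> UNIV)))"
      by simp
    ultimately have "finite {z \<in> Gamma_inf w. adj u z}" by (rule finite_subset)
    then show False using inf by contradiction
  qed
next
  assume notin: "u \<notin> Y_union"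
  \<comment> \<open>Adding the index of the last letter makes the new letter differ from it, so
    nothing cancels. For empty \<open>u\<close> this index is an unspecified number, and any number
    will do.\<close>
  define f where "f k = u @ [(k + 3 + fst (last u), True)]" for k
  have uc: "u \<in> cayley_verts" using u by (simp add: Gamma_inf_eq pruned_def)
  have cv: "f k \<in> cayley_verts" for k
  proof -
    have "last u \<noteq> inv_letter (k + 3 + fst (last u), True)" by (cases "last u") auto
    then have "free_red (f k) = f k"
      using free_red_snoc[of u "(k + 3 + fst (last u), True)"] uc
      by (simp add: f_def cayley_verts_def)
    moreover have "f k \<in> words" unfolding f_def by (rule snoc_in_words[OF uc]) simp
    ultimately show ?thesis using free_red_in_cayley_verts by metis
  qed
  have "f k \<in> Gamma_inf w" for k
    unfolding Gamma_inf_eq pruned_def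
  proof (intro CollectI conjI cv allI impI)
    fix p k' b assume p: "prefix (p @ [(k', b)]) (f k)" "3 \<le> k'" "\<exists>i\<in>{1..}. p \<in> Yset w i"
    then have "p \<in> Y_union" by (auto simp: Y_union_def)
    then have "p \<noteq> u" using notin by blast
    then have "prefix (p @ [(k', b)]) u" using p(1) by (auto simp: f_def)
    then show "p @ [(k', b)] \<in> Y_all" using u p(2,3) unfolding Gamma_inf_eq pruned_def by blast
  qed
  then have "range f \<subseteq> {z \<in> Gamma_inf w. adj u z}"
    using cv by (auto simp: f_def adj_iff)
  moreover have "infinite (range f)"
    by (intro range_inj_infinite) (auto simp: f_def inj_def)
  ultimately show "infinite {z \<in> Gamma_inf w. adj u z}" using infinite_super by blast
qed

text \<open>Step 3 confines labels at least 3 that leave some \<open>Yset w i\<close> to edges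
  ending in Y. Step 4 forbids them at all other vertices, because these are precisely the ones of
  infinite valence.\<close>

lemma Gamma_star_eq:
  "Gamma_star w = {v \<in> cayley_verts. \<forall>p k b. prefix (p @ [(k, b)]) v \<longrightarrow> 3 \<le> k \<longrightarrow> p @ [(k, b)] \<in> Y_union}"
proof (intro subset_antisym subsetI)
  fix v assume v: "v \<in> Gamma_star w"
  then have vi: "v \<in> Gamma_inf w" by (simp add: Gamma_star_def)
  then have vc: "v \<in> cayley_verts" by (simp add: Gamma_inf_eq pruned_def)
  have "p @ [(k, b)] \<in> Y_union" if p: "prefix (p @ [(k, b)]) v" "3 \<le> k" for p k b
  proof -
    obtain x where x: "v = p @ (k, b) # x" using p(1) by (auto simp: prefix_def)
    have pi: "p \<in> Gamma_inf w"
      using pruned_prefix[of v "{1..}" p] vi x by (simp add: Gamma_inf_eq)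
    have "x \<in> words" using vc x by (auto simp: cayley_verts_def words_iff)
    then have "p \<in> Y_union"
    proof -
      have "\<not> infinite {z \<in> Gamma_inf w. adj p z}"
      proof
        assume inf: "infinite {z \<in> Gamma_inf w. adj p z}"
        have "k \<notin> {1, 2}" using p(2) by auto
        then show False using v pi inf x \<open>x \<in> words\<close> unfolding Gamma_star_def by blast
      qed
      then show ?thesis using infinite_valence_iff[OF pi] by blast
    qed
    then have "p @ [(k, b)] \<in> Y_all"
      using vi p by (auto simp: Gamma_inf_eq pruned_def Y_union_def)
    then show ?thesis using ray_edge_small[of p k b] p(2) by (auto simp: Y_all_def)
  qed
  then show "v \<in> {v \<in> cayley_verts. \<forall>p k b. prefix (p @ [(k, b)]) v \<longrightarrow> 3 \<le> k \<longrightarrow> p @ [(k, b)] \<in> Y_union}"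
    using vc by blast
next
  fix v
  assume "v \<in> {v \<in> cayley_verts. \<forall>p k b. prefix (p @ [(k, b)]) v \<longrightarrow> 3 \<le> k \<longrightarrow> p @ [(k, b)] \<in> Y_union}"
  then have vc: "v \<in> cayley_verts"
    and edge: "\<And>p k b. prefix (p @ [(k, b)]) v \<Longrightarrow> 3 \<le> k \<Longrightarrow> p @ [(k, b)] \<in> Y_union" by auto
  have vi: "v \<in> Gamma_inf w" using vc edge by (auto simp: Gamma_inf_eq pruned_def Y_all_def)
  have False if u: "u \<in> Gamma_inf w" "infinite {z \<in> Gamma_inf w. adj u z}" "k \<notin> {1, 2}"
    "v = u @ (k, b) # x" for u k b x
  proof -
    have k: "3 \<le> k" using vc u(3,4) by (fastforce simp: cayley_verts_def words_iff)
    have "prefix (u @ [(k, b)]) v" using u(4) by simp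
    then obtain j where "1 \<le> j" "u @ [(k, b)] \<in> Yset w j"
      using edge[OF _ k] by (auto simp: Y_union_def)
    then have "u \<in> Y_union" using Yset_edge(3)[OF _ _ k] by (auto simp: Y_union_def)
    then show False using infinite_valence_iff[OF u(1)] u(2) by blast
  qed
  then show "v \<in> Gamma_star w" using vi unfolding Gamma_star_def by blast
qed

section \<open>Labels at the vertices of the final tree\<close>

lemma Gamma_star_cayley_verts: "v \<in> Gamma_star w \<Longrightarrow> v \<in> cayley_verts"
  by (simp add: Gamma_star_eq)

lemma Gamma_star_prefix:
  assumes "v \<in> Gamma_star w" "prefix u v"
  shows "u \<in> Gamma_star w"
proof -
  have "prefix p v" if "prefix p u" for p using that assms(2) by (rule prefix_order.trans)
  then show ?thesis using assms cayley_verts_prefix[OF _ assms(2)] by (simp add: Gamma_star_eq)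
qed

lemma Nil_in_Gamma_star: "[] \<in> Gamma_star w"
  by (simp add: Gamma_star_eq cayley_verts_def words_iff reduced_def)

lemma Gamma_star_snoc:
  assumes "v \<in> Gamma_star w" "v @ [(k, b)] \<in> cayley_verts" "3 \<le> k \<Longrightarrow> v @ [(k, b)] \<in> Y_union"
  shows "v @ [(k, b)] \<in> Gamma_star w"
  using assms by (auto simp: Gamma_star_eq)

lemma neighbour_small_in_Gamma_star:
  assumes "v \<in> Gamma_star w" "1 \<le> i" "i \<le> 2"
  shows "neighbour v i b \<in> Gamma_star w"
  using Gamma_star_cayley_verts[OF assms(1)]
proof (cases rule: neighbour_cases[where i = i and b = b])
  case 1
  then show ?thesis using Gamma_star_snoc assms by simp
next
  case 2
  then show ?thesis using Gamma_star_prefix[OF assms(1)] by (metis prefixI)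
qed

text \<open>\<open>Yset_edge\<close> applies to whichever end of the edge is farther from the root.
  If that is \<open>v\<close>, the line is rewritten as a line through \<open>v\<close> by
  \<open>line_trans\<close>.\<close>

lemma neighbour_large_in_Gamma_star:
  assumes "v \<in> Gamma_star w" "3 \<le> i" "neighbour v i b \<in> Gamma_star w"
  obtains j where "1 \<le> j" "i \<le> nmin w j" "v \<in> Yset w j" "line v i \<subseteq> Yset w j"
proof -
  have vc: "v \<in> cayley_verts" using assms(1) by (rule Gamma_star_cayley_verts)
  then show ?thesis
  proof (cases rule: neighbour_cases[where i = i and b = b])
    case 1
    then have "v @ [(i, b)] \<in> Y_union" using assms by (auto simp: Gamma_star_eq)
    then obtain j where "1 \<le> j" "v @ [(i, b)] \<in> Yset w j" by (auto simp: Y_union_def)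
    then show ?thesis using that Yset_edge[OF _ _ assms(2)] by blast
  next
    case 2
    let ?u = "neighbour v i b"
    have "?u @ [(i, \<not> b)] \<in> Y_union"
      using 2 assms(1,2) unfolding Gamma_star_eq by (metis (no_types, lifting) mem_Collect_eq prefix_order.order_refl)
    then obtain j where j: "1 \<le> j" "?u @ [(i, \<not> b)] \<in> Yset w j" by (auto simp: Y_union_def)
    have "v \<in> line ?u i"
      using line_step[OF line_refl, of ?u i "\<not> b"] neighbour_neighbour[OF vc, of i b] vc assms(3)
        Gamma_star_cayley_verts by (auto simp: neighbour_def cayley_verts_def)
    then have "line v i \<subseteq> Yset w j" using line_trans Yset_edge(2)[OF j assms(2)] by blast
    then show ?thesis using that j 2 Yset_edge(1)[OF j assms(2)] by metis
  qed
qed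

text \<open>This is the claim in Step 4 that the edges ending and starting at a vertex carry the
  same labels. It holds because Y contains complete lines, and with a point both neighbours on the
  line.\<close>

lemma neighbour_in_Gamma_star_flip:
  assumes v: "v \<in> Gamma_star w" and i: "1 \<le> i" and nb: "neighbour v i b \<in> Gamma_star w"
  shows "neighbour v i c \<in> Gamma_star w"
proof (cases "3 \<le> i")
  case False
  then show ?thesis using neighbour_small_in_Gamma_star[OF v i] by simp
next
  case True
  have vc: "v \<in> cayley_verts" using v by (rule Gamma_star_cayley_verts)
  obtain j where j: "1 \<le> j" "line v i \<subseteq> Yset w j"
    using neighbour_large_in_Gamma_star[OF v True nb] by metis
  have "neighbour v i c \<in> line v i"
    using line_step[OF line_refl] vc by (auto simp: neighbour_def cayley_verts_def)
  then have Y: "neighbour v i c \<in> Y_union" using j by (auto simp: Y_union_def)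
  from vc show ?thesis
  proof (cases rule: neighbour_cases[where i = i and b = c])
    case 1
    then show ?thesis using Gamma_star_snoc[OF v] i Y by simp
  next
    case 2
    then show ?thesis using Gamma_star_prefix[OF v] by (metis prefixI)
  qed
qed

text \<open>Edges with label at least 3 never leave a set \<open>Y\<^sub>j\<close>, on which the labels are bounded. This is what
  forces lifts of paths to converge.\<close>

lemma Gamma_star_component:
  assumes v: "v \<in> Gamma_star w"
  obtains D N where "v \<in> D" "D \<subseteq> Gamma_star w" "2 \<le> N"
    "\<And>u i b. u \<in> D \<Longrightarrow> 3 \<le> i \<Longrightarrow> neighbour u i b \<in> Gamma_star w \<Longrightarrow> i \<le> N \<and> neighbour u i b \<in> D"
proof (cases "v \<in> Y_union")
  case True
  then obtain j where j: "1 \<le> j" "v \<in> Yset w j" by (auto simp: Y_union_def)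
  show ?thesis
  proof (rule that)
    show "v \<in> Yset w j \<inter> Gamma_star w" "Yset w j \<inter> Gamma_star w \<subseteq> Gamma_star w" "2 \<le> nmin w j"
      using j v nmin by auto
    fix u i b assume u: "u \<in> Yset w j \<inter> Gamma_star w" and i: "3 \<le> i"
      and nb: "neighbour u i b \<in> Gamma_star w"
    obtain j' where j': "1 \<le> j'" "i \<le> nmin w j'" "u \<in> Yset w j'" "line u i \<subseteq> Yset w j'"
      using neighbour_large_in_Gamma_star[OF _ i nb] u by blast
    have "j' = j" using Yset_disjoint j(1) j'(1,3) u by blast
    moreover have "neighbour u i b \<in> line u i"
      using line_step[OF line_refl] u Gamma_star_cayley_verts
      by (auto simp: neighbour_def cayley_verts_def)
    ultimately show "i \<le> nmin w j \<and> neighbour u i b \<in> Yset w j \<inter> Gamma_star w"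
      using j' nb by blast
  qed
next
  case False
  \<comment> \<open>Off \<open>Y_union\<close> no label at least 3 occurs at \<open>v\<close>, so
    the single vertex with bound 2 will do.\<close>
  have "\<not> neighbour v i b \<in> Gamma_star w" if "3 \<le> i" for i b
    using neighbour_large_in_Gamma_star[OF v that] False by (auto simp: Y_union_def)
  then show ?thesis using that[of "{v}" 2] v by auto
qed

end

section \<open>Coordinates on the Hawaiian Earring\<close>

lemma ell_ends: "ell i 0 = (0, 0)" "ell i 1 = (0, 0)"
  by (simp_all add: ell_def)

text \<open>On the earring minus its base point the index of the circle and the parameter of \<open>ell\<close> are
  continuous functions of the point: \<open>2y / (x\<^sup>2 + y\<^sup>2)\<close> and \<open>1/2 - arctan (x/y) / \<pi>\<close>.\<close>

definition circ_index :: "real \<times> real \<Rightarrow> real" where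
  "circ_index P = 2 * snd P / ((fst P)\<^sup>2 + (snd P)\<^sup>2)"

definition circ_param :: "real \<times> real \<Rightarrow> real" where
  "circ_param P = 1/2 - arctan (fst P / snd P) / pi"

text \<open>In half angles x/y is the cotangent of \<open>pi * t\<close>, and x^2 + y^2 is twice y
  divided by the index of the circle. The formulas for \<open>circ_param\<close> and
  \<open>circ_index\<close> are read off from this.\<close>

lemma ell_half_angle:
  "ell i t = (2 * sin (pi * t) * cos (pi * t) / real i, 2 * (sin (pi * t))\<^sup>2 / real i)"
  using sin_double[of "pi * t"] cos_double_sin[of "pi * t"] by (simp add: ell_def mult.assoc)

lemma ell_inverse:
  assumes "1 \<le> i" "0 < t" "t < 1"
  shows "0 < snd (ell i t)" "circ_index (ell i t) = real i" "circ_param (ell i t) = t"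
proof -
  define s c where "s = sin (pi * t)" and "c = cos (pi * t)"
  have s: "0 < s" using assms unfolding s_def by (intro sin_gt_zero) auto
  have sc: "s\<^sup>2 + c\<^sup>2 = 1" by (simp add: s_def c_def)
  have i: "0 < real i" using assms by simp
  have e: "ell i t = (2 * s * c / i, 2 * s\<^sup>2 / i)" by (simp add: ell_half_angle s_def c_def)
  show "0 < snd (ell i t)" using s i by (simp add: e)
  have "(2 * s * c / i)\<^sup>2 + (2 * s\<^sup>2 / i)\<^sup>2 = 4 * s\<^sup>2 * (s\<^sup>2 + c\<^sup>2) / i\<^sup>2"
    by (simp add: power2_eq_square add_divide_distrib[symmetric] algebra_simps)
  also have "\<dots> = 4 * s\<^sup>2 / (real i)\<^sup>2" using sc by simp
  finally have "circ_index (ell i t) = 2 * (2 * s\<^sup>2 / real i) / (4 * s\<^sup>2 / (real i)\<^sup>2)"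
    by (simp add: circ_index_def e)
  also have "\<dots> = real i" using s i by (simp add: power2_eq_square)
  finally show "circ_index (ell i t) = real i" .
  have "fst (ell i t) / snd (ell i t) = c / s"
    using s i by (simp add: e power2_eq_square field_simps)
  also have "\<dots> = tan (pi / 2 - pi * t)"
    by (simp add: tan_def s_def c_def sin_diff cos_diff)
  finally have "arctan (fst (ell i t) / snd (ell i t)) = pi / 2 - pi * t"
    using assms by (simp add: arctan_tan)
  then show "circ_param (ell i t) = t" by (simp add: circ_param_def field_simps)
qed

lemma ell_nonzero: "1 \<le> i \<Longrightarrow> 0 < t \<Longrightarrow> t < 1 \<Longrightarrow> ell i t \<noteq> (0, 0)"
  using ell_inverse(1) by fastforce

lemma ell_inject:
  assumes "1 \<le> i" "0 < t" "t < 1" "1 \<le> j" "0 < s" "s < 1"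
  shows "ell i t = ell j s \<longleftrightarrow> i = j \<and> t = s"
  using ell_inverse[OF assms(1-3)] ell_inverse[OF assms(4-6)] by (metis of_nat_eq_iff)

lemma ell_in_circ: "1 \<le> i \<Longrightarrow> ell i t \<in> circ i"
proof -
  assume "1 \<le> i"
  have "(sin (2 * pi * t))\<^sup>2 + (cos (2 * pi * t))\<^sup>2 = 1" by simp
  then have "(sin (2 * pi * t) / i)\<^sup>2 + (- cos (2 * pi * t) / i)\<^sup>2 = 1 / i\<^sup>2"
    by (simp add: power_divide add_divide_distrib[symmetric])
  then show ?thesis by (simp add: ell_def circ_def diff_divide_distrib)
qed

lemma circ_cases:
  assumes "P \<in> circ i" "1 \<le> i"
  obtains "P = (0, 0)" | t where "0 < t" "t < 1" "P = ell i t"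
proof (cases "snd P = 0")
  case True
  then have "(fst P)\<^sup>2 = 0" using assms by (auto simp: circ_def power_divide)
  then show ?thesis using that(1) True by (cases P) simp
next
  case False
  obtain x y where P: "P = (x, y)" by (cases P)
  have i: "0 < real i" using assms by simp
  have "x\<^sup>2 + (y - 1 / i)\<^sup>2 = 1 / i\<^sup>2" using assms P by (auto simp: circ_def power_divide)
  then have xy: "x\<^sup>2 + y\<^sup>2 = 2 * y / i"
    by (simp add: power2_diff power_divide)
  have "0 < x\<^sup>2 + y\<^sup>2" using False P by (simp add: sum_power2_gt_zero_iff)
  then have y: "0 < y" using xy i by (simp add: zero_less_divide_iff)
  define z where "z = arctan (x / y)"
  \<comment> \<open>This is \<open>circ_param P\<close>. The arctangent is strictly between its
    limits, which places \<open>t\<close> strictly between 0 and 1.\<close>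
  define t where "t = 1/2 - z / pi"
  have z: "- (pi / 2) < z" "z < pi / 2" unfolding z_def by (rule arctan_lbound arctan_ubound)+
  have t: "0 < t" "t < 1" using z by (auto simp: t_def field_simps)
  have pt: "pi * t = pi / 2 - z" by (simp add: t_def field_simps)
  have sn: "sin (pi * t) = 1 / sqrt (1 + (x / y)\<^sup>2)"
    unfolding pt by (simp add: sin_diff z_def cos_arctan)
  have cs: "cos (pi * t) = (x / y) / sqrt (1 + (x / y)\<^sup>2)"
    unfolding pt by (simp add: cos_diff z_def sin_arctan)
  have pos: "0 < 1 + (x / y)\<^sup>2" by (simp add: add_pos_nonneg)
  have q: "1 + (x / y)\<^sup>2 = 2 / (y * i)"
    using xy y i by (simp add: power_divide field_simps power2_eq_square)
  have "sin (pi * t) * cos (pi * t) = (x / y) / (1 + (x / y)\<^sup>2)"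
    unfolding sn cs using pos by (simp add: field_simps)
  moreover have "(sin (pi * t))\<^sup>2 = 1 / (1 + (x / y)\<^sup>2)"
    unfolding sn using pos by (simp add: power_divide)
  ultimately have "ell i t = P"
    unfolding ell_half_angle mult.assoc P q using y i by (simp add: field_simps)
  then show ?thesis using that(2) t by blast
qed

lemma earring_cases:
  assumes "P \<in> earring"
  obtains "P = (0, 0)" | i t where "1 \<le> i" "0 < t" "t < 1" "P = ell i t"
proof -
  obtain i where "1 \<le> i" "P \<in> circ i" using assms by (auto simp: earring_def)
  then show ?thesis using that circ_cases[of P i] by metis
qed

lemma ell_in_earring: "1 \<le> i \<Longrightarrow> ell i t \<in> earring"
  using ell_in_circ by (auto simp: earring_def)

lemma zero_in_earring: "(0, 0) \<in> earring"
  using ell_in_earring[of 1 0] by (simp add: ell_ends)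

lemma continuous_on_ell: "continuous_on A (ell i)"
  unfolding ell_def by (cases "i = 0") (auto intro!: continuous_intros)

text \<open>Off the base point \<open>circ_index\<close> takes integer values on the earring, so the
  open window of radius 1/2 around \<open>i\<close> isolates one circle. On it
  \<open>circ_param\<close> cuts out the arc.\<close>

lemma openin_ell_image:
  assumes "1 \<le> i" "open A" "A \<subseteq> {0<..<1}"
  shows "openin (top_of_set earring) (ell i ` A)"
proof -
  define H where "H = {P :: real \<times> real. 0 < snd P}"
  have H: "open H" unfolding H_def by (intro open_Collect_less continuous_intros)
  have cp: "continuous_on H circ_param" and ci: "continuous_on H circ_index"
    unfolding circ_param_def circ_index_def H_def
    by (auto intro!: continuous_intros simp: sum_power2_eq_zero_iff)
  define B where "B = (H \<inter> circ_param -` A) \<inter> (H \<inter> circ_index -` {real i - 1/2<..<real i + 1/2})"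
  have "open B"
    unfolding B_def using H cp ci assms(2)
    by (intro open_Int continuous_open_preimage) auto
  moreover have "ell i ` A = earring \<inter> B"
  proof (intro subset_antisym subsetI)
    fix P assume "P \<in> ell i ` A"
    then obtain t where t: "t \<in> A" "P = ell i t" by blast
    then have "0 < t" "t < 1" using assms(3) by auto
    then show "P \<in> earring \<inter> B"
      using ell_inverse[OF assms(1), of t] t ell_in_earring[OF assms(1)]
      by (auto simp: B_def H_def)
  next
    fix P assume P: "P \<in> earring \<inter> B"
    then have "P \<noteq> (0, 0)" by (auto simp: B_def H_def)
    then obtain j t where j: "1 \<le> j" "0 < t" "t < 1" "P = ell j t"
      using P earring_cases by blast
    then have "circ_param P = t" "circ_index P = real j" using ell_inverse[OF j(1-3)] by auto
    then have "t \<in> A" "real j < real (i + 1)" "real i < real (j + 1)" using P by (auto simp: B_def)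
    then have "t \<in> A" "j = i" unfolding of_nat_less_iff by auto
    then show "P \<in> ell i ` A" using j by auto
  qed
  ultimately show ?thesis by (auto simp: openin_open)
qed

lemma zero_in_earring_Uinf: "(0, 0) \<in> earring_Uinf n"
proof -
  have "(0, 0) \<in> circ (n + 1)" using ell_in_circ[of "n + 1" 0] by (simp add: ell_ends)
  then show ?thesis unfolding earring_Uinf_def by (intro UnI2) auto
qed

lemma ell_in_earring_Uinf:
  assumes "1 \<le> i" "0 < t" "t < 1"
  shows "ell i t \<in> earring_Uinf n \<longleftrightarrow> n < i \<or> t < 3/8 \<or> 5/8 < t"
proof
  assume "ell i t \<in> earring_Uinf n"
  then consider j s where "j \<in> {1..n}" "s \<in> {0..<3/8} \<union> {5/8<..1}" "ell i t = ell j s"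
    | j where "n < j" "ell i t \<in> circ j"
    unfolding earring_Uinf_def by fastforce
  then show "n < i \<or> t < 3/8 \<or> 5/8 < t"
  proof cases
    case 1
    then have "s \<noteq> 0 \<and> s \<noteq> 1" using ell_nonzero[OF assms] ell_ends by metis
    then show ?thesis using 1 ell_inject[OF assms, of j s] by auto
  next
    case 2
    then show ?thesis
      using circ_cases[of "ell i t" j] ell_nonzero[OF assms] ell_inject[OF assms, of j]
      by (metis One_nat_def Suc_leI gr0I not_less_zero)
  qed
next
  assume *: "n < i \<or> t < 3/8 \<or> 5/8 < t"
  show "ell i t \<in> earring_Uinf n"
  proof (cases "n < i")
    case True
    then have "i \<in> {n + 1..}" by simp
    then show ?thesis
      using ell_in_circ[OF assms(1)] unfolding earring_Uinf_def by (intro UnI2) blast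
  next
    case False
    then have "i \<in> {1..n}" "t \<in> {0..<3/8} \<union> {5/8<..1}" using * assms by auto
    then show ?thesis unfolding earring_Uinf_def by (intro UnI1) blast
  qed
qed

lemma earring_Uinf_subset: "earring_Uinf n \<subseteq> earring"
proof
  fix P assume "P \<in> earring_Uinf n"
  then consider i t where "1 \<le> i" "P = ell i t" | i where "1 \<le> i" "P \<in> circ i"
    unfolding earring_Uinf_def by fastforce
  then show "P \<in> earring" using ell_in_earring by cases (auto simp: earring_def)
qed

lemma earring_Uinf_antimono: "n \<le> m \<Longrightarrow> earring_Uinf m \<subseteq> earring_Uinf n"
proof
  fix P assume P: "n \<le> m" "P \<in> earring_Uinf m"
  then have "P \<in> earring" using earring_Uinf_subset by blast
  then show "P \<in> earring_Uinf n"
    using P by (cases rule: earring_cases) (auto simp: zero_in_earring_Uinf ell_in_earring_Uinf)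
qed

text \<open>The complement in the earring consists of the middle arcs of the first \<open>n\<close>
  circles, a finite union of compact sets that avoids the base point.\<close>

lemma openin_earring_Uinf: "openin (top_of_set earring) (earring_Uinf n)"
proof -
  define K where "K = (\<Union>i\<in>{1..n}. ell i ` {3/8..5/8})"
  have K: "P \<in> K \<longleftrightarrow> (\<exists>i t. 1 \<le> i \<and> i \<le> n \<and> 3/8 \<le> t \<and> t \<le> 5/8 \<and> P = ell i t)" for P
    by (force simp: K_def)
  have zero: "(0, 0) \<notin> K"
  proof
    assume "(0, 0) \<in> K"
    then obtain i t where "1 \<le> i" "3/8 \<le> t" "t \<le> 5/8" "(0, 0) = ell i t" unfolding K by blast
    then show False using ell_nonzero[of i t] by simp
  qed
  have ellK: "ell i t \<in> K \<longleftrightarrow> ell i t \<notin> earring_Uinf n" if it: "1 \<le> i" "0 < t" "t < 1" for i t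
  proof -
    have "ell i t = ell j s \<longleftrightarrow> i = j \<and> t = s" if "1 \<le> j" "3/8 \<le> s" "s \<le> 5/8" for j s
      using ell_inject[OF it, of j s] that by auto
    then have "ell i t \<in> K \<longleftrightarrow> i \<le> n \<and> 3/8 \<le> t \<and> t \<le> 5/8"
      unfolding K using it(1) by blast
    then show ?thesis by (auto simp: ell_in_earring_Uinf[OF it])
  qed
  have "compact K" unfolding K_def
    by (intro compact_UN compact_continuous_image continuous_on_ell) auto
  then have "open (- K)" by (simp add: compact_imp_closed open_closed)
  moreover have "earring_Uinf n = earring \<inter> - K"
  proof (intro subset_antisym subsetI)
    fix P assume P: "P \<in> earring_Uinf n"
    then have "P \<in> earring" using earring_Uinf_subset by blast
    then show "P \<in> earring \<inter> - K"
      using P zero ellK zero_in_earring ell_in_earring by (cases rule: earring_cases) auto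
  next
    fix P assume P: "P \<in> earring \<inter> - K"
    then have "P \<in> earring" by blast
    then show "P \<in> earring_Uinf n"
      using P ellK zero_in_earring_Uinf by (cases rule: earring_cases) auto
  qed
  ultimately show ?thesis by (auto simp: openin_open)
qed

section \<open>The topology of the covering graph\<close>

lemma continuous_map_inv_into_open:
  assumes "open_map X Y q" "openin X W" "inj_on q W"
  shows "continuous_map (subtopology Y (q ` W)) X (inv_into W q)"
  unfolding continuous_map_def
proof (intro conjI allI impI)
  show "inv_into W q \<in> topspace (subtopology Y (q ` W)) \<rightarrow> topspace X"
    using openin_subset[OF assms(2)] by (auto simp: inv_into_f_f[OF assms(3)])
  fix S assume S: "openin X S"
  have "{b \<in> topspace (subtopology Y (q ` W)). inv_into W q b \<in> S} = q ` (W \<inter> S) \<inter> topspace Y"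
    by (auto simp: inv_into_f_f[OF assms(3)])
  moreover have "openin Y (q ` (W \<inter> S))"
    using assms S by (simp add: open_map_def openin_Int)
  ultimately show "openin (subtopology Y (q ` W)) {b \<in> topspace (subtopology Y (q ` W)). inv_into W q b \<in> S}"
    by (auto simp: openin_subtopology)
qed

lemma homeomorphic_map_open_restriction:
  assumes "continuous_map X Y q" "open_map X Y q" "openin X W" "inj_on q W"
  shows "homeomorphic_map (subtopology X W) (subtopology Y (q ` W)) q"
proof (rule bijective_open_imp_homeomorphic_map)
  have WX: "W \<subseteq> topspace X" using assms(3) by (rule openin_subset)
  then have qW: "q ` W \<subseteq> topspace Y" using assms(1) by (auto simp: continuous_map_def)
  show "continuous_map (subtopology X W) (subtopology Y (q ` W)) q"
    using assms(1) by (auto simp: continuous_map_in_subtopology continuous_map_from_subtopology)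
  show "open_map (subtopology X W) (subtopology Y (q ` W)) q"
    unfolding open_map_def
  proof (intro allI impI)
    fix S assume "openin (subtopology X W) S"
    then have "openin X S" "S \<subseteq> W" using assms(3) by (simp_all add: openin_open_subtopology)
    then show "openin (subtopology Y (q ` W)) (q ` S)"
      using assms(2) by (auto simp: open_map_def openin_subtopology intro!: exI[of _ "q ` S"])
  qed
  show "q ` topspace (subtopology X W) = topspace (subtopology Y (q ` W))"
    using WX qW by (simp add: inf_absorb2)
  show "inj_on q (topspace (subtopology X W))"
    using assms(4) by (auto simp: inj_on_def)
qed

context word_sequence
begin

text \<open>Every label occurs at every vertex exactly once outgoing and once incoming, as a tree
  edge or as an added loop. So the edge is determined by vertex and label, and its other end becomes
  a function.\<close>

definition edge_target :: "word \<Rightarrow> nat \<Rightarrow> word" where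
  "edge_target v i = (if neighbour v i True \<in> Gamma_star w then neighbour v i True else v)"

definition edge_source :: "word \<Rightarrow> nat \<Rightarrow> word" where
  "edge_source v i = (if neighbour v i False \<in> Gamma_star w then neighbour v i False else v)"

lemma E_set_iff:
  assumes v: "v \<in> Gamma_star w"
  shows "i \<in> E_set w v \<longleftrightarrow> 1 \<le> i \<and> neighbour v i b \<in> Gamma_star w"
proof -
  have vc: "v \<in> cayley_verts" using v by (rule Gamma_star_cayley_verts)
  have "i \<in> E_set w v \<longleftrightarrow> 1 \<le> i \<and> neighbour v i False \<in> Gamma_star w"
  proof
    assume "i \<in> E_set w v"
    then obtain u where u: "u \<in> Gamma_star w" "cayley_edge u i v" by (auto simp: E_set_def)
    then have "1 \<le> i" by (simp add: cayley_edge_def)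
    then show "1 \<le> i \<and> neighbour v i False \<in> Gamma_star w"
      using u cayley_edge_target[OF vc] by simp
  next
    assume "1 \<le> i \<and> neighbour v i False \<in> Gamma_star w"
    then show "i \<in> E_set w v" using cayley_edge_target[OF vc] by (auto simp: E_set_def)
  qed
  then show ?thesis using neighbour_in_Gamma_star_flip[OF v] by blast
qed

lemma hat_edgeD:
  assumes "(u, i, v) \<in> hat_edges w"
  shows "u \<in> Gamma_star w" "v \<in> Gamma_star w" "1 \<le> i"
  using assms by (auto simp: hat_edges_def cayley_edge_def)

lemma hat_edge_from:
  assumes v: "v \<in> Gamma_star w"
  shows "(v, i, x) \<in> hat_edges w \<longleftrightarrow> 1 \<le> i \<and> x = edge_target v i"
proof (cases "1 \<le> i")
  case True
  have vc: "v \<in> cayley_verts" using v by (rule Gamma_star_cayley_verts)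
  show ?thesis
    using True v E_set_iff[OF v, of i True] cayley_edge_source[OF vc True]
    by (auto simp: hat_edges_def edge_target_def)
qed (auto dest: hat_edgeD)

lemma hat_edge_to:
  assumes v: "v \<in> Gamma_star w"
  shows "(x, i, v) \<in> hat_edges w \<longleftrightarrow> 1 \<le> i \<and> x = edge_source v i"
proof (cases "1 \<le> i")
  case True
  have vc: "v \<in> cayley_verts" using v by (rule Gamma_star_cayley_verts)
  show ?thesis
    using True v E_set_iff[OF v, of i False] cayley_edge_target[OF vc True]
    by (auto simp: hat_edges_def edge_source_def)
qed (auto dest: hat_edgeD)

lemma nv_le:
  assumes "v \<in> Gamma_star w" "2 \<le> N"
    "\<And>i b. 3 \<le> i \<Longrightarrow> neighbour v i b \<in> Gamma_star w \<Longrightarrow> i \<le> N"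
  shows "2 \<le> nv w v" "E_set w v \<subseteq> {1..nv w v}" "nv w v \<le> N"
proof -
  have "E_set w v \<subseteq> {1..N}"
  proof
    fix i assume "i \<in> E_set w v"
    then have "1 \<le> i" "neighbour v i True \<in> Gamma_star w" using E_set_iff[OF assms(1)] by auto
    then show "i \<in> {1..N}" using assms(2) assms(3)[of i True] by (cases "3 \<le> i") auto
  qed
  then have N: "2 \<le> N \<and> E_set w v \<subseteq> {1..N}" using assms(2) by blast
  show "nv w v \<le> N" unfolding nv_def using N by (rule Least_le)
  have "2 \<le> nv w v \<and> E_set w v \<subseteq> {1..nv w v}" unfolding nv_def using N by (rule LeastI)
  then show "2 \<le> nv w v" "E_set w v \<subseteq> {1..nv w v}" by auto
qed

lemma nv_bounds:
  assumes "v \<in> Gamma_star w"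
  shows "2 \<le> nv w v" "E_set w v \<subseteq> {1..nv w v}"
  using Gamma_star_component[OF assms] nv_le[OF assms] by metis+

lemma hat_loop:
  assumes v: "v \<in> Gamma_star w" and i: "nv w v < i"
  shows "edge_target v i = v" "edge_source v i = v"
proof -
  have "i \<notin> E_set w v" using nv_bounds(2)[OF v] i by auto
  moreover have "1 \<le> i" using i by simp
  ultimately show "edge_target v i = v" "edge_source v i = v"
    using E_set_iff[OF v] by (auto simp: edge_target_def edge_source_def)
qed

lemma Vertex_in_hat_Uv:
  assumes v: "v \<in> Gamma_star w"
  shows "Vertex x \<in> hat_Uv w v \<longleftrightarrow> x = v"
proof
  assume "Vertex x \<in> hat_Uv w v"
  then show "x = v" by (auto simp: hat_Uv_def split: if_splits)
next
  assume "x = v"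
  moreover have "(v, 1, edge_target v 1) \<in> hat_edges w" using hat_edge_from[OF v] by simp
  moreover have "Vertex v \<in> psi (v, 1, edge_target v 1) ` {0..<3/8}"
    by (rule image_eqI[of _ _ 0]) auto
  ultimately show "Vertex x \<in> hat_Uv w v" unfolding hat_Uv_def by blast
qed

lemma Inner_in_hat_Uv:
  "Inner (a, i, b) t \<in> hat_Uv w v \<longleftrightarrow> (a, i, b) \<in> hat_edges w \<and> 0 < t \<and> t < 1 \<and>
     (a = v \<and> t < 3/8 \<or> b = v \<and> 5/8 < t \<or> a = v \<and> b = v \<and> nv w v < i)"
proof
  assume "Inner (a, i, b) t \<in> hat_Uv w v"
  then show "(a, i, b) \<in> hat_edges w \<and> 0 < t \<and> t < 1 \<and>
     (a = v \<and> t < 3/8 \<or> b = v \<and> 5/8 < t \<or> a = v \<and> b = v \<and> nv w v < i)"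
    by (auto simp: hat_Uv_def split: if_splits)
next
  assume *: "(a, i, b) \<in> hat_edges w \<and> 0 < t \<and> t < 1 \<and>
     (a = v \<and> t < 3/8 \<or> b = v \<and> 5/8 < t \<or> a = v \<and> b = v \<and> nv w v < i)"
  have psi: "Inner (a, i, b) t \<in> psi (a, i, b) ` A" if "t \<in> A" for A
    using that * by (intro image_eqI[of _ _ t]) auto
  consider "a = v" "t < 3/8" | "b = v" "5/8 < t" | "a = v" "b = v" "nv w v < i" using * by blast
  then show "Inner (a, i, b) t \<in> hat_Uv w v"
  proof cases
    case 1
    then have "Inner (a, i, b) t \<in> psi (a, i, b) ` {0..<3/8}" using * by (intro psi) auto
    then show ?thesis using * 1 unfolding hat_Uv_def by blast
  next
    case 2
    then have "Inner (a, i, b) t \<in> psi (a, i, b) ` {5/8<..1}" using * by (intro psi) auto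
    then show ?thesis using * 2 unfolding hat_Uv_def by blast
  next
    case 3
    then have "Inner (a, i, b) t \<in> psi (a, i, b) ` {0..1}" using * by (intro psi) auto
    then show ?thesis using * 3 unfolding hat_Uv_def by blast
  qed
qed

lemma Vertex_in_hat_space: "Vertex v \<in> hat_space w \<longleftrightarrow> v \<in> Gamma_star w"
  by (auto simp: hat_space_def)

lemma Inner_in_hat_space: "Inner e t \<in> hat_space w \<longleftrightarrow> e \<in> hat_edges w \<and> 0 < t \<and> t < 1"
  unfolding hat_space_def by blast

lemma hat_Ue_iff: "p \<in> hat_Ue e \<longleftrightarrow> (\<exists>t. 1/4 < t \<and> t < 3/4 \<and> p = Inner e t)"
proof -
  obtain u i v where "e = (u, i, v)" by (cases e)
  moreover have "psi (u, i, v) t = Inner (u, i, v) t" if "1/4 < t" "t < 3/4" for t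
    using that by auto
  ultimately show ?thesis unfolding hat_Ue_def by (force simp del: psi.simps)
qed

lemma hat_Uv_subset: "v \<in> Gamma_star w \<Longrightarrow> hat_Uv w v \<subseteq> hat_space w"
proof
  fix p assume "v \<in> Gamma_star w" "p \<in> hat_Uv w v"
  then show "p \<in> hat_space w"
    by (cases p) (auto simp: Vertex_in_hat_Uv Vertex_in_hat_space Inner_in_hat_space Inner_in_hat_Uv)
qed

lemma qmap_Inner_nonzero: "Inner e t \<in> hat_space w \<Longrightarrow> qmap (Inner e t) \<noteq> (0, 0)"
  by (cases e) (auto simp: Inner_in_hat_space ell_nonzero dest: hat_edgeD)

lemma inj_on_hat_Uv:
  assumes v: "v \<in> Gamma_star w"
  shows "inj_on qmap (hat_Uv w v)"
proof (rule inj_onI)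
  fix p p' assume p: "p \<in> hat_Uv w v" "p' \<in> hat_Uv w v" and q: "qmap p = qmap p'"
  have ps: "p \<in> hat_space w" "p' \<in> hat_space w" using p hat_Uv_subset[OF v] by auto
  show "p = p'"
  proof (cases p)
    case (Vertex x)
    then have "\<nexists>e t. p' = Inner e t" using q ps qmap_Inner_nonzero by fastforce
    then obtain x' where "p' = Vertex x'" by (cases p') auto
    then show ?thesis using Vertex p Vertex_in_hat_Uv[OF v] by simp
  next
    case (Inner e t)
    then have "\<nexists>x. p' = Vertex x" using q ps qmap_Inner_nonzero by fastforce
    then obtain e' t' where Inner': "p' = Inner e' t'" by (cases p') auto
    obtain a i b a' i' b' where e: "e = (a, i, b)" "e' = (a', i', b')" by (cases e, cases e')
    note m = p[unfolded Inner Inner' e Inner_in_hat_Uv]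
    have i: "1 \<le> i" "1 \<le> i'" using m hat_edgeD by auto
    have "i = i'" "t = t'" using q m i by (auto simp: Inner Inner' e ell_inject)
    moreover have "e = e'"
    proof (cases "a = v \<and> a' = v")
      case True
      then show ?thesis using m hat_edge_from[OF v] \<open>i = i'\<close> e by auto
    next
      \<comment> \<open>If one of the edges does not start at \<open>v\<close>, the common parameter
        exceeds 5/8. It is then not below 3/8, so both edges end at \<open>v\<close>.\<close>
      case False
      then have "b = v" "b' = v" using m \<open>t = t'\<close> by auto
      then show ?thesis using m hat_edge_to[OF v] \<open>i = i'\<close> e by auto
    qed
    ultimately show ?thesis using Inner Inner' by simp
  qed
qed

lemma qmap_image_hat_Uv:
  assumes v: "v \<in> Gamma_star w"
  shows "qmap ` hat_Uv w v = earring_Uinf (nv w v)"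
proof (intro subset_antisym subsetI)
  fix P assume "P \<in> qmap ` hat_Uv w v"
  then obtain p where p: "p \<in> hat_Uv w v" "P = qmap p" by blast
  show "P \<in> earring_Uinf (nv w v)"
  proof (cases p)
    case (Vertex x)
    then show ?thesis using p zero_in_earring_Uinf by simp
  next
    case (Inner e t)
    obtain a i b where "e = (a, i, b)" by (cases e)
    then show ?thesis using p Inner hat_edgeD(3)
      by (auto simp: Inner_in_hat_Uv ell_in_earring_Uinf)
  qed
next
  fix P assume P: "P \<in> earring_Uinf (nv w v)"
  then have "P \<in> earring" using earring_Uinf_subset by blast
  then show "P \<in> qmap ` hat_Uv w v"
  proof (cases rule: earring_cases)
    case 1
    then show ?thesis using Vertex_in_hat_Uv[OF v] by (intro image_eqI[of _ _ "Vertex v"]) auto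
  next
    case (2 i t)
    then consider "t < 3/8" | "5/8 < t" | "nv w v < i"
      using P ell_in_earring_Uinf by blast
    then show ?thesis
    proof cases
      case 1
      then have "Inner (v, i, edge_target v i) t \<in> hat_Uv w v"
        using 2 v by (simp add: Inner_in_hat_Uv hat_edge_from)
      then show ?thesis using 2 by (intro image_eqI[of _ _ "Inner (v, i, edge_target v i) t"]) simp
    next
      case a: 2
      then have "Inner (edge_source v i, i, v) t \<in> hat_Uv w v"
        using 2 v by (simp add: Inner_in_hat_Uv hat_edge_to)
      then show ?thesis using 2 by (intro image_eqI[of _ _ "Inner (edge_source v i, i, v) t"]) simp
    next
      case 3
      then have "Inner (v, i, v) t \<in> hat_Uv w v"
        using 2 v hat_loop[OF v 3] hat_edge_from[OF v, of i v] by (simp add: Inner_in_hat_Uv)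
      then show ?thesis using 2 by (intro image_eqI[of _ _ "Inner (v, i, v) t"]) simp
    qed
  qed
qed

lemma inj_on_hat_Ue: "e \<in> hat_edges w \<Longrightarrow> inj_on qmap (hat_Ue e)"
proof (rule inj_onI)
  fix p p' assume e: "e \<in> hat_edges w" "p \<in> hat_Ue e" "p' \<in> hat_Ue e" "qmap p = qmap p'"
  obtain a i b where "e = (a, i, b)" by (cases e)
  then show "p = p'" using e hat_edgeD(3) ell_inject[of i _ i] by (fastforce simp: hat_Ue_iff)
qed

lemma qmap_image_hat_Ue: "qmap ` hat_Ue (u, i, v) = earring_U i"
  unfolding earring_U_def by (force simp: hat_Ue_iff)

text \<open>The open sets of the topology that \<open>hat_topology\<close> selects by \<open>THE\<close>.\<close>

definition hat_open :: "point set \<Rightarrow> bool" where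
  "hat_open S \<longleftrightarrow> S \<subseteq> hat_space w \<and>
     (\<forall>e\<in>hat_edges w. open {t. 0 < t \<and> t < 1 \<and> Inner e t \<in> S}) \<and>
     (\<forall>v. Vertex v \<in> S \<longrightarrow> (\<exists>d>0. \<forall>p\<in>hat_Uv w v. norm (qmap p) < d \<longrightarrow> p \<in> S))"

lemma istopology_hat_open: "istopology hat_open"
  unfolding istopology_def
proof (intro conjI allI impI)
  fix S T assume S: "hat_open S" and T: "hat_open T"
  show "hat_open (S \<inter> T)"
    unfolding hat_open_def
  proof (intro conjI ballI allI impI)
    show "S \<inter> T \<subseteq> hat_space w" using S by (auto simp: hat_open_def)
    fix e assume "e \<in> hat_edges w"
    then have "open ({t. 0 < t \<and> t < 1 \<and> Inner e t \<in> S} \<inter> {t. 0 < t \<and> t < 1 \<and> Inner e t \<in> T})"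
      using S T by (intro open_Int) (auto simp: hat_open_def)
    moreover have "{t. 0 < t \<and> t < 1 \<and> Inner e t \<in> S \<inter> T} =
      {t. 0 < t \<and> t < 1 \<and> Inner e t \<in> S} \<inter> {t. 0 < t \<and> t < 1 \<and> Inner e t \<in> T}" by auto
    ultimately show "open {t. 0 < t \<and> t < 1 \<and> Inner e t \<in> S \<inter> T}" by simp
  next
    fix v assume "Vertex v \<in> S \<inter> T"
    then obtain d d' where "d > 0" "\<forall>p\<in>hat_Uv w v. norm (qmap p) < d \<longrightarrow> p \<in> S"
      "d' > 0" "\<forall>p\<in>hat_Uv w v. norm (qmap p) < d' \<longrightarrow> p \<in> T"
      using S T unfolding hat_open_def by blast
    then show "\<exists>d>0. \<forall>p\<in>hat_Uv w v. norm (qmap p) < d \<longrightarrow> p \<in> S \<inter> T"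
      by (intro exI[of _ "min d d'"]) auto
  qed
next
  fix \<K> assume K: "\<forall>S\<in>\<K>. hat_open S"
  show "hat_open (\<Union>\<K>)"
    unfolding hat_open_def
  proof (intro conjI ballI allI impI)
    show "\<Union>\<K> \<subseteq> hat_space w" using K unfolding hat_open_def by blast
    fix e assume "e \<in> hat_edges w"
    then have "open (\<Union>S\<in>\<K>. {t. 0 < t \<and> t < 1 \<and> Inner e t \<in> S})"
      using K by (intro open_UN) (auto simp: hat_open_def)
    moreover have "{t. 0 < t \<and> t < 1 \<and> Inner e t \<in> \<Union>\<K>} = (\<Union>S\<in>\<K>. {t. 0 < t \<and> t < 1 \<and> Inner e t \<in> S})"
      by auto
    ultimately show "open {t. 0 < t \<and> t < 1 \<and> Inner e t \<in> \<Union>\<K>}" by simp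
  next
    fix v assume "Vertex v \<in> \<Union>\<K>"
    then show "\<exists>d>0. \<forall>p\<in>hat_Uv w v. norm (qmap p) < d \<longrightarrow> p \<in> \<Union>\<K>"
      using K unfolding hat_open_def by (metis Union_iff)
  qed
qed

definition hat_top :: "point topology" where
  "hat_top = topology hat_open"

lemma openin_hat_top: "openin hat_top S \<longleftrightarrow> hat_open S"
  by (simp add: hat_top_def istopology_hat_open)

lemma hat_openI:
  assumes "S \<subseteq> hat_space w" "\<And>e. e \<in> hat_edges w \<Longrightarrow> open {t. 0 < t \<and> t < 1 \<and> Inner e t \<in> S}"
    "\<And>v. Vertex v \<in> S \<Longrightarrow> \<exists>d>0. \<forall>p\<in>hat_Uv w v. norm (qmap p) < d \<longrightarrow> p \<in> S"
  shows "openin hat_top S"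
  using assms by (simp add: openin_hat_top hat_open_def)

lemma openin_hat_top_edge:
  assumes "e \<in> hat_edges w" "open A" "A \<subseteq> {0<..<1}"
  shows "openin hat_top (Inner e ` A)"
proof (rule hat_openI)
  show "Inner e ` A \<subseteq> hat_space w" using assms by (auto simp: Inner_in_hat_space)
  fix e' :: edge
  have "{t. 0 < t \<and> t < 1 \<and> Inner e' t \<in> Inner e ` A} = (if e' = e then A else {})"
    using assms(3) by auto
  then show "open {t. 0 < t \<and> t < 1 \<and> Inner e' t \<in> Inner e ` A}" using assms(2) by simp
qed auto

lemma openin_hat_top_Ue: "e \<in> hat_edges w \<Longrightarrow> openin hat_top (hat_Ue e)"
proof -
  assume "e \<in> hat_edges w"
  then have "openin hat_top (Inner e ` {1/4<..<3/4})" by (rule openin_hat_top_edge) auto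
  moreover have "hat_Ue e = Inner e ` {1/4<..<3/4}" by (auto simp: hat_Ue_iff)
  ultimately show ?thesis by simp
qed

lemma openin_hat_top_Uv:
  assumes v: "v \<in> Gamma_star w"
  shows "openin hat_top (hat_Uv w v)"
proof (rule hat_openI)
  show "hat_Uv w v \<subseteq> hat_space w" using v by (rule hat_Uv_subset)
  fix e assume e: "e \<in> hat_edges w"
  obtain a i b where abi: "e = (a, i, b)" by (cases e)
  have "{t. 0 < t \<and> t < 1 \<and> Inner e t \<in> hat_Uv w v} = {0<..<1} \<inter>
     ((if a = v then {..<3/8} else {}) \<union> (if b = v then {5/8<..} else {}) \<union>
      (if a = v \<and> b = v \<and> nv w v < i then UNIV else {}))"
    using e by (auto simp: abi Inner_in_hat_Uv)
  also have "open \<dots>" by (intro open_Int open_Un) auto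
  finally show "open {t. 0 < t \<and> t < 1 \<and> Inner e t \<in> hat_Uv w v}" .
next
  fix x assume "Vertex x \<in> hat_Uv w v"
  then show "\<exists>d>0. \<forall>p\<in>hat_Uv w x. norm (qmap p) < d \<longrightarrow> p \<in> hat_Uv w v"
    using Vertex_in_hat_Uv[OF v] by (intro exI[of _ 1]) auto
qed

lemma topspace_hat_top: "topspace hat_top = hat_space w"
proof -
  have "openin hat_top (hat_space w)"
  proof (rule hat_openI)
    fix e assume "e \<in> hat_edges w"
    then have "{t. 0 < t \<and> t < 1 \<and> Inner e t \<in> hat_space w} = {0<..<1}"
      by (auto simp: Inner_in_hat_space)
    then show "open {t. 0 < t \<and> t < 1 \<and> Inner e t \<in> hat_space w}" by simp
  next
    fix v assume "Vertex v \<in> hat_space w"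
    then show "\<exists>d>0. \<forall>p\<in>hat_Uv w v. norm (qmap p) < d \<longrightarrow> p \<in> hat_space w"
      using hat_Uv_subset by (intro exI[of _ 1]) (auto simp: Vertex_in_hat_space)
  qed simp
  then show ?thesis
    by (metis hat_open_def openin_hat_top openin_subset openin_topspace subset_antisym)
qed

section \<open>Continuity and openness of the map to the earring\<close>

lemma qmap_in_earring: "p \<in> hat_space w \<Longrightarrow> qmap p \<in> earring"
  by (auto simp: hat_space_def zero_in_earring ell_in_earring dest: hat_edgeD)

lemma continuous_map_qmap: "continuous_map hat_top (top_of_set earring) qmap"
  unfolding continuous_map_def
proof (intro conjI allI impI)
  show "qmap \<in> topspace hat_top \<rightarrow> topspace (top_of_set earring)"
    using qmap_in_earring by (auto simp: topspace_hat_top)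
  fix U assume "openin (top_of_set earring) U"
  then obtain O' where O': "open O'" "U = earring \<inter> O'" by (auto simp: openin_open)
  have "openin hat_top {p \<in> hat_space w. qmap p \<in> O'}"
  proof (rule hat_openI)
    fix e assume e: "e \<in> hat_edges w"
    obtain a i b where abi: "e = (a, i, b)" by (cases e)
    have "open ({0<..<1} \<inter> ell i -` O')"
      using O'(1) continuous_on_ell by (intro continuous_open_preimage) auto
    moreover have "{t. 0 < t \<and> t < 1 \<and> Inner e t \<in> {p \<in> hat_space w. qmap p \<in> O'}} = {0<..<1} \<inter> ell i -` O'"
      using e by (auto simp: abi Inner_in_hat_space)
    ultimately show "open {t. 0 < t \<and> t < 1 \<and> Inner e t \<in> {p \<in> hat_space w. qmap p \<in> O'}}" by simp
  next
    fix v assume v: "Vertex v \<in> {p \<in> hat_space w. qmap p \<in> O'}"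
    then have "0 \<in> O'" by (simp add: zero_prod_def)
    then obtain d where "d > 0" "ball 0 d \<subseteq> O'" using O'(1) openE by blast
    then show "\<exists>d>0. \<forall>p\<in>hat_Uv w v. norm (qmap p) < d \<longrightarrow> p \<in> {p \<in> hat_space w. qmap p \<in> O'}"
      using v hat_Uv_subset by (intro exI[of _ d]) (auto simp: Vertex_in_hat_space)
  qed auto
  moreover have "{p \<in> topspace hat_top. qmap p \<in> U} = {p \<in> hat_space w. qmap p \<in> O'}"
    using qmap_in_earring by (auto simp: topspace_hat_top O'(2))
  ultimately show "openin hat_top {p \<in> topspace hat_top. qmap p \<in> U}" by simp
qed

text \<open>At a vertex the metric clause of \<open>hat_open\<close> is exactly what is required:
  \<open>qmap\<close> maps \<open>hat_Uv\<close> onto an open set, and the part of that set in a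
  small ball is in the image. Inside an edge the reason is \<open>openin_ell_image\<close>.\<close>

lemma open_map_qmap: "open_map hat_top (top_of_set earring) qmap"
  unfolding open_map_def
proof (intro allI impI)
  fix S assume "openin hat_top S"
  then have S: "hat_open S" by (simp add: openin_hat_top)
  show "openin (top_of_set earring) (qmap ` S)"
  proof (subst openin_subopen, intro ballI)
    fix P assume "P \<in> qmap ` S"
    then obtain p where p: "p \<in> S" "P = qmap p" by blast
    then have ps: "p \<in> hat_space w" using S by (auto simp: hat_open_def)
    show "\<exists>T. openin (top_of_set earring) T \<and> P \<in> T \<and> T \<subseteq> qmap ` S"
    proof (cases p)
      case (Vertex v)
      then have v: "v \<in> Gamma_star w" using ps by (simp add: Vertex_in_hat_space)
      obtain d where d: "d > 0" "\<forall>p\<in>hat_Uv w v. norm (qmap p) < d \<longrightarrow> p \<in> S"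
        using S p(1) Vertex by (auto simp: hat_open_def)
      have "openin (top_of_set earring) (earring_Uinf (nv w v) \<inter> ball 0 d)"
        by (intro openin_Int_open openin_earring_Uinf) auto
      moreover have "earring_Uinf (nv w v) \<inter> ball 0 d \<subseteq> qmap ` S"
        using d(2) qmap_image_hat_Uv[OF v] by force
      moreover have "P \<in> earring_Uinf (nv w v) \<inter> ball 0 d"
        using p(2) Vertex d(1) zero_in_earring_Uinf by (simp add: zero_prod_def)
      ultimately show ?thesis by blast
    next
      case (Inner e t)
      obtain a i b where abi: "e = (a, i, b)" by (cases e)
      have e: "e \<in> hat_edges w" "0 < t" "t < 1" using ps Inner by (auto simp: Inner_in_hat_space)
      let ?A = "{t. 0 < t \<and> t < 1 \<and> Inner e t \<in> S}"
      have "open ?A" using S e(1) by (simp add: hat_open_def)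
      then have "openin (top_of_set earring) (ell i ` ?A)"
        using hat_edgeD(3) e(1) abi by (intro openin_ell_image) auto
      moreover have "ell i ` ?A \<subseteq> qmap ` S" by (force simp: abi)
      moreover have "P \<in> ell i ` ?A" using p Inner e abi by auto
      ultimately show ?thesis by blast
    qed
  qed
qed

text \<open>The condition under the definite description in \<open>hat_topology\<close>, named so
  that existence and uniqueness can be shown separately.\<close>

definition is_hat_topology :: "point topology \<Rightarrow> bool" where
  "is_hat_topology T \<longleftrightarrow> topspace T = hat_space w \<and>
     (\<forall>(u, i, v)\<in>hat_edges w. openin T (hat_Ue (u, i, v)) \<and>
        homeomorphic_map (subtopology T (hat_Ue (u, i, v))) (top_of_set (earring_U i)) qmap) \<and>
     (\<forall>v\<in>Gamma_star w. openin T (hat_Uv w v) \<and>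
        homeomorphic_map (subtopology T (hat_Uv w v)) (top_of_set (earring_Uinf (nv w v))) qmap)"

text \<open>A continuous open map restricts to a homeomorphism from any open set on which it is
  injective onto the image. So only the injectivity and the images of the charts have to be
  supplied.\<close>

lemma is_hat_topology_hat_top: "is_hat_topology hat_top"
proof -
  have sub: "subtopology (top_of_set earring) (qmap ` W) = top_of_set (qmap ` W)"
    if "W \<subseteq> hat_space w" for W
    using that qmap_in_earring by (simp add: subtopology_subtopology image_subset_iff subset_eq Int_absorb1)
  have W: "homeomorphic_map (subtopology hat_top W) (top_of_set (qmap ` W)) qmap"
    if "openin hat_top W" "inj_on qmap W" for W
    using homeomorphic_map_open_restriction[OF continuous_map_qmap open_map_qmap that]
      sub[of W] openin_subset[OF that(1)] by (simp add: topspace_hat_top)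
  show ?thesis
    unfolding is_hat_topology_def
  proof (intro conjI ballI, simp_all add: topspace_hat_top openin_hat_top_Uv, safe)
    fix u i v assume e: "(u, i, v) \<in> hat_edges w"
    show "openin hat_top (hat_Ue (u, i, v))" using e by (rule openin_hat_top_Ue)
    then show "homeomorphic_map (subtopology hat_top (hat_Ue (u, i, v))) (top_of_set (earring_U i)) qmap"
      using W inj_on_hat_Ue[OF e] qmap_image_hat_Ue by metis
  next
    fix v assume v: "v \<in> Gamma_star w"
    then show "homeomorphic_map (subtopology hat_top (hat_Uv w v)) (top_of_set (earring_Uinf (nv w v))) qmap"
      using W[OF openin_hat_top_Uv inj_on_hat_Uv] qmap_image_hat_Uv by metis
  qed
qed

lemma hat_space_cover:
  assumes "p \<in> hat_space w"
  shows "(\<exists>e\<in>hat_edges w. p \<in> hat_Ue e) \<or> (\<exists>v\<in>Gamma_star w. p \<in> hat_Uv w v)"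
proof (cases p)
  case (Vertex v)
  then show ?thesis using assms Vertex_in_hat_Uv by (auto simp: Vertex_in_hat_space)
next
  case (Inner e t)
  obtain a i b where abi: "e = (a, i, b)" by (cases e)
  have e: "(a, i, b) \<in> hat_edges w" "0 < t" "t < 1" using assms Inner abi by (auto simp: Inner_in_hat_space)
  consider "t < 3/8" | "5/8 < t" | "1/4 < t" "t < 3/4" by linarith
  then show ?thesis
  proof cases
    case 1
    then have "p \<in> hat_Uv w a" using e by (simp add: Inner abi Inner_in_hat_Uv)
    then show ?thesis using hat_edgeD(1)[OF e(1)] by blast
  next
    case 2
    then have "p \<in> hat_Uv w b" using e by (simp add: Inner abi Inner_in_hat_Uv)
    then show ?thesis using hat_edgeD(2)[OF e(1)] by blast
  next
    case 3
    then have "p \<in> hat_Ue (a, i, b)" by (auto simp: Inner abi hat_Ue_iff)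
    then show ?thesis using e(1) by blast
  qed
qed

text \<open>The charts are open and cover the space, so a set is open if its traces on them are, and
  these can be tested in the earring. The criterion does not mention \<open>T\<close>, whence
  uniqueness.\<close>

lemma is_hat_topology_openin:
  assumes T: "is_hat_topology T"
  shows "openin T S \<longleftrightarrow> S \<subseteq> hat_space w \<and>
    (\<forall>(u, i, v)\<in>hat_edges w. openin (top_of_set (earring_U i)) (qmap ` (hat_Ue (u, i, v) \<inter> S))) \<and>
    (\<forall>v\<in>Gamma_star w. openin (top_of_set (earring_Uinf (nv w v))) (qmap ` (hat_Uv w v \<inter> S)))"
proof -
  have chart: "openin Y (qmap ` (W \<inter> S)) \<longleftrightarrow> openin T (W \<inter> S)"
    if W: "openin T W" "homeomorphic_map (subtopology T W) Y qmap" for W and Y :: "(real \<times> real) topology"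
  proof -
    have "W \<inter> S \<subseteq> topspace (subtopology T W)" using openin_subset[OF W(1)] by auto
    then have "openin Y (qmap ` (W \<inter> S)) \<longleftrightarrow> openin (subtopology T W) (W \<inter> S)"
      by (rule homeomorphic_map_openness[OF W(2)])
    then show ?thesis using W(1) by (simp add: openin_open_subtopology)
  qed
  have e: "openin (top_of_set (earring_U i)) (qmap ` (hat_Ue (u, i, v) \<inter> S)) \<longleftrightarrow>
      openin T (hat_Ue (u, i, v) \<inter> S)" if "(u, i, v) \<in> hat_edges w" for u i v
    using T that unfolding is_hat_topology_def by (intro chart) blast+
  have v: "openin (top_of_set (earring_Uinf (nv w v))) (qmap ` (hat_Uv w v \<inter> S)) \<longleftrightarrow>
      openin T (hat_Uv w v \<inter> S)" if "v \<in> Gamma_star w" for v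
    using T that unfolding is_hat_topology_def by (intro chart) blast+
  have "openin T S \<longleftrightarrow> S \<subseteq> hat_space w \<and> (\<forall>e\<in>hat_edges w. openin T (hat_Ue e \<inter> S)) \<and>
      (\<forall>v\<in>Gamma_star w. openin T (hat_Uv w v \<inter> S))"
  proof
    assume S: "openin T S"
    have "S \<subseteq> hat_space w" using openin_subset[OF S] T by (simp add: is_hat_topology_def)
    moreover have "\<forall>e\<in>hat_edges w. openin T (hat_Ue e)" "\<forall>v\<in>Gamma_star w. openin T (hat_Uv w v)"
      using T unfolding is_hat_topology_def by auto
    ultimately show "S \<subseteq> hat_space w \<and> (\<forall>e\<in>hat_edges w. openin T (hat_Ue e \<inter> S)) \<and>
      (\<forall>v\<in>Gamma_star w. openin T (hat_Uv w v \<inter> S))"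
      using S by (auto intro: openin_Int)
  next
    assume *: "S \<subseteq> hat_space w \<and> (\<forall>e\<in>hat_edges w. openin T (hat_Ue e \<inter> S)) \<and>
      (\<forall>v\<in>Gamma_star w. openin T (hat_Uv w v \<inter> S))"
    show "openin T S"
    proof (subst openin_subopen, intro ballI)
      fix p assume "p \<in> S"
      then show "\<exists>V. openin T V \<and> p \<in> V \<and> V \<subseteq> S"
        using * hat_space_cover[of p] by (meson IntI Int_lower2 subsetD)
    qed
  qed
  then show ?thesis using e v by (auto split: prod.splits)
qed

lemma hat_topology_eq: "hat_topology w = hat_top"
proof -
  have "T = hat_top" if "is_hat_topology T" for T
    unfolding topology_eq is_hat_topology_openin[OF that]
      is_hat_topology_openin[OF is_hat_topology_hat_top] by simp
  then have "(THE T. is_hat_topology T) = hat_top"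
    using is_hat_topology_hat_top by (intro the_equality)
  then show ?thesis by (simp add: hat_topology_def is_hat_topology_def)
qed

end

section \<open>Lifting paths through local homeomorphisms\<close>

definition lift_on ::
    "'a topology \<Rightarrow> ('a \<Rightarrow> 'b) \<Rightarrow> (real \<Rightarrow> 'b) \<Rightarrow> real \<Rightarrow> real \<Rightarrow> (real \<Rightarrow> 'a) \<Rightarrow> bool" where
  "lift_on X q \<alpha> a b \<delta> \<longleftrightarrow> continuous_map (top_of_set {a..b}) X \<delta> \<and> (\<forall>t\<in>{a..b}. q (\<delta> t) = \<alpha> t)"

lemma lift_on_cong:
  assumes "lift_on X q \<alpha> a b \<delta>" "\<And>t. t \<in> {a..b} \<Longrightarrow> \<alpha> t = \<beta> t" "\<And>t. t \<in> {a..b} \<Longrightarrow> \<delta> t = \<epsilon> t"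
  shows "lift_on X q \<beta> a b \<epsilon>"
  using assms continuous_map_eq[of "top_of_set {a..b}" X \<delta> \<epsilon>] by (auto simp: lift_on_def)

lemma lift_on_glue:
  assumes 1: "lift_on X q \<alpha> a b \<delta>" and 2: "lift_on X q \<alpha> b c \<epsilon>" and eq: "\<delta> b = \<epsilon> b"
  shows "lift_on X q \<alpha> a c (\<lambda>t. if t \<le> b then \<delta> t else \<epsilon> t)"
proof -
  have "continuous_map (top_of_set {a..c}) X (\<lambda>t. if id t \<le> b then \<delta> t else \<epsilon> t)"
  proof (rule continuous_map_cases_le)
    show "continuous_map (subtopology (top_of_set {a..c}) {x \<in> topspace (top_of_set {a..c}). id x \<le> b}) X \<delta>"
      using 1 by (auto simp: lift_on_def subtopology_subtopology intro: continuous_map_from_subtopology_mono)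
    show "continuous_map (subtopology (top_of_set {a..c}) {x \<in> topspace (top_of_set {a..c}). b \<le> id x}) X \<epsilon>"
      using 2 by (auto simp: lift_on_def subtopology_subtopology intro: continuous_map_from_subtopology_mono)
  qed (use eq in \<open>auto simp: id_def\<close>)
  then show ?thesis using 1 2 by (auto simp: lift_on_def)
qed

lemma lift_on_compose:
  assumes "lift_on X q \<alpha> a b \<delta>" "continuous_on {c..d} f" "f ` {c..d} \<subseteq> {a..b}"
  shows "lift_on X q (\<alpha> \<circ> f) c d (\<delta> \<circ> f)"
proof -
  have "continuous_map (top_of_set {c..d}) (top_of_set {a..b}) f"
    using assms(2,3) by auto
  then have "continuous_map (top_of_set {c..d}) X (\<delta> \<circ> f)"
    using assms(1) continuous_map_compose unfolding lift_on_def by blast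
  then show ?thesis using assms(1,3) by (auto simp: lift_on_def)
qed

lemma lift_on_sheet:
  assumes "open_map X Y q" "openin X W" "inj_on q W"
    and "continuous_map (top_of_set {a..b}) Y \<alpha>" "\<alpha> ` {a..b} \<subseteq> q ` W"
  shows "lift_on X q \<alpha> a b (inv_into W q \<circ> \<alpha>)"
proof -
  have "continuous_map (top_of_set {a..b}) (subtopology Y (q ` W)) \<alpha>"
    using assms(4,5) by (auto simp: continuous_map_in_subtopology)
  then have "continuous_map (top_of_set {a..b}) X (inv_into W q \<circ> \<alpha>)"
    using continuous_map_inv_into_open[OF assms(1-3)] by (rule continuous_map_compose)
  then show ?thesis using assms(5) by (auto simp: lift_on_def f_inv_into_f)
qed

lemma path_nhd:
  assumes "continuous_map (top_of_set {a..b}) Y \<alpha>" "x \<in> {a..b::real}" "openin Y U" "\<alpha> x \<in> U"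
  obtains d where "d > 0" "\<And>t. t \<in> {a..b} \<Longrightarrow> \<bar>t - x\<bar> < d \<Longrightarrow> \<alpha> t \<in> U"
proof -
  have "openin (top_of_set {a..b}) {t \<in> topspace (top_of_set {a..b}). \<alpha> t \<in> U}"
    using assms(1,3) by (rule openin_continuous_map_preimage)
  then obtain d where "d > 0" "ball x d \<inter> {a..b} \<subseteq> {t \<in> {a..b}. \<alpha> t \<in> U}"
    using assms(2,4) by (auto simp: openin_contains_ball)
  then show ?thesis using that[of d] by (force simp: dist_real_def abs_minus_commute)
qed

text \<open>No neighbourhood of the base point of the earring is evenly covered, since the radius of the sheets
  depends on \<open>j\<close>. Within a suitable piece \<open>D\<close> of the preimage of a fixed neighbourhood \<open>U\<close> it is bounded below.\<close>

definition covers_within :: "'a topology \<Rightarrow> 'b topology \<Rightarrow> ('a \<Rightarrow> 'b) \<Rightarrow> 'a set \<Rightarrow> 'b set \<Rightarrow> bool" where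
  "covers_within X Y q D U \<longleftrightarrow> (\<forall>c\<in>U. \<exists>V. openin Y V \<and> c \<in> V \<and>
     (\<forall>e\<in>D. q e \<in> V \<longrightarrow> (\<exists>W\<subseteq>D. openin X W \<and> e \<in> W \<and> inj_on q W \<and> V \<subseteq> q ` W)))"

text \<open>Bolzano bisection. The pieces are required to end in \<open>D\<close> again, because
  only from points of \<open>D\<close> does the next sheet have a size that is independent of the
  point.\<close>

lemma path_lift_within:
  assumes q: "open_map X Y q" and \<alpha>: "continuous_map (top_of_set {a..b}) Y \<alpha>" and "a \<le> b"
    and U: "\<alpha> ` {a..b} \<subseteq> U" and cover: "covers_within X Y q D U"
    and e: "e \<in> D" "q e = \<alpha> a"
  shows "\<exists>\<delta>. lift_on X q \<alpha> a b \<delta> \<and> \<delta> a = e"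
proof -
  define P where "P c d \<longleftrightarrow> (a \<le> c \<longrightarrow> c \<le> d \<longrightarrow> d \<le> b \<longrightarrow>
     (\<forall>e\<in>D. q e = \<alpha> c \<longrightarrow> (\<exists>\<delta>. lift_on X q \<alpha> c d \<delta> \<and> \<delta> c = e \<and> \<delta> d \<in> D)))" for c d
  have "P a b"
    using \<open>a \<le> b\<close>
  proof (induction rule: Bolzano)
    case (trans c d e)
    show ?case
      unfolding P_def
    proof (intro impI ballI)
      fix p assume p: "a \<le> c" "c \<le> e" "e \<le> b" "p \<in> D" "q p = \<alpha> c"
      then obtain \<delta> where \<delta>: "lift_on X q \<alpha> c d \<delta>" "\<delta> c = p" "\<delta> d \<in> D"
        using trans unfolding P_def by fastforce
      have "q (\<delta> d) = \<alpha> d" using \<delta>(1) trans(3) by (simp add: lift_on_def)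
      then obtain \<epsilon> where \<epsilon>: "lift_on X q \<alpha> d e \<epsilon>" "\<epsilon> d = \<delta> d" "\<epsilon> e \<in> D"
        using trans p \<delta>(3) unfolding P_def by (meson order_trans)
      show "\<exists>\<delta>. lift_on X q \<alpha> c e \<delta> \<and> \<delta> c = p \<and> \<delta> e \<in> D"
        using lift_on_glue[OF \<delta>(1) \<epsilon>(1)] \<delta> \<epsilon> trans(3,4)
        by (intro exI[of _ "\<lambda>t. if t \<le> d then \<delta> t else \<epsilon> t"]) auto
    qed
  next
    case (local x)
    then have "\<alpha> x \<in> U" using U by auto
    then obtain V where V: "openin Y V" "\<alpha> x \<in> V"
      and sheet: "\<And>e. e \<in> D \<Longrightarrow> q e \<in> V \<Longrightarrow> \<exists>W\<subseteq>D. openin X W \<and> e \<in> W \<and> inj_on q W \<and> V \<subseteq> q ` W"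
      using cover unfolding covers_within_def by meson
    obtain r where r: "r > 0" "\<And>t. t \<in> {a..b} \<Longrightarrow> \<bar>t - x\<bar> < r \<Longrightarrow> \<alpha> t \<in> V"
      using path_nhd[OF \<alpha> _ V] local by auto
    have "P c d" if cd: "c \<le> x" "x \<le> d" "d - c < r" for c d
      unfolding P_def
    proof (intro impI ballI)
      fix p assume p: "a \<le> c" "c \<le> d" "d \<le> b" "p \<in> D" "q p = \<alpha> c"
      have \<alpha>V: "\<alpha> ` {c..d} \<subseteq> V" using r(2) p cd by auto
      then have "q p \<in> V" using p by auto
      then obtain W where W: "W \<subseteq> D" "openin X W" "p \<in> W" "inj_on q W" "V \<subseteq> q ` W"
        using sheet[OF p(4)] by metis
      have "continuous_map (top_of_set {c..d}) Y \<alpha>"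
        by (rule continuous_map_from_subtopology_mono[OF \<alpha>]) (use p in auto)
      then have "lift_on X q \<alpha> c d (inv_into W q \<circ> \<alpha>)"
        using lift_on_sheet[OF q W(2,4)] \<alpha>V W(5) by blast
      moreover have "inv_into W q (\<alpha> c) = p" using W p by (simp add: inv_into_f_f flip: p(5))
      moreover have "inv_into W q (\<alpha> d) \<in> D"
        using \<alpha>V W p(2) inv_into_into[of "\<alpha> d" q W] by (auto simp: subset_eq)
      ultimately show "\<exists>\<delta>. lift_on X q \<alpha> c d \<delta> \<and> \<delta> c = p \<and> \<delta> d \<in> D"
        by (intro exI[of _ "inv_into W q \<circ> \<alpha>"]) auto
    qed
    then show ?case using r(1) by blast
  qed
  then show ?thesis using e \<open>a \<le> b\<close> unfolding P_def by blast
qed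

text \<open>A second bisection around \<open>path_lift_within\<close>. The length of the pieces is
  determined by \<open>U\<close> alone; \<open>D\<close> is chosen only afterwards, when the
  starting point of the lift over the piece is known. Hence \<open>D\<close> may vary along the
  fibre while \<open>U\<close> may not.\<close>

lemma path_lift:
  assumes q: "open_map X Y q" and \<alpha>: "continuous_map (top_of_set {0..1}) Y \<alpha>"
    and cover: "\<And>y. y \<in> topspace Y \<Longrightarrow> \<exists>U. openin Y U \<and> y \<in> U \<and>
      (\<forall>e\<in>topspace X. q e \<in> U \<longrightarrow> (\<exists>D. e \<in> D \<and> covers_within X Y q D U))"
    and e: "e \<in> topspace X" "q e = \<alpha> 0"
  shows "\<exists>\<delta>. lift_on X q \<alpha> 0 1 \<delta> \<and> \<delta> 0 = e"
proof -
  define P where "P c d \<longleftrightarrow> (0 \<le> c \<longrightarrow> c \<le> d \<longrightarrow> d \<le> 1 \<longrightarrow>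
     (\<forall>e\<in>topspace X. q e = \<alpha> c \<longrightarrow> (\<exists>\<delta>. lift_on X q \<alpha> c d \<delta> \<and> \<delta> c = e)))" for c d
  have "P 0 1"
    using zero_le_one
  proof (induction rule: Bolzano)
    case (trans c d e)
    show ?case
      unfolding P_def
    proof (intro impI ballI)
      fix p assume p: "0 \<le> c" "c \<le> e" "e \<le> 1" "p \<in> topspace X" "q p = \<alpha> c"
      then obtain \<delta> where \<delta>: "lift_on X q \<alpha> c d \<delta>" "\<delta> c = p"
        using trans unfolding P_def by fastforce
      have "q (\<delta> d) = \<alpha> d" "\<delta> d \<in> topspace X"
        using \<delta>(1) trans(3) by (auto simp: lift_on_def continuous_map_def Pi_iff)
      then obtain \<epsilon> where \<epsilon>: "lift_on X q \<alpha> d e \<epsilon>" "\<epsilon> d = \<delta> d"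
        using trans p unfolding P_def by (meson order_trans)
      show "\<exists>\<delta>. lift_on X q \<alpha> c e \<delta> \<and> \<delta> c = p"
        using lift_on_glue[OF \<delta>(1) \<epsilon>(1)] \<delta> \<epsilon> trans(3,4)
        by (intro exI[of _ "\<lambda>t. if t \<le> d then \<delta> t else \<epsilon> t"]) auto
    qed
  next
    case (local x)
    then have "\<alpha> x \<in> topspace Y" using \<alpha> by (auto simp: continuous_map_def Pi_iff)
    then obtain U where U: "openin Y U" "\<alpha> x \<in> U"
      and D: "\<And>e. e \<in> topspace X \<Longrightarrow> q e \<in> U \<Longrightarrow> \<exists>D. e \<in> D \<and> covers_within X Y q D U"
      using cover by meson
    obtain r where r: "r > 0" "\<And>t. t \<in> {0..1} \<Longrightarrow> \<bar>t - x\<bar> < r \<Longrightarrow> \<alpha> t \<in> U"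
      using path_nhd[OF \<alpha> _ U] local by auto
    have "P c d" if cd: "c \<le> x" "x \<le> d" "d - c < r" for c d
      unfolding P_def
    proof (intro impI ballI)
      fix p assume p: "0 \<le> c" "c \<le> d" "d \<le> 1" "p \<in> topspace X" "q p = \<alpha> c"
      have \<alpha>U: "\<alpha> ` {c..d} \<subseteq> U" using r(2) p cd by auto
      then have "q p \<in> U" using p by auto
      then obtain D where D: "p \<in> D" "covers_within X Y q D U" using D[OF p(4)] by blast
      have "continuous_map (top_of_set {c..d}) Y \<alpha>"
        by (rule continuous_map_from_subtopology_mono[OF \<alpha>]) (use p in auto)
      then show "\<exists>\<delta>. lift_on X q \<alpha> c d \<delta> \<and> \<delta> c = p"
        using path_lift_within[OF q _ p(2) \<alpha>U D(2,1) p(5)] by blast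
    qed
    then show ?case using r(1) by blast
  qed
  then show ?thesis using e unfolding P_def by auto
qed

section \<open>Loops that lift with prescribed end points\<close>

lemma loops_continuous: "\<alpha> \<in> loops X x \<Longrightarrow> continuous_map (top_of_set {0..1}) X \<alpha>"
  by (simp add: loops_iff pathin_def)

lemma openin_loop_space_subbasic:
  assumes "compactin (top_of_set {0..1}) C" "openin X U"
  shows "openin (loop_space X x) {\<alpha> \<in> loops X x. \<alpha> ` C \<subseteq> U}"
proof -
  let ?S = "{f \<in> extensional (topspace (top_of_set {0..1})). continuous_map (top_of_set {0..1}) X f \<and> f ` C \<subseteq> U}"
  have "openin (compact_open_topology (top_of_set {0..1}) X) ?S"
    unfolding compact_open_topology_def using assms by (intro topology_generated_by_Basis) blast
  moreover have "{\<alpha> \<in> loops X x. \<alpha> ` C \<subseteq> U} = ?S \<inter> {\<alpha>. \<alpha> 0 = x \<and> \<alpha> 1 = x}"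
    by (auto simp: loops_iff pathin_def)
  ultimately show ?thesis unfolding loop_space_def openin_subtopology by blast
qed

text \<open>The end points are kept apart because openness is argued around a loop whose lift is not
  known to be closed.\<close>

definition liftable_loops ::
    "'a topology \<Rightarrow> ('a \<Rightarrow> 'b) \<Rightarrow> 'b topology \<Rightarrow> 'b \<Rightarrow> 'a \<Rightarrow> 'a \<Rightarrow> (real \<Rightarrow> 'b) set" where
  "liftable_loops X q Y y e0 e1 =
     {\<beta> \<in> loops Y y. \<exists>\<delta>. lift_on X q \<beta> 0 1 \<delta> \<and> \<delta> 0 = e0 \<and> \<delta> 1 = e1}"

text \<open>Bolzano bisection for a stability statement that runs backwards: given a neighbourhood
  \<open>V\<close> of the end of a piece of \<open>\<gamma>\<close>, there are neighbourhoods of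
  \<open>\<alpha>\<close> and of the start such that lifts of nearby loops starting in the latter
  can be chosen to end in \<open>V\<close>. In this form adjacent pieces chain.\<close>

lemma openin_liftable_loops:
  assumes q: "open_map X Y q"
    and loc: "\<And>e. e \<in> topspace X \<Longrightarrow> \<exists>W. openin X W \<and> e \<in> W \<and> inj_on q W"
  shows "openin (loop_space Y y) (liftable_loops X q Y y e0 e1)"
proof (subst openin_subopen, intro ballI)
  fix \<alpha> assume "\<alpha> \<in> liftable_loops X q Y y e0 e1"
  then obtain \<gamma> where \<alpha>: "\<alpha> \<in> loops Y y" and \<gamma>: "lift_on X q \<alpha> 0 1 \<gamma>" "\<gamma> 0 = e0" "\<gamma> 1 = e1"
    by (auto simp: liftable_loops_def)
  have \<gamma>c: "continuous_map (top_of_set {0..1}) X \<gamma>" and q\<gamma>: "\<And>t. t \<in> {0..1} \<Longrightarrow> q (\<gamma> t) = \<alpha> t"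
    using \<gamma>(1) by (auto simp: lift_on_def)
  have \<gamma>X: "\<gamma> t \<in> topspace X" if "t \<in> {0..1}" for t
    using \<gamma>c that by (auto simp: continuous_map_def Pi_iff)
  define P where "P c d \<longleftrightarrow> (0 \<le> c \<longrightarrow> c \<le> d \<longrightarrow> d \<le> 1 \<longrightarrow>
     (\<forall>V. openin X V \<and> \<gamma> d \<in> V \<longrightarrow> (\<exists>N V'. openin (loop_space Y y) N \<and> \<alpha> \<in> N \<and> openin X V' \<and> \<gamma> c \<in> V' \<and>
        (\<forall>\<beta>\<in>N. \<forall>p\<in>V'. q p = \<beta> c \<longrightarrow> (\<exists>\<delta>. lift_on X q \<beta> c d \<delta> \<and> \<delta> c = p \<and> \<delta> d \<in> V)))))" for c d
  have "P 0 1"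
    using zero_le_one
  proof (induction rule: Bolzano)
    case (trans c d e)
    show ?case
      unfolding P_def
    proof (intro impI allI)
      fix V assume p: "0 \<le> c" "c \<le> e" "e \<le> 1" and V: "openin X V \<and> \<gamma> e \<in> V"
      have "0 \<le> d" "d \<le> 1" using p trans(3,4) by auto
      then obtain N' V' where 1: "openin (loop_space Y y) N'" "\<alpha> \<in> N'" "openin X V'" "\<gamma> d \<in> V'"
        "\<And>\<beta> p. \<beta> \<in> N' \<Longrightarrow> p \<in> V' \<Longrightarrow> q p = \<beta> d \<Longrightarrow> \<exists>\<delta>. lift_on X q \<beta> d e \<delta> \<and> \<delta> d = p \<and> \<delta> e \<in> V"
        using trans(2,4) p(3) V unfolding P_def by meson
      obtain N'' V'' where 2: "openin (loop_space Y y) N''" "\<alpha> \<in> N''" "openin X V''" "\<gamma> c \<in> V''"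
        "\<And>\<beta> p. \<beta> \<in> N'' \<Longrightarrow> p \<in> V'' \<Longrightarrow> q p = \<beta> c \<Longrightarrow> \<exists>\<delta>. lift_on X q \<beta> c d \<delta> \<and> \<delta> c = p \<and> \<delta> d \<in> V'"
        using trans(1,3) p(1) \<open>d \<le> 1\<close> 1(3,4) unfolding P_def by meson
      have "\<exists>\<delta>. lift_on X q \<beta> c e \<delta> \<and> \<delta> c = p \<and> \<delta> e \<in> V"
        if \<beta>: "\<beta> \<in> N' \<inter> N''" "p \<in> V''" "q p = \<beta> c" for \<beta> p
      proof -
        obtain \<delta> where \<delta>: "lift_on X q \<beta> c d \<delta>" "\<delta> c = p" "\<delta> d \<in> V'" using 2(5) \<beta> by blast
        have "q (\<delta> d) = \<beta> d" using \<delta>(1) trans(3) by (simp add: lift_on_def)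
        then obtain \<epsilon> where \<epsilon>: "lift_on X q \<beta> d e \<epsilon>" "\<epsilon> d = \<delta> d" "\<epsilon> e \<in> V" using 1(5) \<beta> \<delta>(3) by blast
        show ?thesis
          using lift_on_glue[OF \<delta>(1) \<epsilon>(1)] \<delta> \<epsilon> trans(3,4)
          by (intro exI[of _ "\<lambda>t. if t \<le> d then \<delta> t else \<epsilon> t"]) auto
      qed
      then show "\<exists>N V'. openin (loop_space Y y) N \<and> \<alpha> \<in> N \<and> openin X V' \<and> \<gamma> c \<in> V' \<and>
        (\<forall>\<beta>\<in>N. \<forall>p\<in>V'. q p = \<beta> c \<longrightarrow> (\<exists>\<delta>. lift_on X q \<beta> c e \<delta> \<and> \<delta> c = p \<and> \<delta> e \<in> V))"
        using 1 2 by (intro exI[of _ "N' \<inter> N''"] exI[of _ V'']) auto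
    qed
  next
    case (local x)
    then obtain W where W: "openin X W" "\<gamma> x \<in> W" "inj_on q W" using loc[OF \<gamma>X, of x] by auto
    obtain r where r: "r > 0" "\<And>t. t \<in> {0..1} \<Longrightarrow> \<bar>t - x\<bar> < r \<Longrightarrow> \<gamma> t \<in> W"
      using path_nhd[OF \<gamma>c _ W(1,2)] local by auto
    have "P c d" if cd: "c \<le> x" "x \<le> d" "d - c < r" for c d
      unfolding P_def
    proof (intro impI allI)
      fix V assume p: "0 \<le> c" "c \<le> d" "d \<le> 1" and V: "openin X V \<and> \<gamma> d \<in> V"
      \<comment> \<open>The first condition lets the inverse of \<open>q\<close> on \<open>W\<close>
        lift the whole piece; the second puts the end of this lift into \<open>V\<close>.\<close>
      let ?N = "{\<beta> \<in> loops Y y. \<beta> ` {c..d} \<subseteq> q ` W} \<inter> {\<beta> \<in> loops Y y. \<beta> ` {d} \<subseteq> q ` (W \<inter> V)}"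
      have "openin (loop_space Y y) ?N"
        using q W(1) V p by (intro openin_Int openin_loop_space_subbasic)
          (auto simp: open_map_def compactin_subtopology)
      moreover have "\<gamma> ` {c..d} \<subseteq> W" using r(2) p cd by auto
      then have "\<alpha> ` {c..d} \<subseteq> q ` W" "\<alpha> d \<in> q ` (W \<inter> V)"
        using q\<gamma> p V by (force simp flip: q\<gamma>)+
      then have "\<alpha> \<in> ?N" using \<alpha> by auto
      moreover have "\<exists>\<delta>. lift_on X q \<beta> c d \<delta> \<and> \<delta> c = p' \<and> \<delta> d \<in> V"
        if \<beta>: "\<beta> \<in> ?N" "p' \<in> W" "q p' = \<beta> c" for \<beta> p'
      proof -
        have "continuous_map (top_of_set {c..d}) Y \<beta>"
          using loops_continuous[of \<beta> Y y] \<beta>(1) p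
          by (auto intro: continuous_map_from_subtopology_mono)
        then have "lift_on X q \<beta> c d (inv_into W q \<circ> \<beta>)"
          using lift_on_sheet[OF q W(1,3)] \<beta>(1) by blast
        moreover have "inv_into W q (\<beta> c) = p'"
          using W \<beta>(2) by (simp add: inv_into_f_f flip: \<beta>(3))
        moreover have "inv_into W q (\<beta> d) \<in> V"
          using \<beta>(1) W(3) by (auto simp: inv_into_f_f)
        ultimately show ?thesis by (intro exI[of _ "inv_into W q \<circ> \<beta>"]) auto
      qed
      moreover have "\<gamma> c \<in> W" using r(2) p cd by auto
      ultimately show "\<exists>N V'. openin (loop_space Y y) N \<and> \<alpha> \<in> N \<and> openin X V' \<and> \<gamma> c \<in> V' \<and>
        (\<forall>\<beta>\<in>N. \<forall>p\<in>V'. q p = \<beta> c \<longrightarrow> (\<exists>\<delta>. lift_on X q \<beta> c d \<delta> \<and> \<delta> c = p \<and> \<delta> d \<in> V))"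
        using W(1) by (intro exI[of _ ?N] exI[of _ W] conjI ballI impI) assumption+
    qed
    then show ?case using r(1) by blast
  qed
  \<comment> \<open>Stability alone only brings the end of a lift near \<open>e1\<close>. Both
    points lie over \<open>y\<close>, so a target set on which \<open>q\<close> is injective forces
    them to agree.\<close>
  obtain W where W: "openin X W" "e1 \<in> W" "inj_on q W" using loc[OF \<gamma>X, of 1] \<gamma>(3) by auto
  obtain N V' where N: "openin (loop_space Y y) N" "\<alpha> \<in> N" "e0 \<in> V'"
    and lift: "\<And>\<beta> p. \<beta> \<in> N \<Longrightarrow> p \<in> V' \<Longrightarrow> q p = \<beta> 0 \<Longrightarrow> \<exists>\<delta>. lift_on X q \<beta> 0 1 \<delta> \<and> \<delta> 0 = p \<and> \<delta> 1 \<in> W"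
    using \<open>P 0 1\<close> W \<gamma>(2,3) unfolding P_def by (metis order_refl zero_le_one)
  have qe: "q e0 = y" "q e1 = y" using q\<gamma>[of 0] q\<gamma>[of 1] \<gamma> \<alpha> by (auto simp: loops_iff)
  have "N \<subseteq> liftable_loops X q Y y e0 e1"
  proof
    fix \<beta> assume \<beta>: "\<beta> \<in> N"
    then have \<beta>l: "\<beta> \<in> loops Y y" using openin_subset[OF N(1)] by auto
    then have "q e0 = \<beta> 0" using qe by (simp add: loops_iff)
    then obtain \<delta> where \<delta>: "lift_on X q \<beta> 0 1 \<delta>" "\<delta> 0 = e0" "\<delta> 1 \<in> W" using lift \<beta> N(3) by blast
    have "q (\<delta> 1) = q e1" using \<delta>(1) \<beta>l qe by (auto simp: lift_on_def loops_iff)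
    then have "\<delta> 1 = e1" using W \<delta>(3) by (auto dest: inj_onD)
    then show "\<beta> \<in> liftable_loops X q Y y e0 e1" using \<delta> \<beta>l by (auto simp: liftable_loops_def)
  qed
  then show "\<exists>T. openin (loop_space Y y) T \<and> \<alpha> \<in> T \<and> T \<subseteq> liftable_loops X q Y y e0 e1"
    using N by blast
qed

lemma liftable_loops_concat:
  assumes "\<alpha> \<in> liftable_loops X q Y y e0 e1" "\<beta> \<in> liftable_loops X q Y y e1 e2"
    "loop_concat \<alpha> \<beta> \<in> loops Y y"
  shows "loop_concat \<alpha> \<beta> \<in> liftable_loops X q Y y e0 e2"
proof -
  obtain \<gamma> \<delta> where \<gamma>: "lift_on X q \<alpha> 0 1 \<gamma>" "\<gamma> 0 = e0" "\<gamma> 1 = e1"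
    and \<delta>: "lift_on X q \<beta> 0 1 \<delta>" "\<delta> 0 = e1" "\<delta> 1 = e2"
    and ab: "\<alpha> 1 = \<beta> 0"
    using assms by (auto simp: liftable_loops_def loops_iff)
  let ?f = "\<lambda>t::real. 2 * t" and ?g = "\<lambda>t::real. 2 * t - 1"
  have "lift_on X q (\<alpha> \<circ> ?f) 0 (1/2) (\<gamma> \<circ> ?f)"
    by (rule lift_on_compose[OF \<gamma>(1)]) (auto intro!: continuous_intros)
  then have 1: "lift_on X q (loop_concat \<alpha> \<beta>) 0 (1/2) (\<gamma> \<circ> ?f)"
    by (rule lift_on_cong) (auto simp: loop_concat_def)
  have "lift_on X q (\<beta> \<circ> ?g) (1/2) 1 (\<delta> \<circ> ?g)"
    by (rule lift_on_compose[OF \<delta>(1)]) (auto intro!: continuous_intros)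
  then have 2: "lift_on X q (loop_concat \<alpha> \<beta>) (1/2) 1 (\<delta> \<circ> ?g)"
  proof (rule lift_on_cong)
    fix t :: real assume "t \<in> {1/2..1}"
    then show "(\<beta> \<circ> ?g) t = loop_concat \<alpha> \<beta> t"
    proof (cases "t = 1/2")
      \<comment> \<open>At the midpoint \<open>loop_concat\<close> takes its first branch, so the
        value of \<open>\<beta>\<close> has to be matched with the end of
        \<open>\<alpha>\<close>.\<close>
      case True
      show ?thesis unfolding True using ab by (simp add: loop_concat_def)
    qed (simp add: loop_concat_def)
  qed simp
  have "lift_on X q (loop_concat \<alpha> \<beta>) 0 1 (\<lambda>t. if t \<le> 1/2 then (\<gamma> \<circ> ?f) t else (\<delta> \<circ> ?g) t)"
    using 1 2 by (rule lift_on_glue) (simp add: \<gamma> \<delta>)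
  then show ?thesis
    using assms(3) \<gamma> \<delta> unfolding liftable_loops_def by force
qed

lemma liftable_loops_reverse:
  assumes "\<alpha> \<in> liftable_loops X q Y y e0 e1" "restrict (reversepath \<alpha>) {0..1} \<in> loops Y y"
  shows "restrict (reversepath \<alpha>) {0..1} \<in> liftable_loops X q Y y e1 e0"
proof -
  obtain \<gamma> where \<gamma>: "lift_on X q \<alpha> 0 1 \<gamma>" "\<gamma> 0 = e0" "\<gamma> 1 = e1"
    using assms by (auto simp: liftable_loops_def)
  have "lift_on X q (\<alpha> \<circ> (\<lambda>t. 1 - t)) 0 1 (\<gamma> \<circ> (\<lambda>t. 1 - t))"
    by (rule lift_on_compose[OF \<gamma>(1)]) (auto intro!: continuous_intros)
  then have "lift_on X q (restrict (reversepath \<alpha>) {0..1}) 0 1 (\<gamma> \<circ> (\<lambda>t. 1 - t))"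
    by (rule lift_on_cong) (auto simp: reversepath_def)
  then show ?thesis using assms(2) \<gamma> unfolding liftable_loops_def by force
qed

lemma liftable_loops_const:
  assumes "e \<in> topspace X" "q e = y" "(\<lambda>t\<in>{0..1}. y) \<in> loops Y y"
  shows "(\<lambda>t\<in>{0..1}. y) \<in> liftable_loops X q Y y e e"
  using assms by (auto simp: liftable_loops_def lift_on_def intro!: exI[of _ "\<lambda>t. e"])

lemma liftable_loops_iff:
  assumes q: "continuous_map X Y q" and e: "q e = y"
  shows "\<beta> \<in> liftable_loops X q Y y e e \<longleftrightarrow> (\<exists>\<gamma>\<in>loops X e. \<beta> = restrict (q \<circ> \<gamma>) {0..1})"
proof
  assume "\<beta> \<in> liftable_loops X q Y y e e"
  then obtain \<delta> where \<beta>: "\<beta> \<in> loops Y y" and \<delta>: "lift_on X q \<beta> 0 1 \<delta>" "\<delta> 0 = e" "\<delta> 1 = e"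
    by (auto simp: liftable_loops_def)
  have "continuous_map (top_of_set {0..1}) X (restrict \<delta> {0..1})"
    using \<delta>(1) continuous_map_eq[of "top_of_set {0..1}" X \<delta> "restrict \<delta> {0..1}"]
    by (auto simp: lift_on_def)
  then have "restrict \<delta> {0..1} \<in> loops X e" using \<delta> by (simp add: loops_iff pathin_def)
  moreover have "\<beta> = restrict (q \<circ> restrict \<delta> {0..1}) {0..1}"
    using \<beta> \<delta>(1) by (intro extensionalityI[of _ "{0..1}"]) (auto simp: loops_iff lift_on_def)
  ultimately show "\<exists>\<gamma>\<in>loops X e. \<beta> = restrict (q \<circ> \<gamma>) {0..1}" by blast
next
  assume "\<exists>\<gamma>\<in>loops X e. \<beta> = restrict (q \<circ> \<gamma>) {0..1}"
  then obtain \<gamma> where \<gamma>: "\<gamma> \<in> loops X e" "\<beta> = restrict (q \<circ> \<gamma>) {0..1}" by blast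
  have "continuous_map (top_of_set {0..1}) Y (q \<circ> \<gamma>)"
    using loops_continuous[OF \<gamma>(1)] q by (rule continuous_map_compose)
  then have "continuous_map (top_of_set {0..1}) Y \<beta>"
    using continuous_map_eq[of "top_of_set {0..1}" Y "q \<circ> \<gamma>" \<beta>] by (auto simp: \<gamma>(2))
  then have "\<beta> \<in> loops Y y" using \<gamma> e by (simp add: loops_iff pathin_def)
  moreover have "lift_on X q \<beta> 0 1 \<gamma>" "\<gamma> 0 = e" "\<gamma> 1 = e"
    using loops_continuous[OF \<gamma>(1)] \<gamma> by (auto simp: lift_on_def loops_iff)
  ultimately show "\<beta> \<in> liftable_loops X q Y y e e" by (auto simp: liftable_loops_def)
qed

section \<open>Images of fundamental groups\<close>

lemma loops_top_of_set:
  "\<alpha> \<in> loops (top_of_set S) x \<longleftrightarrow>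
     \<alpha> \<in> extensional {0..1} \<and> path \<alpha> \<and> path_image \<alpha> \<subseteq> S \<and> pathstart \<alpha> = x \<and> pathfinish \<alpha> = x"
  by (auto simp: loops_iff pathin_def path_def path_image_def pathstart_def pathfinish_def)

text \<open>Joins, reversals and constant paths of the path library are not extensional. Restriction
  turns them into points of the loop space without changing the homotopy class, so the group laws
  can be taken from \<open>homotopic_paths\<close>.\<close>

lemma restrict_path_in_loops:
  assumes "path f" "path_image f \<subseteq> S" "pathstart f = x" "pathfinish f = x"
  shows "restrict f {0..1} \<in> loops (top_of_set S) x" "homotopic_paths S f (restrict f {0..1})"
proof -
  have *: "path (restrict f {0..1})" using path_eq[OF assms(1)] by auto
  then show "restrict f {0..1} \<in> loops (top_of_set S) x"
    using assms by (simp add: loops_top_of_set path_image_def pathstart_def pathfinish_def)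
  show "homotopic_paths S f (restrict f {0..1})"
    using assms(1,2) by (rule homotopic_paths_eq) auto
qed

lemma loop_class_iff:
  assumes "\<alpha> \<in> loops (top_of_set S) x"
  shows "\<beta> \<in> loop_class (top_of_set S) x \<alpha> \<longleftrightarrow> \<beta> \<in> loops (top_of_set S) x \<and> homotopic_paths S \<alpha> \<beta>"
  using assms
  by (simp add: loop_class_def homotopic_paths_def loops_top_of_set pathstart_def pathfinish_def)

lemma loop_class_eq_iff:
  assumes "\<alpha> \<in> loops (top_of_set S) x" "\<beta> \<in> loops (top_of_set S) x"
  shows "loop_class (top_of_set S) x \<alpha> = loop_class (top_of_set S) x \<beta> \<longleftrightarrow> homotopic_paths S \<alpha> \<beta>"
proof
  assume "loop_class (top_of_set S) x \<alpha> = loop_class (top_of_set S) x \<beta>"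
  moreover have "\<beta> \<in> loop_class (top_of_set S) x \<beta>"
    using assms(2) by (simp add: loop_class_iff) (simp add: loops_top_of_set)
  ultimately show "homotopic_paths S \<alpha> \<beta>" using loop_class_iff[OF assms(1)] by blast
next
  assume *: "homotopic_paths S \<alpha> \<beta>"
  have "homotopic_paths S \<alpha> \<gamma> \<longleftrightarrow> homotopic_paths S \<beta> \<gamma>" for \<gamma>
    using * by (meson homotopic_paths_sym homotopic_paths_trans)
  then show "loop_class (top_of_set S) x \<alpha> = loop_class (top_of_set S) x \<beta>"
    by (simp add: set_eq_iff loop_class_iff[OF assms(1)] loop_class_iff[OF assms(2)])
qed

lemma loop_concat_in_loops:
  assumes "\<alpha> \<in> loops (top_of_set S) x" "\<beta> \<in> loops (top_of_set S) x"
  shows "loop_concat \<alpha> \<beta> \<in> loops (top_of_set S) x" "homotopic_paths S (\<alpha> +++ \<beta>) (loop_concat \<alpha> \<beta>)"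
proof -
  have "loop_concat \<alpha> \<beta> = restrict (\<alpha> +++ \<beta>) {0..1}"
    by (simp add: loop_concat_def joinpaths_def)
  moreover have "path (\<alpha> +++ \<beta>)" "path_image (\<alpha> +++ \<beta>) \<subseteq> S"
    "pathstart (\<alpha> +++ \<beta>) = x" "pathfinish (\<alpha> +++ \<beta>) = x"
    using assms by (auto simp: loops_top_of_set path_image_join)
  ultimately show "loop_concat \<alpha> \<beta> \<in> loops (top_of_set S) x"
    "homotopic_paths S (\<alpha> +++ \<beta>) (loop_concat \<alpha> \<beta>)"
    using restrict_path_in_loops[of "\<alpha> +++ \<beta>" S x] by auto
qed

lemma reverse_in_loops:
  assumes "\<alpha> \<in> loops (top_of_set S) x"
  shows "restrict (reversepath \<alpha>) {0..1} \<in> loops (top_of_set S) x"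
    "homotopic_paths S (reversepath \<alpha>) (restrict (reversepath \<alpha>) {0..1})"
  using restrict_path_in_loops[of "reversepath \<alpha>" S x] assms by (auto simp: loops_top_of_set)

lemma const_in_loops:
  fixes S :: "'a::real_normed_vector set"
  assumes "x \<in> S"
  shows "(\<lambda>t\<in>{0..1}. x) \<in> loops (top_of_set S) x"
    "homotopic_paths S (linepath x x) (\<lambda>t\<in>{0..1}. x)"
proof -
  have "restrict (linepath x x) {0..1} = (\<lambda>t\<in>{0..1}. x)"
    by (auto simp: linepath_def algebra_simps)
  moreover have "path_image (linepath x x) \<subseteq> S" using assms by simp
  ultimately show "(\<lambda>t\<in>{0..1}. x) \<in> loops (top_of_set S) x"
    "homotopic_paths S (linepath x x) (\<lambda>t\<in>{0..1}. x)"
    using restrict_path_in_loops[OF path_linepath, of x x S x]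
    by (simp_all only: pathstart_linepath pathfinish_linepath)
qed

text \<open>Evaluates the operations on classes, which are unions over representatives.\<close>

lemma UN_eq_const: "a \<in> A \<Longrightarrow> (\<And>x. x \<in> A \<Longrightarrow> F x = C) \<Longrightarrow> (\<Union>x\<in>A. F x) = C"
  by blast

lemma loop_class_mult:
  assumes "\<alpha> \<in> loops (top_of_set S) x" "\<beta> \<in> loops (top_of_set S) x"
  shows "loop_class (top_of_set S) x \<alpha> \<otimes>\<^bsub>pi1 (top_of_set S) x\<^esub> loop_class (top_of_set S) x \<beta> =
    loop_class (top_of_set S) x (loop_concat \<alpha> \<beta>)"
proof -
  have "loop_class (top_of_set S) x (loop_concat \<alpha>' \<beta>') = loop_class (top_of_set S) x (loop_concat \<alpha> \<beta>)"
    if "\<alpha>' \<in> loop_class (top_of_set S) x \<alpha>" "\<beta>' \<in> loop_class (top_of_set S) x \<beta>" for \<alpha>' \<beta>'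
  proof -
    have a: "\<alpha>' \<in> loops (top_of_set S) x" "homotopic_paths S \<alpha> \<alpha>'"
      and b: "\<beta>' \<in> loops (top_of_set S) x" "homotopic_paths S \<beta> \<beta>'"
      using that by (auto simp: loop_class_iff assms)
    have "homotopic_paths S (\<alpha> +++ \<beta>) (\<alpha>' +++ \<beta>')"
      using a(2) b(2) by (rule homotopic_paths_join) (use assms in \<open>simp add: loops_top_of_set\<close>)
    then have "homotopic_paths S (loop_concat \<alpha>' \<beta>') (loop_concat \<alpha> \<beta>)"
      using loop_concat_in_loops(2)[OF assms] loop_concat_in_loops(2)[OF a(1) b(1)]
      by (meson homotopic_paths_sym homotopic_paths_trans)
    then show ?thesis
      using loop_class_eq_iff loop_concat_in_loops(1)[OF assms] loop_concat_in_loops(1)[OF a(1) b(1)]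
      by blast
  qed
  note * = this
  have refl: "\<alpha> \<in> loop_class (top_of_set S) x \<alpha>" "\<beta> \<in> loop_class (top_of_set S) x \<beta>"
    using assms by (simp_all add: loop_class_iff) (simp_all add: loops_top_of_set)
  have "(\<Union>\<alpha>'\<in>loop_class (top_of_set S) x \<alpha>. \<Union>\<beta>'\<in>loop_class (top_of_set S) x \<beta>.
      loop_class (top_of_set S) x (loop_concat \<alpha>' \<beta>')) = loop_class (top_of_set S) x (loop_concat \<alpha> \<beta>)"
    by (rule UN_eq_const[OF refl(1)], rule UN_eq_const[OF refl(2)], rule *)
  then show ?thesis by (simp add: pi1_def)
qed

lemma loop_class_eq_of_homotopic:
  assumes "\<alpha> \<in> loops (top_of_set S) x" "\<beta> \<in> loops (top_of_set S) x"
    "homotopic_paths S f \<alpha>" "homotopic_paths S g \<beta>" "homotopic_paths S f g"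
  shows "loop_class (top_of_set S) x \<alpha> = loop_class (top_of_set S) x \<beta>"
proof -
  have "homotopic_paths S \<alpha> f" using assms(3) by (rule homotopic_paths_sym)
  also note assms(5)
  also note assms(4)
  finally show ?thesis using loop_class_eq_iff[OF assms(1,2)] by blast
qed

lemma loop_class_assoc:
  fixes S :: "'a::real_normed_vector set"
  assumes a: "\<alpha> \<in> loops (top_of_set S) x" and b: "\<beta> \<in> loops (top_of_set S) x"
    and c: "\<gamma> \<in> loops (top_of_set S) x"
  shows "loop_class (top_of_set S) x (loop_concat (loop_concat \<alpha> \<beta>) \<gamma>) =
    loop_class (top_of_set S) x (loop_concat \<alpha> (loop_concat \<beta> \<gamma>))"
proof (rule loop_class_eq_of_homotopic)
  note ab = loop_concat_in_loops[OF a b] and bc = loop_concat_in_loops[OF b c]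
  show "loop_concat (loop_concat \<alpha> \<beta>) \<gamma> \<in> loops (top_of_set S) x"
    using loop_concat_in_loops(1)[OF ab(1) c] .
  show "loop_concat \<alpha> (loop_concat \<beta> \<gamma>) \<in> loops (top_of_set S) x"
    using loop_concat_in_loops(1)[OF a bc(1)] .
  have refl: "homotopic_paths S \<alpha> \<alpha>" "homotopic_paths S \<gamma> \<gamma>" using a c by (auto simp: loops_top_of_set)
  have "homotopic_paths S ((\<alpha> +++ \<beta>) +++ \<gamma>) (loop_concat \<alpha> \<beta> +++ \<gamma>)"
    using ab(2) refl(2) by (rule homotopic_paths_join) (use a b c in \<open>simp add: loops_top_of_set\<close>)
  then show "homotopic_paths S ((\<alpha> +++ \<beta>) +++ \<gamma>) (loop_concat (loop_concat \<alpha> \<beta>) \<gamma>)"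
    using loop_concat_in_loops(2)[OF ab(1) c] by (rule homotopic_paths_trans)
  have "homotopic_paths S (\<alpha> +++ (\<beta> +++ \<gamma>)) (\<alpha> +++ loop_concat \<beta> \<gamma>)"
    using refl(1) bc(2) by (rule homotopic_paths_join) (use a b c in \<open>simp add: loops_top_of_set\<close>)
  then show "homotopic_paths S (\<alpha> +++ (\<beta> +++ \<gamma>)) (loop_concat \<alpha> (loop_concat \<beta> \<gamma>))"
    using loop_concat_in_loops(2)[OF a bc(1)] by (rule homotopic_paths_trans)
  show "homotopic_paths S ((\<alpha> +++ \<beta>) +++ \<gamma>) (\<alpha> +++ (\<beta> +++ \<gamma>))"
    using a b c by (intro homotopic_paths_sym[OF homotopic_paths_assoc]) (auto simp: loops_top_of_set)
qed

lemma loop_class_unit: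
  fixes S :: "'a::real_normed_vector set"
  assumes a: "\<alpha> \<in> loops (top_of_set S) x" and x: "x \<in> S"
  shows "loop_class (top_of_set S) x (loop_concat (\<lambda>t\<in>{0..1}. x) \<alpha>) = loop_class (top_of_set S) x \<alpha>"
proof (rule loop_class_eq_of_homotopic[where f = "linepath x x +++ \<alpha>" and g = \<alpha>])
  note c = const_in_loops[OF x]
  show "loop_concat (\<lambda>t\<in>{0..1}. x) \<alpha> \<in> loops (top_of_set S) x"
    using loop_concat_in_loops(1)[OF c(1) a] .
  have refl: "homotopic_paths S \<alpha> \<alpha>" using a by (auto simp: loops_top_of_set)
  have "homotopic_paths S (linepath x x +++ \<alpha>) ((\<lambda>t\<in>{0..1}. x) +++ \<alpha>)"
    using c(2) refl by (rule homotopic_paths_join) (use a in \<open>simp add: loops_top_of_set\<close>)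
  then show "homotopic_paths S (linepath x x +++ \<alpha>) (loop_concat (\<lambda>t\<in>{0..1}. x) \<alpha>)"
    using loop_concat_in_loops(2)[OF c(1) a] by (rule homotopic_paths_trans)
  show "homotopic_paths S (linepath x x +++ \<alpha>) \<alpha>"
    using a by (intro homotopic_paths_lid') (auto simp: loops_top_of_set)
qed (use a in \<open>auto simp: loops_top_of_set\<close>)

lemma loop_class_inverse:
  fixes S :: "'a::real_normed_vector set"
  assumes a: "\<alpha> \<in> loops (top_of_set S) x" and x: "x \<in> S"
  shows "loop_class (top_of_set S) x (loop_concat (restrict (reversepath \<alpha>) {0..1}) \<alpha>) =
    loop_class (top_of_set S) x (\<lambda>t\<in>{0..1}. x)"
proof (rule loop_class_eq_of_homotopic[where f = "reversepath \<alpha> +++ \<alpha>" and g = "linepath x x"])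
  note c = const_in_loops[OF x] and r = reverse_in_loops[OF a]
  show "loop_concat (restrict (reversepath \<alpha>) {0..1}) \<alpha> \<in> loops (top_of_set S) x"
    using loop_concat_in_loops(1)[OF r(1) a] .
  have refl: "homotopic_paths S \<alpha> \<alpha>" using a by (auto simp: loops_top_of_set)
  have "homotopic_paths S (reversepath \<alpha> +++ \<alpha>) (restrict (reversepath \<alpha>) {0..1} +++ \<alpha>)"
    using r(2) refl by (rule homotopic_paths_join) (use a in \<open>simp add: loops_top_of_set\<close>)
  then show "homotopic_paths S (reversepath \<alpha> +++ \<alpha>) (loop_concat (restrict (reversepath \<alpha>) {0..1}) \<alpha>)"
    using loop_concat_in_loops(2)[OF r(1) a] by (rule homotopic_paths_trans)
  show "homotopic_paths S (reversepath \<alpha> +++ \<alpha>) (linepath x x)"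
    using a homotopic_paths_linv[of \<alpha> S] by (auto simp: loops_top_of_set)
qed (use const_in_loops[OF x] in auto)

text \<open>\<open>groupI\<close> asks for a left unit and left inverses, which is the side prepared
  in \<open>loop_class_unit\<close> and \<open>loop_class_inverse\<close>.\<close>

lemma pi1_group:
  fixes S :: "'a::real_normed_vector set"
  assumes "x \<in> S"
  shows "group (pi1 (top_of_set S) x)"
proof (rule groupI)
  let ?G = "pi1 (top_of_set S) x" and ?c = "loop_class (top_of_set S) x"
  have carrier: "carrier ?G = ?c ` loops (top_of_set S) x"
    and one: "\<one>\<^bsub>?G\<^esub> = ?c (\<lambda>t\<in>{0..1}. x)" by (simp_all add: pi1_def)
  show "\<one>\<^bsub>?G\<^esub> \<in> carrier ?G" using const_in_loops(1)[OF assms] by (simp add: carrier one)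
  fix A assume "A \<in> carrier ?G"
  then obtain \<alpha> where \<alpha>: "\<alpha> \<in> loops (top_of_set S) x" "A = ?c \<alpha>" by (auto simp: carrier)
  show "\<one>\<^bsub>?G\<^esub> \<otimes>\<^bsub>?G\<^esub> A = A"
    unfolding one \<alpha>(2) loop_class_mult[OF const_in_loops(1)[OF assms] \<alpha>(1)]
    using loop_class_unit[OF \<alpha>(1) assms] .
  show "\<exists>B\<in>carrier ?G. B \<otimes>\<^bsub>?G\<^esub> A = \<one>\<^bsub>?G\<^esub>"
    unfolding one \<alpha>(2) carrier
    using loop_class_mult[OF reverse_in_loops(1)[OF \<alpha>(1)] \<alpha>(1)] loop_class_inverse[OF \<alpha>(1) assms]
      reverse_in_loops(1)[OF \<alpha>(1)] by force
  fix B assume "B \<in> carrier ?G"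
  then obtain \<beta> where \<beta>: "\<beta> \<in> loops (top_of_set S) x" "B = ?c \<beta>" by (auto simp: carrier)
  note ab = loop_concat_in_loops(1)[OF \<alpha>(1) \<beta>(1)]
  show "A \<otimes>\<^bsub>?G\<^esub> B \<in> carrier ?G"
    unfolding \<alpha> \<beta> loop_class_mult[OF \<alpha>(1) \<beta>(1)] carrier using ab by blast
  fix C assume "C \<in> carrier ?G"
  then obtain \<gamma> where \<gamma>: "\<gamma> \<in> loops (top_of_set S) x" "C = ?c \<gamma>" by (auto simp: carrier)
  show "A \<otimes>\<^bsub>?G\<^esub> B \<otimes>\<^bsub>?G\<^esub> C = A \<otimes>\<^bsub>?G\<^esub> (B \<otimes>\<^bsub>?G\<^esub> C)"
    unfolding \<alpha>(2) \<beta>(2) \<gamma>(2) loop_class_mult[OF \<alpha>(1) \<beta>(1)] loop_class_mult[OF \<beta>(1) \<gamma>(1)]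
      loop_class_mult[OF ab \<gamma>(1)] loop_class_mult[OF \<alpha>(1) loop_concat_in_loops(1)[OF \<beta>(1) \<gamma>(1)]]
    by (rule loop_class_assoc[OF \<alpha>(1) \<beta>(1) \<gamma>(1)])
qed

lemma inv_loop_class:
  fixes S :: "'a::real_normed_vector set"
  assumes a: "\<alpha> \<in> loops (top_of_set S) x" and x: "x \<in> S"
  shows "inv\<^bsub>pi1 (top_of_set S) x\<^esub> loop_class (top_of_set S) x \<alpha> =
    loop_class (top_of_set S) x (restrict (reversepath \<alpha>) {0..1})"
proof (rule group.inv_equality[OF pi1_group[OF x]])
  show "loop_class (top_of_set S) x (restrict (reversepath \<alpha>) {0..1}) \<otimes>\<^bsub>pi1 (top_of_set S) x\<^esub>
    loop_class (top_of_set S) x \<alpha> = \<one>\<^bsub>pi1 (top_of_set S) x\<^esub>"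
    unfolding loop_class_mult[OF reverse_in_loops(1)[OF a] a] loop_class_inverse[OF a x]
    by (simp add: pi1_def)
qed (use a reverse_in_loops(1)[OF a] in \<open>auto simp: pi1_def\<close>)

lemma pi1_map_loop_class:
  assumes q: "continuous_map X (top_of_set S) q" "q e = y" and \<gamma>: "\<gamma> \<in> loops X e"
  shows "pi1_map q (top_of_set S) y (loop_class X e \<gamma>) =
    loop_class (top_of_set S) y (restrict (q \<circ> \<gamma>) {0..1})"
proof -
  let ?h = "\<lambda>\<gamma>. restrict (q \<circ> \<gamma>) {0..1}"
  have h: "path (q \<circ> \<delta>)" "path_image (q \<circ> \<delta>) \<subseteq> S" "pathstart (q \<circ> \<delta>) = y" "pathfinish (q \<circ> \<delta>) = y"
    if "\<delta> \<in> loops X e" for \<delta>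
  proof -
    have "continuous_map (top_of_set {0..1}) (top_of_set S) (q \<circ> \<delta>)"
      using loops_continuous[OF that] q(1) by (rule continuous_map_compose)
    then show "path (q \<circ> \<delta>)" "path_image (q \<circ> \<delta>) \<subseteq> S" by (auto simp: path_def path_image_def)
    show "pathstart (q \<circ> \<delta>) = y" "pathfinish (q \<circ> \<delta>) = y"
      using that q(2) by (auto simp: loops_iff pathstart_def pathfinish_def)
  qed
  have "loop_class (top_of_set S) y (?h \<delta>) = loop_class (top_of_set S) y (?h \<gamma>)"
    if \<delta>: "\<delta> \<in> loop_class X e \<gamma>" for \<delta>
  proof -
    have \<delta>l: "\<delta> \<in> loops X e"
      and hom: "homotopic_with (\<lambda>r. r 0 = e \<and> r 1 = e) (top_of_set {0..1}) X \<gamma> \<delta>"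
      using \<delta> by (auto simp: loop_class_def)
    have "homotopic_with (\<lambda>r. r 0 = y \<and> r 1 = y) (top_of_set {0..1}) (top_of_set S) (q \<circ> \<gamma>) (q \<circ> \<delta>)"
      by (rule homotopic_with_compose_continuous_map_left[OF hom q(1)]) (use q(2) in auto)
    then have "homotopic_paths S (q \<circ> \<gamma>) (q \<circ> \<delta>)"
      using h(3,4)[OF \<gamma>] by (simp add: homotopic_paths_def pathstart_def pathfinish_def)
    then show ?thesis
      using restrict_path_in_loops[OF h[OF \<delta>l]] restrict_path_in_loops[OF h[OF \<gamma>]]
      by (intro loop_class_eq_of_homotopic[of _ S y _ "q \<circ> \<delta>" "q \<circ> \<gamma>"]) (auto intro: homotopic_paths_sym)
  qed
  note * = this
  have "\<gamma> \<in> loop_class X e \<gamma>"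
    using \<gamma> loops_continuous[OF \<gamma>] by (simp add: loop_class_def) (simp add: loops_iff)
  then show ?thesis unfolding pi1_map_def by (rule UN_eq_const) (rule *)
qed

text \<open>A class thus belongs to the image if and only if some representative has a closed lift
  at \<open>e\<close>, which allows all further arguments to be about lifts.\<close>

lemma pi1_map_image:
  assumes "continuous_map X (top_of_set S) q" "q e = y"
  shows "pi1_map q (top_of_set S) y ` carrier (pi1 X e) =
    loop_class (top_of_set S) y ` liftable_loops X q (top_of_set S) y e e"
proof -
  have "liftable_loops X q (top_of_set S) y e e = (\<lambda>\<gamma>. restrict (q \<circ> \<gamma>) {0..1}) ` loops X e"
    using liftable_loops_iff[OF assms] by blast
  then show ?thesis
    using pi1_map_loop_class[OF assms] by (simp add: pi1_def image_image)
qed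

text \<open>The covering graph will enter only through \<open>loc\<close> and \<open>cover\<close>:
  the sheets make the sets of liftable loops open, and \<open>covers_within\<close> provides the
  lifts.\<close>

lemma pi1_map_image_open_subgroup:
  fixes S :: "'b::real_normed_vector set"
  assumes q: "continuous_map X (top_of_set S) q" "open_map X (top_of_set S) q"
    and loc: "\<And>p. p \<in> topspace X \<Longrightarrow> \<exists>W. openin X W \<and> p \<in> W \<and> inj_on q W"
    and cover: "\<And>s. s \<in> S \<Longrightarrow> \<exists>U. openin (top_of_set S) U \<and> s \<in> U \<and>
      (\<forall>p\<in>topspace X. q p \<in> U \<longrightarrow> (\<exists>D. p \<in> D \<and> covers_within X (top_of_set S) q D U))"
    and e: "e \<in> topspace X" "q e = y"
  shows "subgroup (pi1_map q (top_of_set S) y ` carrier (pi1 X e)) (pi1 (top_of_set S) y)"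
    "openin (pi1_topology (top_of_set S) y) (pi1_map q (top_of_set S) y ` carrier (pi1 X e))"
proof -
  let ?Y = "top_of_set S"
  let ?G = "pi1 ?Y y" and ?c = "loop_class ?Y y" and ?L = "liftable_loops X q ?Y y"
  define K where "K = ?c ` ?L e e"
  have K: "pi1_map q ?Y y ` carrier (pi1 X e) = K"
    unfolding K_def by (rule pi1_map_image[OF q(1) e(2)])
  have y: "y \<in> S" using q(1) e by (auto simp: continuous_map_def)
  interpret group ?G using y by (rule pi1_group)
  have Ll: "\<beta> \<in> loops ?Y y" if "\<beta> \<in> ?L e0 e1" for \<beta> e0 e1 using that by (simp add: liftable_loops_def)
  have carrier: "carrier ?G = ?c ` loops ?Y y" by (simp add: pi1_def)
  have KG: "K \<subseteq> carrier ?G" using Ll by (auto simp: K_def carrier)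
  have sub: "subgroup K ?G"
  proof (rule subgroupI)
    show "K \<subseteq> carrier ?G" by (rule KG)
    show "K \<noteq> {}" using liftable_loops_const[of e X q y ?Y] e const_in_loops(1)[OF y] by (auto simp: K_def)
    fix A assume "A \<in> K"
    then obtain \<alpha> where \<alpha>: "\<alpha> \<in> ?L e e" "A = ?c \<alpha>" by (auto simp: K_def)
    show "inv\<^bsub>?G\<^esub> A \<in> K"
      unfolding \<alpha>(2) inv_loop_class[OF Ll[OF \<alpha>(1)] y] K_def
      using liftable_loops_reverse[OF \<alpha>(1) reverse_in_loops(1)[OF Ll[OF \<alpha>(1)]]] by blast
    fix B assume "B \<in> K"
    then obtain \<beta> where \<beta>: "\<beta> \<in> ?L e e" "B = ?c \<beta>" by (auto simp: K_def)
    show "A \<otimes>\<^bsub>?G\<^esub> B \<in> K"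
      unfolding \<alpha>(2) \<beta>(2) loop_class_mult[OF Ll[OF \<alpha>(1)] Ll[OF \<beta>(1)]] K_def
      using liftable_loops_concat[OF \<alpha>(1) \<beta>(1) loop_concat_in_loops(1)[OF Ll[OF \<alpha>(1)] Ll[OF \<beta>(1)]]]
      by blast
  qed
  have "openin (loop_space ?Y y) {\<alpha> \<in> loops ?Y y. ?c \<alpha> \<in> K}"
  proof (subst openin_subopen, intro ballI)
    fix \<alpha> assume "\<alpha> \<in> {\<alpha> \<in> loops ?Y y. ?c \<alpha> \<in> K}"
    then have \<alpha>: "\<alpha> \<in> loops ?Y y" "?c \<alpha> \<in> K" by auto
    then have "q e = \<alpha> 0" using e by (simp add: loops_iff)
    \<comment> \<open>That the class lies in \<open>K\<close> says nothing about
      \<open>\<alpha>\<close> itself, only about a homotopic loop. So the lift comes from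
      \<open>path_lift\<close>, and its end is left undetermined.\<close>
    then obtain \<gamma> where \<gamma>: "lift_on X q \<alpha> 0 1 \<gamma>" "\<gamma> 0 = e"
      using path_lift[OF q(2) loops_continuous[OF \<alpha>(1)], of e] cover e(1) by auto
    let ?e = "\<gamma> 1" and ?r = "restrict (reversepath \<alpha>) {0..1}"
    have \<alpha>L: "\<alpha> \<in> ?L e ?e" using \<alpha>(1) \<gamma> by (auto simp: liftable_loops_def)
    have "?c \<beta> \<in> K" if \<beta>: "\<beta> \<in> ?L e ?e" for \<beta>
    proof -
      have G: "?c \<beta> \<in> carrier ?G" "?c \<alpha> \<in> carrier ?G" using \<alpha>(1) Ll[OF \<beta>] by (auto simp: carrier)
      have "?c \<beta> \<otimes>\<^bsub>?G\<^esub> inv\<^bsub>?G\<^esub> ?c \<alpha> = ?c (loop_concat \<beta> ?r)"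
        unfolding inv_loop_class[OF \<alpha>(1) y]
        by (rule loop_class_mult[OF Ll[OF \<beta>] reverse_in_loops(1)[OF \<alpha>(1)]])
      moreover have "loop_concat \<beta> ?r \<in> ?L e e"
        using liftable_loops_concat[OF \<beta> liftable_loops_reverse[OF \<alpha>L]] reverse_in_loops(1)[OF \<alpha>(1)]
          loop_concat_in_loops(1)[OF Ll[OF \<beta>]] by blast
      ultimately have "?c \<beta> \<otimes>\<^bsub>?G\<^esub> inv\<^bsub>?G\<^esub> ?c \<alpha> \<in> K" by (simp add: K_def)
      then have "?c \<beta> \<otimes>\<^bsub>?G\<^esub> inv\<^bsub>?G\<^esub> ?c \<alpha> \<otimes>\<^bsub>?G\<^esub> ?c \<alpha> \<in> K"
        using \<alpha>(2) subgroup.m_closed[OF sub] by blast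
      then show ?thesis using G by (simp add: m_assoc)
    qed
    then have "?L e ?e \<subseteq> {\<alpha> \<in> loops ?Y y. ?c \<alpha> \<in> K}" using Ll by blast
    moreover have "openin (loop_space ?Y y) (?L e ?e)" using q(2) loc by (rule openin_liftable_loops)
    ultimately show "\<exists>T. openin (loop_space ?Y y) T \<and> \<alpha> \<in> T \<and> T \<subseteq> {\<alpha> \<in> loops ?Y y. ?c \<alpha> \<in> K}"
      using \<alpha>L by (intro exI[of _ "?L e ?e"] conjI)
  qed
  then show "openin (pi1_topology ?Y y) (pi1_map q ?Y y ` carrier (pi1 X e))"
    unfolding K openin_pi1_topology using KG by blast
  show "subgroup (pi1_map q ?Y y ` carrier (pi1 X e)) ?G" unfolding K by (rule sub)
qed

section \<open>Lifting paths in the Hawaiian Earring\<close>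

context word_sequence
begin

lemma edge_sheet:
  assumes "(a, i, b) \<in> hat_edges w" "open A" "A \<subseteq> {0<..<1}"
  shows "openin hat_top (Inner (a, i, b) ` A)" "inj_on qmap (Inner (a, i, b) ` A)"
    "qmap ` Inner (a, i, b) ` A = ell i ` A" "openin (top_of_set earring) (ell i ` A)"
proof -
  have i: "1 \<le> i" using assms(1) by (rule hat_edgeD)
  show "openin hat_top (Inner (a, i, b) ` A)" using assms by (rule openin_hat_top_edge)
  show "openin (top_of_set earring) (ell i ` A)" using i assms(2,3) by (rule openin_ell_image)
  show "qmap ` Inner (a, i, b) ` A = ell i ` A" by (auto simp: image_image)
  show "inj_on qmap (Inner (a, i, b) ` A)"
  proof (rule inj_onI)
    fix p p' assume "p \<in> Inner (a, i, b) ` A" "p' \<in> Inner (a, i, b) ` A" "qmap p = qmap p'"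
    then obtain t t' where t: "t \<in> A" "t' \<in> A" "p = Inner (a, i, b) t" "p' = Inner (a, i, b) t'"
        "ell i t = ell i t'" by auto
    then have "t = t'" using ell_inject[OF i _ _ i, of t t'] assms(3) by (auto simp: subset_eq)
    then show "p = p'" using t by simp
  qed
qed

text \<open>Off the base point the map is evenly covered, with the open edges over the circle as
  sheets, so \<open>D\<close> can be the whole space.\<close>

lemma earring_circle_covered:
  assumes "1 \<le> i"
  shows "covers_within hat_top (top_of_set earring) qmap (hat_space w) (ell i ` {0<..<1})"
  unfolding covers_within_def
proof (intro ballI exI[of _ "ell i ` {0<..<1}"] conjI impI)
  let ?V = "ell i ` {0<..<1}"
  show "openin (top_of_set earring) ?V" using assms by (intro openin_ell_image) auto
  fix e assume e: "e \<in> hat_space w" "qmap e \<in> ?V"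
  then obtain t where t: "0 < t" "t < 1" "qmap e = ell i t" by auto
  then obtain a j b s where abi: "e = Inner (a, j, b) s"
    using ell_nonzero[OF assms t(1,2)] by (cases e) auto
  then have s: "(a, j, b) \<in> hat_edges w" "0 < s" "s < 1" using e by (auto simp: Inner_in_hat_space)
  then have "j = i" using t abi ell_inject[OF hat_edgeD(3)[OF s(1)] s(2,3) assms t(1,2)] by simp
  note W = edge_sheet[OF s(1), of "{0<..<1}", unfolded \<open>j = i\<close>]
  show "\<exists>W\<subseteq>hat_space w. openin hat_top W \<and> e \<in> W \<and> inj_on qmap W \<and> ?V \<subseteq> qmap ` W"
    using W s abi \<open>j = i\<close> openin_subset[OF W(1)]
    by (intro exI[of _ "Inner (a, i, b) ` {0<..<1}"]) (simp_all add: topspace_hat_top)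
qed

text \<open>\<open>earring_Uinf 2\<close> contains the circles of index at least 3 completely but
  only the ends of the first two. Over it one passes from vertex to vertex only along labels at
  least 3, hence inside the set \<open>V\<close> of \<open>Gamma_star_component\<close>, on which
  \<open>N\<close> bounds \<open>nv\<close>. The second alternative for \<open>p\<close> covers the
  middle parts of edges.\<close>

lemma earring_base_covered:
  assumes v: "v \<in> Gamma_star w"
    and p: "p \<in> hat_Uv w v \<or> (p \<in> hat_space w \<and> (\<exists>i b t. p = Inner (v, i, b) t \<and> 3 \<le> i))"
  shows "\<exists>D. p \<in> D \<and> covers_within hat_top (top_of_set earring) qmap D (earring_Uinf 2)"
proof -
  obtain V N where V: "v \<in> V" "V \<subseteq> Gamma_star w" "2 \<le> N"
    and closed: "\<And>u i b. u \<in> V \<Longrightarrow> 3 \<le> i \<Longrightarrow> neighbour u i b \<in> Gamma_star w \<Longrightarrow> i \<le> N \<and> neighbour u i b \<in> V"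
    using Gamma_star_component[OF v] by blast
  have nvN: "nv w u \<le> N" if "u \<in> V" for u using nv_le(3)[of u N] V that closed by blast
  have ends: "a \<in> V \<longleftrightarrow> b \<in> V" if "(a, i, b) \<in> hat_edges w" "3 \<le> i" for a i b
  proof
    assume a: "a \<in> V"
    then have "b = edge_target a i" using that(1) V(2) hat_edge_from by blast
    then show "b \<in> V" using closed[OF a that(2)] a by (auto simp: edge_target_def)
  next
    assume b: "b \<in> V"
    then have "a = edge_source b i" using that(1) V(2) hat_edge_to by blast
    then show "a \<in> V" using closed[OF b that(2)] b by (auto simp: edge_source_def)
  qed
  \<comment> \<open>The vertex neighbourhoods miss the middle parts of edges that are not loops with
    large labels. For labels at least 3 these parts lie over \<open>earring_Uinf 2\<close>, so the
    whole edges are added.\<close>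
  define D where "D = (\<Union>u\<in>V. hat_Uv w u) \<union> {p \<in> hat_space w. \<exists>a i b t. p = Inner (a, i, b) t \<and> 3 \<le> i \<and> a \<in> V}"
  have Dspace: "D \<subseteq> hat_space w" using hat_Uv_subset V(2) by (auto simp: D_def)
  have "covers_within hat_top (top_of_set earring) qmap D (earring_Uinf 2)"
    unfolding covers_within_def
  proof
    fix c assume c: "c \<in> earring_Uinf 2"
    then have "c \<in> earring" using earring_Uinf_subset by blast
    then show "\<exists>U. openin (top_of_set earring) U \<and> c \<in> U \<and>
      (\<forall>e\<in>D. qmap e \<in> U \<longrightarrow> (\<exists>W\<subseteq>D. openin hat_top W \<and> e \<in> W \<and> inj_on qmap W \<and> U \<subseteq> qmap ` W))"
    proof (cases rule: earring_cases)
      case 1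
      \<comment> \<open>Around the base point the sheets are the sets \<open>hat_Uv w u\<close> with
        \<open>u\<close> in \<open>V\<close>. Since \<open>N\<close> bounds \<open>nv\<close> on
        \<open>V\<close>, each of them covers all of \<open>earring_Uinf N\<close>.\<close>
      have "\<exists>W\<subseteq>D. openin hat_top W \<and> e \<in> W \<and> inj_on qmap W \<and> earring_Uinf N \<subseteq> qmap ` W"
        if e: "e \<in> D" "qmap e \<in> earring_Uinf N" for e
      proof -
        have "\<exists>u\<in>V. e \<in> hat_Uv w u"
        proof (cases "\<exists>u\<in>V. e \<in> hat_Uv w u")
          case False
          then obtain a i b t where e': "e = Inner (a, i, b) t" "3 \<le> i" "a \<in> V" "e \<in> hat_space w"
            using e(1) by (auto simp: D_def)
          then have ed: "(a, i, b) \<in> hat_edges w" "0 < t" "t < 1" by (auto simp: Inner_in_hat_space)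
          then have b: "b \<in> V" using ends e' by blast
          have "N < i \<or> t < 3/8 \<or> 5/8 < t"
            using e(2) e'(1,2) ed ell_in_earring_Uinf by simp
          \<comment> \<open>An edge at \<open>V\<close> whose label exceeds \<open>N\<close> is a
            loop and belongs entirely to the neighbourhood of its vertex.\<close>
          moreover have "b = a" if "N < i"
          proof -
            have "nv w a < i" using nvN[OF e'(3)] that by simp
            then show ?thesis using hat_loop(1)[of a i] hat_edge_from[of a i b] e'(3) V(2) ed(1) by auto
          qed
          ultimately have "e \<in> hat_Uv w a \<or> e \<in> hat_Uv w b"
            using ed e' nvN[OF e'(3)] by (auto simp: Inner_in_hat_Uv)
          then show ?thesis using b e'(3) by blast
        qed
        then obtain u where u: "u \<in> V" "e \<in> hat_Uv w u" by blast
        have "hat_Uv w u \<subseteq> D" using u by (auto simp: D_def)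
        moreover have "earring_Uinf N \<subseteq> qmap ` hat_Uv w u"
          using qmap_image_hat_Uv earring_Uinf_antimono[OF nvN[OF u(1)]] u V(2) by blast
        ultimately show ?thesis
          using u V(2) openin_hat_top_Uv inj_on_hat_Uv by (intro exI[of _ "hat_Uv w u"]) blast
      qed
      then show ?thesis
        using 1 zero_in_earring_Uinf openin_earring_Uinf by (intro exI[of _ "earring_Uinf N"]) simp
    next
      case (2 i t)
      \<comment> \<open>On circles 1 and 2 the set \<open>D\<close> contains only pieces at the ends
        that belong to \<open>V\<close>, so the arc must not run past 3/8 or 5/8. On the other
        circles the whole open edge lies in \<open>D\<close>.\<close>
      define A where "A = (if 2 < i then {0<..<1} else if t < 3/8 then {0<..<3/8} else {5/8<..<1::real})"
      have A: "open A" "A \<subseteq> {0<..<1}" by (auto simp: A_def)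
      have tA: "t \<in> A" using 2 c ell_in_earring_Uinf[OF 2(1-3), of 2] by (auto simp: A_def)
      have "\<exists>W\<subseteq>D. openin hat_top W \<and> e \<in> W \<and> inj_on qmap W \<and> ell i ` A \<subseteq> qmap ` W"
        if e: "e \<in> D" "qmap e \<in> ell i ` A" for e
      proof -
        obtain t' where t': "t' \<in> A" "qmap e = ell i t'" using e(2) by blast
        then have t'01: "0 < t'" "t' < 1" using A by auto
        have es: "e \<in> hat_space w" using e(1) Dspace by blast
        obtain a j b s where abi: "e = Inner (a, j, b) s"
          using ell_nonzero[OF 2(1) t'01] t'(2) by (cases e) auto
        then have s: "(a, j, b) \<in> hat_edges w" "0 < s" "s < 1" using es by (auto simp: Inner_in_hat_space)
        then have ji: "j = i" "s = t'"
          using t' abi ell_inject[OF hat_edgeD(3)[OF s(1)] s(2,3) 2(1) t'01] by auto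
        have ed: "(a, i, b) \<in> hat_edges w" using s ji by simp
        have "Inner (a, i, b) ` A \<subseteq> D"
        proof (cases "2 < i")
          case True
          have "a \<in> V \<or> b \<in> V"
            using e(1) abi ji by (auto simp: D_def Inner_in_hat_Uv)
          then have "a \<in> V" using ends[OF ed] True by auto
          then show ?thesis using ed A(2) True by (auto simp: D_def Inner_in_hat_space)
        next
          case False
          then obtain u where u: "u \<in> V" "e \<in> hat_Uv w u" using e(1) abi ji by (auto simp: D_def)
          \<comment> \<open>As \<open>nv\<close> is at least 2, no loop labelled 1 or 2 is contained
            in a vertex neighbourhood as a whole.\<close>
          moreover have "\<not> nv w u < i" using False nv_bounds(1) u(1) V(2) by fastforce
          ultimately have "a = u \<and> t' < 3/8 \<or> b = u \<and> 5/8 < t'"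
            using abi ji by (auto simp: Inner_in_hat_Uv)
          then have "Inner (a, i, b) ` A \<subseteq> hat_Uv w u"
            using ed t'(1) False by (auto simp: A_def Inner_in_hat_Uv split: if_splits)
          then show ?thesis using u by (auto simp: D_def)
        qed
        then show ?thesis
          using edge_sheet[OF ed A] abi ji t'(1)
          by (intro exI[of _ "Inner (a, i, b) ` A"]) auto
      qed
      then show ?thesis
        using openin_ell_image[OF 2(1) A] tA 2(4) by (intro exI[of _ "ell i ` A"]) simp
    qed
  qed
  moreover have "p \<in> D" using p V(1) by (auto simp: D_def)
  ultimately show ?thesis by blast
qed

text \<open>The index 2 in \<open>earring_Uinf 2\<close> is dictated by the tree: edges labelled 1
  and 2 leave the sets \<open>Yset w j\<close>, so the middle arcs of these two circles have to be
  excluded, and no others.\<close>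

lemma earring_covered:
  assumes "c \<in> earring"
  shows "\<exists>U. openin (top_of_set earring) U \<and> c \<in> U \<and>
    (\<forall>e\<in>topspace hat_top. qmap e \<in> U \<longrightarrow>
      (\<exists>D. e \<in> D \<and> covers_within hat_top (top_of_set earring) qmap D U))"
  using assms
proof (cases rule: earring_cases)
  case 1
  have "\<exists>D. e \<in> D \<and> covers_within hat_top (top_of_set earring) qmap D (earring_Uinf 2)"
    if e: "e \<in> hat_space w" "qmap e \<in> earring_Uinf 2" for e
  proof (cases e)
    case (Vertex v)
    then have v: "v \<in> Gamma_star w" using e by (simp add: Vertex_in_hat_space)
    then have "e \<in> hat_Uv w v" using Vertex Vertex_in_hat_Uv by simp
    then show ?thesis by (intro earring_base_covered[OF v] disjI1)
  next
    case (Inner e' t)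
    obtain a i b where abi: "e' = (a, i, b)" by (cases e')
    have ed: "(a, i, b) \<in> hat_edges w" "0 < t" "t < 1" using e Inner abi by (auto simp: Inner_in_hat_space)
    note ab = hat_edgeD(1,2)[OF ed(1)]
    have "2 < i \<or> t < 3/8 \<or> 5/8 < t"
      using e(2) ed Inner abi ell_in_earring_Uinf[OF hat_edgeD(3)[OF ed(1)]] by simp
    then consider "3 \<le> i" | "e \<in> hat_Uv w a" | "e \<in> hat_Uv w b"
      using ed by (auto simp: Inner abi Inner_in_hat_Uv)
    then show ?thesis
    proof cases
      case 1
      then show ?thesis using e(1) Inner abi by (intro earring_base_covered[OF ab(1)]) simp
    next
      case 2
      then show ?thesis by (intro earring_base_covered[OF ab(1)] disjI1)
    next
      case 3
      then show ?thesis by (intro earring_base_covered[OF ab(2)] disjI1)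
    qed
  qed
  then show ?thesis
    using 1 zero_in_earring_Uinf openin_earring_Uinf by (auto simp: topspace_hat_top)
next
  case (2 i t)
  then have "c \<in> ell i ` {0<..<1}" by auto
  then show ?thesis
    using earring_circle_covered[OF 2(1)] openin_ell_image[OF 2(1), of "{0<..<1}"]
    by (intro exI[of _ "ell i ` {0<..<1}"]) (auto simp: topspace_hat_top)
qed

lemma hat_top_sheet: "p \<in> topspace hat_top \<Longrightarrow> \<exists>W. openin hat_top W \<and> p \<in> W \<and> inj_on qmap W"
  using hat_space_cover[of p] openin_hat_top_Ue openin_hat_top_Uv inj_on_hat_Ue inj_on_hat_Uv
  unfolding topspace_hat_top by meson

lemma K_group_open_subgroup:
  "subgroup (K_group w) (pi1 (top_of_set earring) (0, 0))"
  "openin (pi1_topology (top_of_set earring) (0, 0)) (K_group w)"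
  unfolding K_group_def hat_topology_eq
  by (rule pi1_map_image_open_subgroup[OF continuous_map_qmap open_map_qmap hat_top_sheet earring_covered];
      simp add: topspace_hat_top Vertex_in_hat_space Nil_in_Gamma_star)+

end

theorem proposition4p1:
  fixes w :: "nat \<Rightarrow> word"
  assumes complete_list: "w ` {1..} = {x \<in> words. x \<noteq> []}"
  shows "subgroup (K_group w) (pi1 (top_of_set earring) (0, 0)) \<and>
    openin (pi1_topology (top_of_set earring) (0, 0)) (K_group w)"
proof -
  interpret word_sequence w
    by unfold_locales (use complete_list in auto)
  show ?thesis using K_group_open_subgroup by blast
qed

end
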